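(* Let $\Upsilon:\mathfrak{Q}\to\mathfrak{R}$, $\Upsilon^{\diamond}$, $\Upsilon^{\star}$ be as defined in the context. For a quiver $Q$ and an incidence hypergraph $G$, the Frobenius morphism $\Phi:\Upsilon^{\diamond}(\Upsilon(Q)\times G)\to Q\times\Upsilon^{\diamond}(G)$ in $\mathfrak{Q}$ is given by $\overrightarrow{V}(\Phi)(n,v,x)=(v,n,x)$ and $\overrightarrow{E}(\Phi)=\mathrm{id}_{\overrightarrow{E}(Q)\times I(G)}$. Moreover, $(\Upsilon^{\diamond},\Upsilon,\Upsilon^{\star})$ is an atomic geometric surjection from $\mathfrak{R}$ to $\mathfrak{Q}$ which is not an embedding. Furthermore, $\Upsilon^{\diamond}$ is faithful, and $\mathfrak{R}$ is equivalent to the slice category $\mathfrak{Q}/\overrightarrow{E}^{\diamond}(\{1\})$.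
   Context: A quiver $Q$ consists of sets $\overrightarrow{V}(Q)$, $\overrightarrow{E}(Q)$ and functions $\sigma_Q,\tau_Q:\overrightarrow{E}(Q)\to\overrightarrow{V}(Q)$; morphisms are pairs of functions commuting with $\sigma,\tau$; category $\mathfrak{Q}$, products componentwise. An incidence hypergraph $G$ consists of sets $\check V(G)$, $\check E(G)$, $I(G)$ and functions $\varsigma_G:I(G)\to\check V(G)$, $\omega_G:I(G)\to\check E(G)$; morphisms are triples of functions commuting with $\varsigma,\omega$; category $\mathfrak{R}$, products componentwise. $\Upsilon(Q)$ is the incidence hypergraph with $\check V=\check E=\overrightarrow{V}(Q)$, $I=\overrightarrow{E}(Q)$, $\varsigma=\sigma_Q$, $\omega=\tau_Q$, and $\Upsilon(\phi)=(\overrightarrow{V}(\phi),\overrightarrow{V}(\phi),\overrightarrow{E}(\phi))$. Its left adjoint $\Upsilon^{\diamond}(G)$ is the quiver with vertex set $(\{1\}\times\check V(G))\cup(\{2\}\times\check E(G))$, edge set $I(G)$, source $i\mapsto(1,\varsigma_G(i))$, target $i\mapsto(2,\omega_G(i))$; its right adjoint $\Upsilon^{\star}(G)$ is the quiver with vertices $\check V(G)\times\check E(G)$, edges $\check V(G)\times I(G)\times\check E(G)$, source $(v,i,e)\mapsto(\varsigma_G(i),e)$, target $(v,i,e)\mapsto(v,\omega_G(i))$. The counit $\Upsilon^{\diamond}\Upsilon(Q)\to Q$ is $(n,v)\mapsto v$ on vertices and the identity on edges. Vertices of $\Upsilon^{\diamond}(\Upsilon(Q)\times G)$ are written $(1,v,x)$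 with $v\in\overrightarrow{V}(Q),x\in\check V(G)$ or $(2,v,x)$ with $x\in\check E(G)$. $\overrightarrow{E}^{\diamond}(\{1\})$ is the quiver with two vertices and one edge between them (directed path of length 1). For an adjunction $L\dashv F$ with $F$ preserving products and counit $\varepsilon$, the Frobenius morphism $L(F(A)\times B)\to A\times L(B)$ has components $\varepsilon_A\circ L(\pi_{F(A)})$ and $L(\pi_B)$. A triple $(L,F,F^\star)$ with $L\dashv F\dashv F^\star$, $F:\mathcal{F}\to\mathcal{E}$ between topoi, is an essential geometric morphism $\mathcal{E}\to\mathcal{F}$ with inverse image $F$; it is atomic if $F$ is logical, a surjection if $F$ is faithful, an embedding if $F^\star$ is full and faithful. *)

theory Defs
  imports Main "HOL-Library.FuncSet" "HOL-Library.Equipollence" "HOL-Library.Nat_Bijection"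
begin

section \<open>A universe of small sets\<close>

text \<open>
  HOL has no type of all sets, so the category of sets is rendered relative to a universe: a type
  whose cardinality is a strong limit, the (small) sets being its subsets of strictly smaller
  cardinality. If the cardinality of the type is inaccessible, these are, up to
  equivalence, the sets of a Grothendieck universe. Neither regularity nor uncountability is
  imposed; infinity follows from the pairing and the two distinct tags.
  The pairing codes ordered pairs (and, nested to the right, triples) as elements of the universe;
  the tags code the labels 1 and 2 of disjoint unions.
\<close>

class set_universe =
  fixes pr :: "'a \<Rightarrow> 'a \<Rightarrow> 'a"
    and tag1 tag2 :: 'a
  assumes pr_inject: "pr a b = pr c d \<longleftrightarrow> a = c \<and> b = d"
    and tag1_neq_tag2: "tag1 \<noteq> tag2"
    and strong_limit: "A \<prec> (UNIV :: 'a set) \<Longrightarrow> Pow A \<prec> (UNIV :: 'a set)"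

text \<open>The class is inhabited; in this instance small means finite.\<close>

instantiation nat :: set_universe
begin

definition pr_nat :: "nat \<Rightarrow> nat \<Rightarrow> nat" where "pr_nat a b = prod_encode (a, b)"
definition tag1_nat :: nat where "tag1_nat = 1"
definition tag2_nat :: nat where "tag2_nat = 2"

instance
proof
  fix A :: "nat set"
  assume "A \<prec> (UNIV :: nat set)"
  then have "finite A"
    using countable_lesspoll infinite_le_lepoll lesspoll_def lepoll_antisym
    by (metis infinite_UNIV_nat subset_UNIV subset_imp_lepoll)
  then show "Pow A \<prec> (UNIV :: nat set)"
    by (simp add: finite_lesspoll_infinite)
qed (auto simp: pr_nat_def tag1_nat_def tag2_nat_def)

end

definition small :: "'a set \<Rightarrow> bool"
  where "small A \<longleftrightarrow> A \<prec> (UNIV :: 'a set)"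

definition pfst :: "'a::set_universe \<Rightarrow> 'a"
  where "pfst z = (THE a. \<exists>b. z = pr a b)"

definition psnd :: "'a::set_universe \<Rightarrow> 'a"
  where "psnd z = (THE b. \<exists>a. z = pr a b)"

definition ptimes :: "'a::set_universe set \<Rightarrow> 'a set \<Rightarrow> 'a set"  (infixr "\<otimes>" 70)
  where "A \<otimes> B = {pr a b | a b. a \<in> A \<and> b \<in> B}"

definition pmap :: "('a::set_universe \<Rightarrow> 'a) \<Rightarrow> ('a \<Rightarrow> 'a) \<Rightarrow> 'a \<Rightarrow> 'a"
  where "pmap f g z = pr (f (pfst z)) (g (psnd z))"


section \<open>Categories, functors, adjunctions\<close>

record ('o, 'm) cat =
  Obj :: "'o set"
  Arr :: "'m set"
  Dom :: "'m \<Rightarrow> 'o"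
  Cod :: "'m \<Rightarrow> 'o"
  Id  :: "'o \<Rightarrow> 'm"
  Comp :: "'m \<Rightarrow> 'm \<Rightarrow> 'm"  (infixr "\<cdot>\<index>" 75)

definition Hom :: "('o, 'm) cat \<Rightarrow> 'o \<Rightarrow> 'o \<Rightarrow> 'm set"
  where "Hom C a b = {f \<in> Arr C. Dom C f = a \<and> Cod C f = b}"

locale category =
  fixes C :: "('o, 'm) cat" (structure)
  assumes Dom_Obj: "f \<in> Arr C \<Longrightarrow> Dom C f \<in> Obj C"
    and Cod_Obj: "f \<in> Arr C \<Longrightarrow> Cod C f \<in> Obj C"
    and Id_Hom: "a \<in> Obj C \<Longrightarrow> Id C a \<in> Hom C a a"
    and Comp_Hom: "f \<in> Hom C a b \<Longrightarrow> g \<in> Hom C b c \<Longrightarrow> g \<cdot> f \<in> Hom C a c"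
    and Id_left: "f \<in> Hom C a b \<Longrightarrow> Id C b \<cdot> f = f"
    and Id_right: "f \<in> Hom C a b \<Longrightarrow> f \<cdot> Id C a = f"
    and Comp_assoc: "f \<in> Hom C a b \<Longrightarrow> g \<in> Hom C b c \<Longrightarrow> h \<in> Hom C c d
      \<Longrightarrow> (h \<cdot> g) \<cdot> f = h \<cdot> (g \<cdot> f)"

record ('o1, 'm1, 'o2, 'm2) functr =
  FO :: "'o1 \<Rightarrow> 'o2"
  FA :: "'m1 \<Rightarrow> 'm2"

definition is_functor ::
  "('o1, 'm1) cat \<Rightarrow> ('o2, 'm2) cat \<Rightarrow> ('o1, 'm1, 'o2, 'm2) functr \<Rightarrow> bool"
  where "is_functor C D F \<longleftrightarrow> category C \<and> category D
    \<and> (\<forall>a \<in> Obj C. FO F a \<in> Obj D)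
    \<and> (\<forall>a \<in> Obj C. \<forall>b \<in> Obj C. \<forall>f \<in> Hom C a b. FA F f \<in> Hom D (FO F a) (FO F b))
    \<and> (\<forall>a \<in> Obj C. FA F (Id C a) = Id D (FO F a))
    \<and> (\<forall>f \<in> Arr C. \<forall>g \<in> Arr C. Cod C f = Dom C g \<longrightarrow>
          FA F (g \<cdot>\<^bsub>C\<^esub> f) = FA F g \<cdot>\<^bsub>D\<^esub> FA F f)"

definition idfun :: "('o, 'm, 'o, 'm) functr"
  where "idfun = \<lparr>FO = (\<lambda>a. a), FA = (\<lambda>f. f)\<rparr>"

definition fcomp :: "('o2, 'm2, 'o3, 'm3) functr \<Rightarrow> ('o1, 'm1, 'o2, 'm2) functr
    \<Rightarrow> ('o1, 'm1, 'o3, 'm3) functr"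
  where "fcomp G F = \<lparr>FO = FO G \<circ> FO F, FA = FA G \<circ> FA F\<rparr>"

definition faithful_functor where
  "faithful_functor C D F \<longleftrightarrow> is_functor C D F
    \<and> (\<forall>a \<in> Obj C. \<forall>b \<in> Obj C. inj_on (FA F) (Hom C a b))"

definition full_functor where
  "full_functor C D F \<longleftrightarrow> is_functor C D F
    \<and> (\<forall>a \<in> Obj C. \<forall>b \<in> Obj C. FA F ` Hom C a b = Hom D (FO F a) (FO F b))"

definition natural_trans ::
  "('o1, 'm1) cat \<Rightarrow> ('o2, 'm2) cat \<Rightarrow> ('o1, 'm1, 'o2, 'm2) functr
    \<Rightarrow> ('o1, 'm1, 'o2, 'm2) functr \<Rightarrow> ('o1 \<Rightarrow> 'm2) \<Rightarrow> bool"
  where "natural_trans C D F G t \<longleftrightarrow> is_functor C D F \<and> is_functor C D G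
    \<and> (\<forall>a \<in> Obj C. t a \<in> Hom D (FO F a) (FO G a))
    \<and> (\<forall>f \<in> Arr C. t (Cod C f) \<cdot>\<^bsub>D\<^esub> FA F f = FA G f \<cdot>\<^bsub>D\<^esub> t (Dom C f))"

definition is_iso :: "('o, 'm) cat \<Rightarrow> 'm \<Rightarrow> bool"
  where "is_iso C f \<longleftrightarrow> f \<in> Arr C \<and> (\<exists>g \<in> Hom C (Cod C f) (Dom C f).
    g \<cdot>\<^bsub>C\<^esub> f = Id C (Dom C f) \<and> f \<cdot>\<^bsub>C\<^esub> g = Id C (Cod C f))"

definition natural_iso where
  "natural_iso C D F G t \<longleftrightarrow> natural_trans C D F G t \<and> (\<forall>a \<in> Obj C. is_iso D (t a))"

definition equivalent_categories :: "('o1, 'm1) cat \<Rightarrow> ('o2, 'm2) cat \<Rightarrow> bool"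
  where "equivalent_categories C D \<longleftrightarrow> (\<exists>F G s t. is_functor C D F \<and> is_functor D C G
    \<and> natural_iso C C idfun (fcomp G F) s \<and> natural_iso D D (fcomp F G) idfun t)"

text \<open>\<open>adjunction C D L R \<eta> \<epsilon>\<close>: the functor \<open>L\<close> from \<open>C\<close> to \<open>D\<close> is left adjoint to \<open>R\<close>.\<close>

definition adjunction ::
  "('o1, 'm1) cat \<Rightarrow> ('o2, 'm2) cat \<Rightarrow> ('o1, 'm1, 'o2, 'm2) functr
    \<Rightarrow> ('o2, 'm2, 'o1, 'm1) functr \<Rightarrow> ('o1 \<Rightarrow> 'm1) \<Rightarrow> ('o2 \<Rightarrow> 'm2) \<Rightarrow> bool"
  where "adjunction C D L R \<eta> \<epsilon> \<longleftrightarrow> is_functor C D L \<and> is_functor D C R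
    \<and> natural_trans C C idfun (fcomp R L) \<eta> \<and> natural_trans D D (fcomp L R) idfun \<epsilon>
    \<and> (\<forall>a \<in> Obj C. \<epsilon> (FO L a) \<cdot>\<^bsub>D\<^esub> FA L (\<eta> a) = Id D (FO L a))
    \<and> (\<forall>b \<in> Obj D. FA R (\<epsilon> b) \<cdot>\<^bsub>C\<^esub> \<eta> (FO R b) = Id C (FO R b))"

definition left_adjoint where
  "left_adjoint C D L R \<longleftrightarrow> (\<exists>\<eta> \<epsilon>. adjunction C D L R \<eta> \<epsilon>)"

text \<open>An arrow of the slice from \<open>f\<close> to \<open>g\<close> is a triple \<open>(f, h, g)\<close> with \<open>g \<cdot> h = f\<close>.\<close>

definition slice :: "('o, 'm) cat \<Rightarrow> 'o \<Rightarrow> ('m, 'm \<times> 'm \<times> 'm) cat"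
  where "slice C x =
    \<lparr>Obj = {f \<in> Arr C. Cod C f = x},
     Arr = {(f, h, g). f \<in> Arr C \<and> Cod C f = x \<and> g \<in> Arr C \<and> Cod C g = x
              \<and> h \<in> Hom C (Dom C f) (Dom C g) \<and> g \<cdot>\<^bsub>C\<^esub> h = f},
     Dom = (\<lambda>(f, h, g). f),
     Cod = (\<lambda>(f, h, g). g),
     Id = (\<lambda>f. (f, Id C (Dom C f), f)),
     Comp = (\<lambda>(f', h', g') (f, h, g). (f, h' \<cdot>\<^bsub>C\<^esub> h, g'))\<rparr>"


section \<open>Limits, exponentials, subobject classifiers\<close>

definition is_cone where
  "is_cone J C D x p \<longleftrightarrow> x \<in> Obj C \<and> (\<forall>j \<in> Obj J. p j \<in> Hom C x (FO D j))
    \<and> (\<forall>u \<in> Arr J. FA D u \<cdot>\<^bsub>C\<^esub> p (Dom J u) = p (Cod J u))"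

definition is_limit ::
  "('i, 'k) cat \<Rightarrow> ('o, 'm) cat \<Rightarrow> ('i, 'k, 'o, 'm) functr \<Rightarrow> 'o \<Rightarrow> ('i \<Rightarrow> 'm) \<Rightarrow> bool"
  where "is_limit J C D x p \<longleftrightarrow> is_functor J C D \<and> is_cone J C D x p
    \<and> (\<forall>y q. is_cone J C D y q \<longrightarrow>
          (\<exists>!h. h \<in> Hom C y x \<and> (\<forall>j \<in> Obj J. p j \<cdot>\<^bsub>C\<^esub> h = q j)))"

text \<open>Every finite category is isomorphic to one whose objects and arrows are natural numbers.\<close>

definition finite_category :: "(nat, nat) cat \<Rightarrow> bool"
  where "finite_category J \<longleftrightarrow> category J \<and> finite (Obj J) \<and> finite (Arr J)"

definition has_finite_limits where
  "has_finite_limits C \<longleftrightarrow> (\<forall>J D. finite_category J \<longrightarrow> is_functor J C D \<longrightarrow>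
    (\<exists>x p. is_limit J C D x p))"

definition preserves_finite_limits where
  "preserves_finite_limits C E F \<longleftrightarrow> (\<forall>J D x p. finite_category J \<longrightarrow> is_limit J C D x p \<longrightarrow>
    is_limit J E (fcomp F D) (FO F x) (\<lambda>j. FA F (p j)))"

definition is_terminal where
  "is_terminal C t \<longleftrightarrow> t \<in> Obj C \<and> (\<forall>x \<in> Obj C. \<exists>!f. f \<in> Hom C x t)"

definition is_product :: "('o, 'm) cat \<Rightarrow> 'o \<Rightarrow> 'o \<Rightarrow> 'o \<Rightarrow> 'm \<Rightarrow> 'm \<Rightarrow> bool"
  where "is_product C a b P p1 p2 \<longleftrightarrow> a \<in> Obj C \<and> b \<in> Obj C \<and> P \<in> Obj C
    \<and> p1 \<in> Hom C P a \<and> p2 \<in> Hom C P b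
    \<and> (\<forall>x \<in> Obj C. \<forall>f \<in> Hom C x a. \<forall>g \<in> Hom C x b.
          \<exists>!h. h \<in> Hom C x P \<and> p1 \<cdot>\<^bsub>C\<^esub> h = f \<and> p2 \<cdot>\<^bsub>C\<^esub> h = g)"

text \<open>\<open>p1, p2\<close> is a pullback of the cospan \<open>f, g\<close>.\<close>

definition is_pullback :: "('o, 'm) cat \<Rightarrow> 'm \<Rightarrow> 'm \<Rightarrow> 'm \<Rightarrow> 'm \<Rightarrow> bool"
  where "is_pullback C f g p1 p2 \<longleftrightarrow> f \<in> Arr C \<and> g \<in> Arr C \<and> Cod C f = Cod C g
    \<and> p1 \<in> Arr C \<and> p2 \<in> Hom C (Dom C p1) (Dom C g) \<and> Cod C p1 = Dom C f
    \<and> f \<cdot>\<^bsub>C\<^esub> p1 = g \<cdot>\<^bsub>C\<^esub> p2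
    \<and> (\<forall>x \<in> Obj C. \<forall>q1 \<in> Hom C x (Dom C f). \<forall>q2 \<in> Hom C x (Dom C g).
          f \<cdot>\<^bsub>C\<^esub> q1 = g \<cdot>\<^bsub>C\<^esub> q2 \<longrightarrow>
          (\<exists>!h. h \<in> Hom C x (Dom C p1) \<and> p1 \<cdot>\<^bsub>C\<^esub> h = q1 \<and> p2 \<cdot>\<^bsub>C\<^esub> h = q2))"

text \<open>\<open>X\<close> with evaluation \<open>ev\<close>, defined on the product \<open>(P, p1, p2)\<close> of \<open>X\<close> and \<open>a\<close>, is an
  exponential of \<open>b\<close> by \<open>a\<close>. Below, \<open>k\<close> is the arrow \<open>g \<times> a\<close>.\<close>

definition is_exponential ::
  "('o, 'm) cat \<Rightarrow> 'o \<Rightarrow> 'o \<Rightarrow> 'o \<Rightarrow> 'o \<Rightarrow> 'm \<Rightarrow> 'm \<Rightarrow> 'm \<Rightarrow> bool"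
  where "is_exponential C a b X P p1 p2 ev \<longleftrightarrow> is_product C X a P p1 p2 \<and> ev \<in> Hom C P b
    \<and> (\<forall>z R r1 r2 f. is_product C z a R r1 r2 \<longrightarrow> f \<in> Hom C R b \<longrightarrow>
          (\<exists>!g. g \<in> Hom C z X \<and>
             (\<exists>k \<in> Hom C R P. p1 \<cdot>\<^bsub>C\<^esub> k = g \<cdot>\<^bsub>C\<^esub> r1 \<and> p2 \<cdot>\<^bsub>C\<^esub> k = r2 \<and> ev \<cdot>\<^bsub>C\<^esub> k = f)))"

definition has_exponentials where
  "has_exponentials C \<longleftrightarrow> (\<forall>a \<in> Obj C. \<forall>b \<in> Obj C.
    \<exists>X P p1 p2 ev. is_exponential C a b X P p1 p2 ev)"

definition preserves_exponentials where
  "preserves_exponentials C E F \<longleftrightarrow> (\<forall>a b X P p1 p2 ev. is_exponential C a b X P p1 p2 ev \<longrightarrow>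
    is_exponential E (FO F a) (FO F b) (FO F X) (FO F P) (FA F p1) (FA F p2) (FA F ev))"

definition is_mono :: "('o, 'm) cat \<Rightarrow> 'm \<Rightarrow> bool"
  where "is_mono C m \<longleftrightarrow> m \<in> Arr C
    \<and> (\<forall>x \<in> Obj C. \<forall>f \<in> Hom C x (Dom C m). \<forall>g \<in> Hom C x (Dom C m).
          m \<cdot>\<^bsub>C\<^esub> f = m \<cdot>\<^bsub>C\<^esub> g \<longrightarrow> f = g)"

definition is_subobject_classifier :: "('o, 'm) cat \<Rightarrow> 'o \<Rightarrow> 'm \<Rightarrow> bool"
  where "is_subobject_classifier C \<Omega> tr \<longleftrightarrow> tr \<in> Arr C \<and> Cod C tr = \<Omega> \<and> is_terminal C (Dom C tr)
    \<and> (\<forall>m. is_mono C m \<longrightarrow>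
          (\<exists>!\<chi>. \<chi> \<in> Hom C (Cod C m) \<Omega> \<and>
             (\<exists>u \<in> Hom C (Dom C m) (Dom C tr). is_pullback C \<chi> tr m u)))"

definition has_subobject_classifier where
  "has_subobject_classifier C \<longleftrightarrow> (\<exists>\<Omega> tr. is_subobject_classifier C \<Omega> tr)"

definition preserves_subobject_classifier where
  "preserves_subobject_classifier C E F \<longleftrightarrow> (\<forall>\<Omega> tr. is_subobject_classifier C \<Omega> tr \<longrightarrow>
    is_subobject_classifier E (FO F \<Omega>) (FA F tr))"


section \<open>Topoi and geometric morphisms\<close>

definition topos :: "('o, 'm) cat \<Rightarrow> bool"
  where "topos C \<longleftrightarrow> category C \<and> has_finite_limits C \<and> has_exponentials C
    \<and> has_subobject_classifier C"

definition logical_functor where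
  "logical_functor C E F \<longleftrightarrow> is_functor C E F \<and> preserves_finite_limits C E F
    \<and> preserves_exponentials C E F \<and> preserves_subobject_classifier C E F"

text \<open>An essential geometric morphism \<open>(L, F, R)\<close> from the topos \<open>E\<close> to the topos \<open>B\<close>; the
  inverse image \<open>F\<close> goes from \<open>B\<close> to \<open>E\<close>. It preserves finite limits, being a right adjoint.\<close>

definition essential_geometric_morphism ::
  "('o1, 'm1) cat \<Rightarrow> ('o2, 'm2) cat \<Rightarrow> ('o1, 'm1, 'o2, 'm2) functr
    \<Rightarrow> ('o2, 'm2, 'o1, 'm1) functr \<Rightarrow> ('o1, 'm1, 'o2, 'm2) functr \<Rightarrow> bool"
  where "essential_geometric_morphism E B L F R \<longleftrightarrow> topos E \<and> topos B
    \<and> left_adjoint E B L F \<and> left_adjoint B E F R"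

definition geom_atomic where
  "geom_atomic E B L F R \<longleftrightarrow> essential_geometric_morphism E B L F R \<and> logical_functor B E F"

definition geom_surjection where
  "geom_surjection E B L F R \<longleftrightarrow> essential_geometric_morphism E B L F R \<and> faithful_functor B E F"

definition geom_embedding where
  "geom_embedding E B L F R \<longleftrightarrow> essential_geometric_morphism E B L F R
    \<and> full_functor E B R \<and> faithful_functor E B R"

text \<open>\<open>h\<close> is the Frobenius morphism \<open>L (F a \<times> b) \<rightarrow> a \<times> L b\<close> of the adjunction between \<open>L\<close> and
  \<open>F\<close> with counit \<open>\<epsilon>\<close>, for the product \<open>(P, p1, p2)\<close> of \<open>F a\<close> and \<open>b\<close> and the product
  \<open>(T, t1, t2)\<close> of \<open>a\<close> and \<open>L b\<close>.\<close>

definition is_frobenius_morphism ::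
  "('o1, 'm1) cat \<Rightarrow> ('o2, 'm2) cat \<Rightarrow> ('o1, 'm1, 'o2, 'm2) functr
    \<Rightarrow> ('o2, 'm2, 'o1, 'm1) functr \<Rightarrow> ('o2 \<Rightarrow> 'm2) \<Rightarrow> 'o2 \<Rightarrow> 'o1
    \<Rightarrow> 'o1 \<times> 'm1 \<times> 'm1 \<Rightarrow> 'o2 \<times> 'm2 \<times> 'm2 \<Rightarrow> 'm2 \<Rightarrow> bool"
  where "is_frobenius_morphism E B L F \<epsilon> a b = (\<lambda>(P, p1, p2) (T, t1, t2) h.
      (\<exists>\<eta>. adjunction E B L F \<eta> \<epsilon>)
    \<and> is_product E (FO F a) b P p1 p2 \<and> is_product B a (FO L b) T t1 t2
    \<and> h \<in> Hom B (FO L P) T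
    \<and> t1 \<cdot>\<^bsub>B\<^esub> h = \<epsilon> a \<cdot>\<^bsub>B\<^esub> FA L p1
    \<and> t2 \<cdot>\<^bsub>B\<^esub> h = FA L p2)"


section \<open>Quivers\<close>

record 'a quiver =
  Vert :: "'a set"
  Edge :: "'a set"
  src :: "'a \<Rightarrow> 'a"
  tgt :: "'a \<Rightarrow> 'a"

record 'a quiver_hom =
  qdom :: "'a quiver"
  qcod :: "'a quiver"
  onV :: "'a \<Rightarrow> 'a"
  onE :: "'a \<Rightarrow> 'a"

text \<open>Functions between sets are extensional, so that equality of arrows is equality of functions
  on the carriers.\<close>

definition quivers :: "('a::set_universe) quiver set"
  where "quivers = {Q. small (Vert Q) \<and> small (Edge Q)
    \<and> src Q \<in> Edge Q \<rightarrow>\<^sub>E Vert Q \<and> tgt Q \<in> Edge Q \<rightarrow>\<^sub>E Vert Q}"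

definition quiver_homs :: "('a::set_universe) quiver_hom set"
  where "quiver_homs = {\<phi>. qdom \<phi> \<in> quivers \<and> qcod \<phi> \<in> quivers
    \<and> onV \<phi> \<in> Vert (qdom \<phi>) \<rightarrow>\<^sub>E Vert (qcod \<phi>)
    \<and> onE \<phi> \<in> Edge (qdom \<phi>) \<rightarrow>\<^sub>E Edge (qcod \<phi>)
    \<and> (\<forall>e \<in> Edge (qdom \<phi>). src (qcod \<phi>) (onE \<phi> e) = onV \<phi> (src (qdom \<phi>) e)
                         \<and> tgt (qcod \<phi>) (onE \<phi> e) = onV \<phi> (tgt (qdom \<phi>) e))}"

definition Quiv :: "('a::set_universe quiver, 'a quiver_hom) cat"
  where "Quiv =
    \<lparr>Obj = quivers,
     Arr = quiver_homs,
     Dom = qdom,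
     Cod = qcod,
     Id = (\<lambda>Q. \<lparr>qdom = Q, qcod = Q, onV = (\<lambda>v \<in> Vert Q. v), onE = (\<lambda>e \<in> Edge Q. e)\<rparr>),
     Comp = (\<lambda>\<psi> \<phi>. \<lparr>qdom = qdom \<phi>, qcod = qcod \<psi>,
                     onV = compose (Vert (qdom \<phi>)) (onV \<psi>) (onV \<phi>),
                     onE = compose (Edge (qdom \<phi>)) (onE \<psi>) (onE \<phi>)\<rparr>)\<rparr>"

definition qprod :: "'a::set_universe quiver \<Rightarrow> 'a quiver \<Rightarrow> 'a quiver"
  where "qprod Q R = \<lparr>Vert = Vert Q \<otimes> Vert R, Edge = Edge Q \<otimes> Edge R,
    src = (\<lambda>e \<in> Edge Q \<otimes> Edge R. pmap (src Q) (src R) e),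
    tgt = (\<lambda>e \<in> Edge Q \<otimes> Edge R. pmap (tgt Q) (tgt R) e)\<rparr>"

text \<open>The product together with its two projections.\<close>

definition qprod_cone ::
  "'a::set_universe quiver \<Rightarrow> 'a quiver \<Rightarrow> 'a quiver \<times> 'a quiver_hom \<times> 'a quiver_hom"
  where "qprod_cone Q R = (qprod Q R,
    \<lparr>qdom = qprod Q R, qcod = Q, onV = restrict pfst (Vert Q \<otimes> Vert R),
     onE = restrict pfst (Edge Q \<otimes> Edge R)\<rparr>,
    \<lparr>qdom = qprod Q R, qcod = R, onV = restrict psnd (Vert Q \<otimes> Vert R),
     onE = restrict psnd (Edge Q \<otimes> Edge R)\<rparr>)"

definition dipath1 :: "'a::set_universe quiver"
  where "dipath1 = \<lparr>Vert = {tag1, tag2}, Edge = {tag1},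
    src = (\<lambda>e \<in> {tag1}. tag1), tgt = (\<lambda>e \<in> {tag1}. tag2)\<rparr>"


section \<open>Incidence hypergraphs\<close>

record 'a ihyp =
  HVert :: "'a set"
  HEdge :: "'a set"
  Inc :: "'a set"
  port :: "'a \<Rightarrow> 'a"
  att :: "'a \<Rightarrow> 'a"

record 'a ihyp_hom =
  hdom :: "'a ihyp"
  hcod :: "'a ihyp"
  onHV :: "'a \<Rightarrow> 'a"
  onHE :: "'a \<Rightarrow> 'a"
  onI :: "'a \<Rightarrow> 'a"

text \<open>\<open>port\<close> is the function \<open>\<sigma>\<close> from incidences to vertices, \<open>att\<close> the function \<open>\<omega>\<close> from
  incidences to edges.\<close>

definition ihyps :: "('a::set_universe) ihyp set"
  where "ihyps = {G. small (HVert G) \<and> small (HEdge G) \<and> small (Inc G)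
    \<and> port G \<in> Inc G \<rightarrow>\<^sub>E HVert G \<and> att G \<in> Inc G \<rightarrow>\<^sub>E HEdge G}"

definition ihyp_homs :: "('a::set_universe) ihyp_hom set"
  where "ihyp_homs = {\<phi>. hdom \<phi> \<in> ihyps \<and> hcod \<phi> \<in> ihyps
    \<and> onHV \<phi> \<in> HVert (hdom \<phi>) \<rightarrow>\<^sub>E HVert (hcod \<phi>)
    \<and> onHE \<phi> \<in> HEdge (hdom \<phi>) \<rightarrow>\<^sub>E HEdge (hcod \<phi>)
    \<and> onI \<phi> \<in> Inc (hdom \<phi>) \<rightarrow>\<^sub>E Inc (hcod \<phi>)
    \<and> (\<forall>i \<in> Inc (hdom \<phi>). port (hcod \<phi>) (onI \<phi> i) = onHV \<phi> (port (hdom \<phi>) i)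
                        \<and> att (hcod \<phi>) (onI \<phi> i) = onHE \<phi> (att (hdom \<phi>) i))}"

definition IncHyp :: "('a::set_universe ihyp, 'a ihyp_hom) cat"
  where "IncHyp =
    \<lparr>Obj = ihyps,
     Arr = ihyp_homs,
     Dom = hdom,
     Cod = hcod,
     Id = (\<lambda>G. \<lparr>hdom = G, hcod = G, onHV = (\<lambda>v \<in> HVert G. v), onHE = (\<lambda>e \<in> HEdge G. e),
               onI = (\<lambda>i \<in> Inc G. i)\<rparr>),
     Comp = (\<lambda>\<psi> \<phi>. \<lparr>hdom = hdom \<phi>, hcod = hcod \<psi>,
                     onHV = compose (HVert (hdom \<phi>)) (onHV \<psi>) (onHV \<phi>),
                     onHE = compose (HEdge (hdom \<phi>)) (onHE \<psi>) (onHE \<phi>),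
                     onI = compose (Inc (hdom \<phi>)) (onI \<psi>) (onI \<phi>)\<rparr>)\<rparr>"

definition hprod :: "'a::set_universe ihyp \<Rightarrow> 'a ihyp \<Rightarrow> 'a ihyp"
  where "hprod G H = \<lparr>HVert = HVert G \<otimes> HVert H, HEdge = HEdge G \<otimes> HEdge H,
    Inc = Inc G \<otimes> Inc H,
    port = (\<lambda>i \<in> Inc G \<otimes> Inc H. pmap (port G) (port H) i),
    att = (\<lambda>i \<in> Inc G \<otimes> Inc H. pmap (att G) (att H) i)\<rparr>"

definition hprod_cone ::
  "'a::set_universe ihyp \<Rightarrow> 'a ihyp \<Rightarrow> 'a ihyp \<times> 'a ihyp_hom \<times> 'a ihyp_hom"
  where "hprod_cone G H = (hprod G H,
    \<lparr>hdom = hprod G H, hcod = G, onHV = restrict pfst (HVert G \<otimes> HVert H),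
     onHE = restrict pfst (HEdge G \<otimes> HEdge H), onI = restrict pfst (Inc G \<otimes> Inc H)\<rparr>,
    \<lparr>hdom = hprod G H, hcod = H, onHV = restrict psnd (HVert G \<otimes> HVert H),
     onHE = restrict psnd (HEdge G \<otimes> HEdge H), onI = restrict psnd (Inc G \<otimes> Inc H)\<rparr>)"


section \<open>The functor \<open>\<Upsilon>\<close> and its adjoints\<close>

type_synonym 'a quiv_to_ihyp = "('a quiver, 'a quiver_hom, 'a ihyp, 'a ihyp_hom) functr"
type_synonym 'a ihyp_to_quiv = "('a ihyp, 'a ihyp_hom, 'a quiver, 'a quiver_hom) functr"

definition Ups_obj :: "'a::set_universe quiver \<Rightarrow> 'a ihyp"
  where "Ups_obj Q = \<lparr>HVert = Vert Q, HEdge = Vert Q, Inc = Edge Q, port = src Q, att = tgt Q\<rparr>"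

definition Ups :: "'a::set_universe quiv_to_ihyp"
  where "Ups = \<lparr>FO = Ups_obj,
    FA = (\<lambda>\<phi>. \<lparr>hdom = Ups_obj (qdom \<phi>), hcod = Ups_obj (qcod \<phi>),
              onHV = onV \<phi>, onHE = onV \<phi>, onI = onE \<phi>\<rparr>)\<rparr>"

definition Ups_dia_obj :: "'a::set_universe ihyp \<Rightarrow> 'a quiver"
  where "Ups_dia_obj G = \<lparr>Vert = ({tag1} \<otimes> HVert G) \<union> ({tag2} \<otimes> HEdge G), Edge = Inc G,
    src = (\<lambda>i \<in> Inc G. pr tag1 (port G i)), tgt = (\<lambda>i \<in> Inc G. pr tag2 (att G i))\<rparr>"

definition Ups_dia :: "'a::set_universe ihyp_to_quiv"
  where "Ups_dia = \<lparr>FO = Ups_dia_obj,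
    FA = (\<lambda>\<phi>. \<lparr>qdom = Ups_dia_obj (hdom \<phi>), qcod = Ups_dia_obj (hcod \<phi>),
              onV = (\<lambda>z \<in> Vert (Ups_dia_obj (hdom \<phi>)).
                 pr (pfst z) ((if pfst z = tag1 then onHV \<phi> else onHE \<phi>) (psnd z))),
              onE = onI \<phi>\<rparr>)\<rparr>"

definition Ups_star_obj :: "'a::set_universe ihyp \<Rightarrow> 'a quiver"
  where "Ups_star_obj G = \<lparr>Vert = HVert G \<otimes> HEdge G, Edge = HVert G \<otimes> Inc G \<otimes> HEdge G,
    src = (\<lambda>z \<in> HVert G \<otimes> Inc G \<otimes> HEdge G. pr (port G (pfst (psnd z))) (psnd (psnd z))),
    tgt = (\<lambda>z \<in> HVert G \<otimes> Inc G \<otimes> HEdge G. pr (pfst z) (att G (pfst (psnd z))))\<rparr>"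

definition Ups_star :: "'a::set_universe ihyp_to_quiv"
  where "Ups_star = \<lparr>FO = Ups_star_obj,
    FA = (\<lambda>\<phi>. \<lparr>qdom = Ups_star_obj (hdom \<phi>), qcod = Ups_star_obj (hcod \<phi>),
              onV = restrict (pmap (onHV \<phi>) (onHE \<phi>)) (Vert (Ups_star_obj (hdom \<phi>))),
              onE = restrict (pmap (onHV \<phi>) (pmap (onI \<phi>) (onHE \<phi>)))
                      (Edge (Ups_star_obj (hdom \<phi>)))\<rparr>)\<rparr>"

text \<open>The counit of the adjunction between \<open>Ups_dia\<close> and \<open>Ups\<close>.\<close>

definition Ups_counit :: "'a::set_universe quiver \<Rightarrow> 'a quiver_hom"
  where "Ups_counit Q = \<lparr>qdom = Ups_dia_obj (Ups_obj Q), qcod = Q,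
    onV = restrict psnd (Vert (Ups_dia_obj (Ups_obj Q))), onE = (\<lambda>e \<in> Edge Q. e)\<rparr>"

end

theory Submission
  imports Defs
begin

text \<open>Quivers and incidence hypergraphs are both presheaves on a shape with two arrows out of
  an edge sort; they differ only in whether the two arrows have the same target. Every property of a
  category that enters the definition of a logical functor (being a finite limit, an exponential, a
  subobject classifier) is equivalent, in such a category, to a condition on the carrier sets, sort by
  sort. Sufficiency is direct, and necessity follows by comparison with a canonical choice. Since
  \<open>\<Upsilon>\<close> merely lists the vertex set twice, it preserves each of these conditions.\<close>

section \<open>Small sets\<close>

text \<open>A logical functor is asked to preserve every limit, exponential and classifier, not
  chosen ones. An arbitrary one must therefore first be shown to satisfy its pointwise condition, so
  each characterisation has to be an equivalence, and the canonical choices have to be built inside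
  the universe. This is where the strong limit property enters.

  The conditions transfer because an edge has the same surroundings in both shapes: a source, a
  target and itself. At the edge sort an element of an exponential is a triple of functions and a
  truth value is a triple of booleans, and the two end components are independent of each other even
  when both ends have the same sort. At a vertex sort one component remains. Renaming sorts does not
  disturb this local picture.

  Under the slice equivalence proved at the end, \<Upsilon> corresponds to pullback along the arrow
  from \<open>dipath1\<close> to the terminal quiver. The direct computation takes the place of a
  proof that such pullback functors are logical.\<close>

lemma infinite_UNIV_set_universe: "infinite (UNIV :: 'u::set_universe set)"
proof
  assume fin: "finite (UNIV :: 'u set)"
  \<comment> \<open>A finite universe of size n would satisfy n * n \<le> n by the pairing and n
    \<ge> 2 by the tags.\<close>
  have "inj (\<lambda>(a, b). pr a b :: 'u)"
    by (auto simp: inj_def pr_inject)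
  then have "card (UNIV :: ('u \<times> 'u) set) \<le> card (UNIV :: 'u set)"
    using fin card_inj_on_le by blast
  moreover have "card {tag1, tag2 :: 'u} \<le> card (UNIV :: 'u set)"
    by (rule card_mono[OF fin]) simp
  ultimately show False
    by (simp add: card_cartesian_product tag1_neq_tag2 flip: UNIV_Times_UNIV)
qed

lemma finite_lesspoll_UNIV: "finite A \<Longrightarrow> A \<prec> (UNIV :: 'u::set_universe set)"
  by (simp add: finite_lesspoll_infinite infinite_UNIV_set_universe)

lemma lesspoll_subset: "A \<subseteq> B \<Longrightarrow> B \<prec> C \<Longrightarrow> A \<prec> C"
  using lesspoll_trans1 subset_imp_lepoll by blast

lemma lesspoll_image: "A \<prec> C \<Longrightarrow> f ` A \<prec> C"
  using lesspoll_trans1 image_lepoll by blast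

text \<open>Any two sets are comparable in size, so strict domination is the strict order of
  cardinals. This gives access to cardinal arithmetic.\<close>

lemma lesspoll_iff_ordLess: "A \<prec> B \<longleftrightarrow> (card_of A, card_of B) \<in> ordLess"
proof -
  have "A \<lesssim> B \<or> B \<lesssim> A"
    unfolding lepoll_def card_of_ordLeq by (simp add: ordLeq_total card_of_Well_order)
  then have "A \<prec> B \<longleftrightarrow> \<not> B \<lesssim> A"
    unfolding lesspoll_def by (auto intro: lepoll_antisym dest: eqpoll_imp_lepoll eqpoll_sym)
  then show ?thesis
    unfolding lepoll_def card_of_ordLess .
qed

text \<open>The element type is arbitrary here and below, because sets of pairs and of functions
  have to be bounded before they are coded in the universe.\<close>

lemma lesspoll_UNIV_Un:
  fixes A B :: "'c set"
  assumes "A \<prec> (UNIV :: 'u::set_universe set)" "B \<prec> (UNIV :: 'u set)"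
  shows "A \<union> B \<prec> (UNIV :: 'u set)"
  using assms unfolding lesspoll_iff_ordLess
  by (intro card_of_Un_ordLess_infinite infinite_UNIV_set_universe)

text \<open>An infinite disjoint sum of \<open>A\<close> and \<open>B\<close> is at least as large
  as their product, and it lies below the universe by the bound on unions. If the sum is finite, so
  is the product.\<close>

lemma lesspoll_UNIV_Times:
  assumes A: "A \<prec> (UNIV :: 'u::set_universe set)" and B: "B \<prec> (UNIV :: 'u set)"
  shows "A \<times> B \<prec> (UNIV :: 'u set)"
proof -
  let ?S = "Inl ` A \<union> Inr ` B"
  have S: "?S \<prec> (UNIV :: 'u set)"
    using assms by (intro lesspoll_UNIV_Un lesspoll_image)
  show ?thesis
  proof (cases "finite ?S")
    case True
    then show ?thesis
      by (auto intro!: finite_lesspoll_UNIV dest!: finite_imageD)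
  next
    case False
    have "(card_of A, card_of ?S) \<in> ordLeq" "(card_of B, card_of ?S) \<in> ordLeq"
      by (auto simp: card_of_ordLeq[symmetric] inj_on_def intro: exI[of _ Inl] exI[of _ Inr])
    with False have "(card_of (A \<times> B), card_of ?S) \<in> ordLeq"
      by (intro card_of_Times_ordLeq_infinite_Field)
        (simp_all add: Field_card_of card_of_card_order_on del: Un_iff finite_Un)
    with S show ?thesis
      unfolding lesspoll_iff_ordLess using ordLeq_ordLess_trans by blast
  qed
qed

text \<open>The class axiom speaks only of subsets of the universe, so \<open>A\<close> is replaced
  by an injective image there.\<close>

lemma lesspoll_UNIV_Pow:
  assumes "A \<prec> (UNIV :: 'u::set_universe set)"
  shows "Pow A \<prec> (UNIV :: 'u set)"
proof -
  obtain f :: "'a \<Rightarrow> 'u" where f: "inj_on f A"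
    using assms by (auto simp: lesspoll_def lepoll_def)
  have "Pow A \<lesssim> Pow (f ` A)"
    unfolding lepoll_def using f
    by (intro exI[of _ "image f"]) (auto simp: inj_on_def inj_on_image_eq_iff)
  moreover have "Pow (f ` A) \<prec> (UNIV :: 'u set)"
    using assms by (intro strong_limit lesspoll_image)
  ultimately show ?thesis
    by (rule lesspoll_trans1)
qed

text \<open>An extensional function is determined by its graph over \<open>A\<close>, so the
  function space embeds into the power set of a product.\<close>

lemma lesspoll_UNIV_PiE:
  assumes A: "A \<prec> (UNIV :: 'u::set_universe set)" and B: "(\<Union>i\<in>A. B i) \<prec> (UNIV :: 'u set)"
  shows "PiE A B \<prec> (UNIV :: 'u set)"
proof -
  have "inj_on (\<lambda>f. (\<lambda>i. (i, f i)) ` A) (PiE A B)"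
  proof (rule inj_onI)
    fix f g
    assume f: "f \<in> PiE A B" and g: "g \<in> PiE A B"
      and eq: "(\<lambda>i. (i, f i)) ` A = (\<lambda>i. (i, g i)) ` A"
    have "f i = g i" if "i \<in> A" for i
      using eq that by (auto simp: set_eq_iff image_iff)
    with f g show "f = g"
      by (rule PiE_ext)
  qed
  then have "PiE A B \<lesssim> Pow (A \<times> (\<Union>i\<in>A. B i))"
    unfolding lepoll_def by (intro exI conjI) auto
  then show ?thesis
    using lesspoll_UNIV_Pow[OF lesspoll_UNIV_Times[OF A B]] by (rule lesspoll_trans1)
qed

text \<open>Unions over small index sets would call for regularity of the universe; finite ones
  follow from binary unions.\<close>

lemma lesspoll_UNIV_finite_UN:
  assumes "finite I" "\<And>i. i \<in> I \<Longrightarrow> B i \<prec> (UNIV :: 'u::set_universe set)"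
  shows "(\<Union>i\<in>I. B i) \<prec> (UNIV :: 'u set)"
  using assms by (induction I) (auto intro: lesspoll_UNIV_Un finite_lesspoll_UNIV)

section \<open>Presheaves on an edge sort with two end maps\<close>

lemma bij_betw_ex1: "bij_betw f A B \<Longrightarrow> y \<in> B \<Longrightarrow> \<exists>!x. x \<in> A \<and> f x = y"
  by (auto simp: bij_betw_def inj_on_def)

text \<open>An object \<open>x\<close> has a carrier \<open>car x s\<close> at each sort \<open>s\<close>; \<open>e0\<close> is the sort of edges, and
  \<open>inc x c\<close> maps an edge to its source (\<open>c = False\<close>) or target (\<open>c = True\<close>), which has sort \<open>k c\<close>. The
  last two assumptions say that every small diagram of sets of this shape is an object, and that
  every family of functions commuting with the end maps is an arrow.\<close>

locale presheaves = category C for C :: "('o, 'm) cat" (structure) +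
  fixes car :: "'o \<Rightarrow> 's \<Rightarrow> 'u::set_universe set"
    and act :: "'m \<Rightarrow> 's \<Rightarrow> 'u \<Rightarrow> 'u"
    and inc :: "'o \<Rightarrow> bool \<Rightarrow> 'u \<Rightarrow> 'u"
    and e0 :: 's
    and k :: "bool \<Rightarrow> 's"
  assumes k_neq: "k c \<noteq> e0"
    and car_small: "x \<in> Obj C \<Longrightarrow> small (car x s)"
    and inc_car: "x \<in> Obj C \<Longrightarrow> e \<in> car x e0 \<Longrightarrow> inc x c e \<in> car x (k c)"
    and act_car: "f \<in> Hom C x y \<Longrightarrow> v \<in> car x s \<Longrightarrow> act f s v \<in> car y s"
    and act_inc: "f \<in> Hom C x y \<Longrightarrow> e \<in> car x e0
      \<Longrightarrow> act f (k c) (inc x c e) = inc y c (act f e0 e)"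
    and act_Id: "x \<in> Obj C \<Longrightarrow> v \<in> car x s \<Longrightarrow> act (Id C x) s v = v"
    and act_Comp: "f \<in> Hom C x y \<Longrightarrow> g \<in> Hom C y z \<Longrightarrow> v \<in> car x s
      \<Longrightarrow> act (g \<cdot> f) s v = act g s (act f s v)"
    and hom_eqI: "f \<in> Hom C x y \<Longrightarrow> g \<in> Hom C x y
      \<Longrightarrow> (\<And>s v. v \<in> car x s \<Longrightarrow> act f s v = act g s v) \<Longrightarrow> f = g"
    and obj_ex: "(\<And>s. small (W s)) \<Longrightarrow> (\<And>c e. e \<in> W e0 \<Longrightarrow> i c e \<in> W (k c))
      \<Longrightarrow> \<exists>x\<in>Obj C. (\<forall>s. car x s = W s) \<and> (\<forall>c. \<forall>e\<in>W e0. inc x c e = i c e)"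
    and hom_ex: "x \<in> Obj C \<Longrightarrow> y \<in> Obj C \<Longrightarrow> (\<And>s v. v \<in> car x s \<Longrightarrow> h s v \<in> car y s)
      \<Longrightarrow> (\<And>c e. e \<in> car x e0 \<Longrightarrow> h (k c) (inc x c e) = inc y c (h e0 e))
      \<Longrightarrow> \<exists>f\<in>Hom C x y. \<forall>s. \<forall>v\<in>car x s. act f s v = h s v"
begin

lemma Hom_Obj: "f \<in> Hom C x y \<Longrightarrow> x \<in> Obj C" "f \<in> Hom C x y \<Longrightarrow> y \<in> Obj C"
  by (auto simp: Hom_def Dom_Obj Cod_Obj)

lemma Hom_Arr: "f \<in> Arr C \<Longrightarrow> f \<in> Hom C (Dom C f) (Cod C f)"
  by (simp add: Hom_def)

lemma comp_eqI:
  "f \<in> Hom C x y \<Longrightarrow> g \<in> Hom C y z \<Longrightarrow> h \<in> Hom C x z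
    \<Longrightarrow> (\<And>s v. v \<in> car x s \<Longrightarrow> act g s (act f s v) = act h s v) \<Longrightarrow> g \<cdot> f = h"
  by (rule hom_eqI) (auto simp: act_Comp intro: Comp_Hom)

lemma act_comp_eq:
  assumes "g \<cdot> f = h" "f \<in> Hom C x y" "g \<in> Hom C y z" "v \<in> car x s"
  shows "act g s (act f s v) = act h s v"
  using assms act_Comp by auto

lemma obtain_hom:
  assumes "x \<in> Obj C" "y \<in> Obj C" "\<And>s v. v \<in> car x s \<Longrightarrow> h s v \<in> car y s"
    and "\<And>c e. e \<in> car x e0 \<Longrightarrow> h (k c) (inc x c e) = inc y c (h e0 e)"
  obtains f where "f \<in> Hom C x y" "\<And>s v. v \<in> car x s \<Longrightarrow> act f s v = h s v"
  using hom_ex[of x y h] assms by blast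

text \<open>The bound on \<open>S s\<close> is \<open>small\<close> for sets of another type, such as sets of functions.\<close>

lemma realize:
  fixes S :: "'s \<Rightarrow> 'c set" and i :: "bool \<Rightarrow> 'c \<Rightarrow> 'c"
  assumes S: "\<And>s. S s \<prec> (UNIV :: 'u set)" and i: "\<And>c e. e \<in> S e0 \<Longrightarrow> i c e \<in> S (k c)"
  obtains x \<beta> where "x \<in> Obj C" "\<And>s. bij_betw (\<beta> s) (car x s) (S s)"
    "\<And>c e. e \<in> car x e0 \<Longrightarrow> \<beta> (k c) (inc x c e) = i c (\<beta> e0 e)"
proof -
  have "\<exists>\<phi> :: 'c \<Rightarrow> 'u. inj_on \<phi> (S s)" for s
    using S[of s] by (auto simp: lesspoll_def lepoll_def)
  then obtain \<phi> :: "'s \<Rightarrow> 'c \<Rightarrow> 'u" where \<phi>: "\<And>s. inj_on (\<phi> s) (S s)"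
    by metis
  \<comment> \<open>The carriers of \<open>x\<close> will be the codes \<open>\<phi> s\<close> of
    the elements of \<open>S s\<close>; \<open>?\<beta>\<close> decodes, and the end maps of
    \<open>x\<close> are those of \<open>i\<close> conjugated by the coding.\<close>
  let ?\<beta> = "\<lambda>s. inv_into (S s) (\<phi> s)"
  have "\<exists>x\<in>Obj C. (\<forall>s. car x s = \<phi> s ` S s)
      \<and> (\<forall>c. \<forall>e\<in>\<phi> e0 ` S e0. inc x c e = \<phi> (k c) (i c (?\<beta> e0 e)))"
    by (rule obj_ex) (use S \<phi> i in \<open>auto simp: small_def intro!: lesspoll_image\<close>)
  then obtain x where x: "x \<in> Obj C" "\<forall>s. car x s = \<phi> s ` S s"
    "\<forall>c. \<forall>e\<in>\<phi> e0 ` S e0. inc x c e = \<phi> (k c) (i c (?\<beta> e0 e))"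
    by (elim bexE conjE) (rule that)
  show thesis
  proof (rule that[of x ?\<beta>])
    show "bij_betw (?\<beta> s) (car x s) (S s)" for s
      using \<phi>[of s] by (simp add: x(2) inj_on_imp_bij_betw bij_betw_inv_into)
  qed (use x \<phi> i in auto)
qed

section \<open>Terminal objects\<close>

definition pointwise_terminal :: "'o \<Rightarrow> bool"
  where "pointwise_terminal t \<longleftrightarrow> t \<in> Obj C \<and> (\<forall>s. \<exists>!u. u \<in> car t s)"

lemma pointwise_terminal_imp_terminal:
  assumes t: "pointwise_terminal t" shows "is_terminal C t"
  unfolding is_terminal_def
proof (intro conjI ballI)
  show tO: "t \<in> Obj C"
    using t by (simp add: pointwise_terminal_def)
  have uniq: "u = v" if "u \<in> car t s" "v \<in> car t s" for u v s
    using t that unfolding pointwise_terminal_def by blast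
  fix x assume x: "x \<in> Obj C"
  obtain u where u: "\<And>s. u s \<in> car t s"
    using t unfolding pointwise_terminal_def by metis
  obtain f where f: "f \<in> Hom C x t"
    by (rule obtain_hom[OF x tO, of "\<lambda>s v. u s"]) (use u uniq inc_car[OF tO] in blast)+
  then show "\<exists>!f. f \<in> Hom C x t"
    by (blast intro: hom_eqI uniq act_car)
qed

lemma pointwise_terminal_exists: "\<exists>t. pointwise_terminal t"
proof -
  obtain t and \<beta> :: "'s \<Rightarrow> 'u \<Rightarrow> unit" where "t \<in> Obj C" "\<And>s. bij_betw (\<beta> s) (car t s) UNIV"
    by (rule realize[of "\<lambda>_. UNIV" "\<lambda>_ _. ()"]) (auto intro: finite_lesspoll_UNIV)
  with bij_betw_ex1[OF this(2) UNIV_I, of _ "()"] show ?thesis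
    by (auto simp: pointwise_terminal_def)
qed

text \<open>Comparison with a pointwise terminal object makes every carrier of \<open>t\<close> a
  retract of a singleton, hence inhabited and with at most one element.\<close>

lemma terminal_iff: "is_terminal C t \<longleftrightarrow> pointwise_terminal t"
proof
  assume t: "is_terminal C t"
  obtain t0 where t0: "pointwise_terminal t0"
    using pointwise_terminal_exists by blast
  then have "is_terminal C t0"
    by (rule pointwise_terminal_imp_terminal)
  with t obtain f g where f: "f \<in> Hom C t t0" and g: "g \<in> Hom C t0 t"
    unfolding is_terminal_def by blast
  have "g \<cdot> f = Id C t"
    using t Comp_Hom[OF f g] Id_Hom[OF Hom_Obj(1)[OF f]] unfolding is_terminal_def by blast
  then have gf: "act g s (act f s v) = v" if "v \<in> car t s" for s v
    using act_comp_eq[OF _ f g that] act_Id[OF Hom_Obj(1)[OF f] that] by simp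
  have "\<exists>!u. u \<in> car t s" for s
  proof -
    obtain u where u: "u \<in> car t0 s" "\<And>v. v \<in> car t0 s \<Longrightarrow> v = u"
      using t0 unfolding pointwise_terminal_def by metis
    then show ?thesis
      using gf act_car[OF f] act_car[OF g] by metis
  qed
  then show "pointwise_terminal t"
    using t by (simp add: pointwise_terminal_def is_terminal_def)
qed (rule pointwise_terminal_imp_terminal)

section \<open>Binary products\<close>

definition pointwise_product :: "'o \<Rightarrow> 'o \<Rightarrow> 'o \<Rightarrow> 'm \<Rightarrow> 'm \<Rightarrow> bool"
  where "pointwise_product a b P p1 p2 \<longleftrightarrow> a \<in> Obj C \<and> b \<in> Obj C
    \<and> p1 \<in> Hom C P a \<and> p2 \<in> Hom C P b
    \<and> (\<forall>s. \<forall>u\<in>car a s. \<forall>v\<in>car b s. \<exists>!w. w \<in> car P s \<and> act p1 s w = u \<and> act p2 s w = v)"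

lemma pointwise_productD:
  assumes "pointwise_product a b P p1 p2"
  shows "a \<in> Obj C" "b \<in> Obj C" "P \<in> Obj C" "p1 \<in> Hom C P a" "p2 \<in> Hom C P b"
  using assms Hom_Obj unfolding pointwise_product_def by blast+

lemma pointwise_product_inj:
  assumes P: "pointwise_product a b P p1 p2" and w: "w \<in> car P s" "w' \<in> car P s"
    and eq: "act p1 s w = act p1 s w'" "act p2 s w = act p2 s w'"
  shows "w = w'"
proof -
  have "act p1 s w \<in> car a s" "act p2 s w \<in> car b s"
    using P w act_car unfolding pointwise_product_def by blast+
  with P have "\<exists>!z. z \<in> car P s \<and> act p1 s z = act p1 s w \<and> act p2 s z = act p2 s w"
    unfolding pointwise_product_def by blast
  with w eq show ?thesis
    by metis
qed

definition pairing :: "'o \<Rightarrow> 'm \<Rightarrow> 'm \<Rightarrow> 's \<Rightarrow> 'u \<Rightarrow> 'u \<Rightarrow> 'u"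
  where "pairing P p1 p2 s u v = (THE w. w \<in> car P s \<and> act p1 s w = u \<and> act p2 s w = v)"

lemma pairing:
  assumes "pointwise_product a b P p1 p2" "u \<in> car a s" "v \<in> car b s"
  shows "pairing P p1 p2 s u v \<in> car P s" "act p1 s (pairing P p1 p2 s u v) = u"
    "act p2 s (pairing P p1 p2 s u v) = v"
proof -
  have "\<exists>!w. w \<in> car P s \<and> act p1 s w = u \<and> act p2 s w = v"
    using assms unfolding pointwise_product_def by blast
  from theI'[OF this] show "pairing P p1 p2 s u v \<in> car P s"
    "act p1 s (pairing P p1 p2 s u v) = u" "act p2 s (pairing P p1 p2 s u v) = v"
    unfolding pairing_def by blast+
qed

lemma pairing_act:
  assumes P: "pointwise_product a b P p1 p2" and w: "w \<in> car P s"
  shows "pairing P p1 p2 s (act p1 s w) (act p2 s w) = w"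
proof -
  have "act p1 s w \<in> car a s" "act p2 s w \<in> car b s"
    using P w act_car unfolding pointwise_product_def by blast+
  from pairing[OF P this] show ?thesis
    by (intro pointwise_product_inj[OF P _ w])
qed

text \<open>Both sides have the same projections, since the projections commute with the end maps.
  This is what makes a pointwise pairing of two arrows an arrow.\<close>

lemma inc_pairing:
  assumes P: "pointwise_product a b P p1 p2" and u: "u \<in> car a e0" and v: "v \<in> car b e0"
  shows "inc P c (pairing P p1 p2 e0 u v) = pairing P p1 p2 (k c) (inc a c u) (inc b c v)"
proof (rule pointwise_product_inj[OF P])
  note O = pointwise_productD[OF P]
  note e = pairing[OF P u v]
  note i = pairing[OF P inc_car[OF O(1) u] inc_car[OF O(2) v]]
  show "inc P c (pairing P p1 p2 e0 u v) \<in> car P (k c)"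
    using e(1) by (rule inc_car[OF O(3)])
  show "pairing P p1 p2 (k c) (inc a c u) (inc b c v) \<in> car P (k c)"
    by (rule i)
  show "act p1 (k c) (inc P c (pairing P p1 p2 e0 u v))
      = act p1 (k c) (pairing P p1 p2 (k c) (inc a c u) (inc b c v))"
    "act p2 (k c) (inc P c (pairing P p1 p2 e0 u v))
      = act p2 (k c) (pairing P p1 p2 (k c) (inc a c u) (inc b c v))"
    using e i act_inc[OF O(4) e(1)] act_inc[OF O(5) e(1)] by simp_all
qed

lemma pointwise_product_imp_product:
  assumes P: "pointwise_product a b P p1 p2" shows "is_product C a b P p1 p2"
  unfolding is_product_def
proof (intro conjI ballI)
  note O = pointwise_productD[OF P]
  show "a \<in> Obj C" "b \<in> Obj C" "P \<in> Obj C" "p1 \<in> Hom C P a" "p2 \<in> Hom C P b"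
    by (fact O)+
  fix x f g assume x: "x \<in> Obj C" and f: "f \<in> Hom C x a" and g: "g \<in> Hom C x b"
  let ?h = "\<lambda>s v. pairing P p1 p2 s (act f s v) (act g s v)"
  obtain h where h: "h \<in> Hom C x P" "\<And>s v. v \<in> car x s \<Longrightarrow> act h s v = ?h s v"
    by (rule obtain_hom[OF x O(3), of ?h])
      (auto simp: pairing[OF P] act_car[OF f] act_car[OF g] inc_pairing[OF P]
        act_inc[OF f] act_inc[OF g])
  have "p1 \<cdot> h = f" "p2 \<cdot> h = g"
    by (auto intro!: comp_eqI[OF h(1) O(4) f] comp_eqI[OF h(1) O(5) g]
        simp: h(2) pairing[OF P] act_car[OF f] act_car[OF g])
  moreover have "h' = h" if h': "h' \<in> Hom C x P" "p1 \<cdot> h' = f" "p2 \<cdot> h' = g" for h'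
  proof (rule hom_eqI[OF h'(1) h(1)])
    fix s v assume v: "v \<in> car x s"
    have "act f s v = act p1 s (act h' s v)" "act g s v = act p2 s (act h' s v)"
      using h' act_comp_eq[OF _ h'(1) _ v] O by metis+
    with v show "act h' s v = act h s v"
      by (simp add: h(2) pairing_act[OF P] act_car[OF h'(1)])
  qed
  ultimately show "\<exists>!h. h \<in> Hom C x P \<and> p1 \<cdot> h = f \<and> p2 \<cdot> h = g"
    using h(1) by metis
qed

lemma pointwise_product_exists:
  assumes a: "a \<in> Obj C" and b: "b \<in> Obj C"
  obtains P p1 p2 where "pointwise_product a b P p1 p2"
proof -
  obtain P \<beta> where P: "P \<in> Obj C" "\<And>s. bij_betw (\<beta> s) (car P s) (car a s \<times> car b s)"
    "\<And>c e. e \<in> car P e0 \<Longrightarrow> \<beta> (k c) (inc P c e) = map_prod (inc a c) (inc b c) (\<beta> e0 e)"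
    by (rule realize[of "\<lambda>s. car a s \<times> car b s" "\<lambda>c. map_prod (inc a c) (inc b c)"])
      (use car_small[OF a] car_small[OF b] inc_car[OF a] inc_car[OF b] in
        \<open>auto simp: small_def intro!: lesspoll_UNIV_Times\<close>)
  have \<beta>: "fst (\<beta> s w) \<in> car a s" "snd (\<beta> s w) \<in> car b s" if "w \<in> car P s" for s w
    using bij_betw_apply[OF P(2) that] by auto
  obtain p1 where p1: "p1 \<in> Hom C P a" "\<And>s v. v \<in> car P s \<Longrightarrow> act p1 s v = fst (\<beta> s v)"
    by (rule obtain_hom[OF P(1) a, of "\<lambda>s v. fst (\<beta> s v)"]) (use \<beta> P(3) in auto)
  obtain p2 where p2: "p2 \<in> Hom C P b" "\<And>s v. v \<in> car P s \<Longrightarrow> act p2 s v = snd (\<beta> s v)"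
    by (rule obtain_hom[OF P(1) b, of "\<lambda>s v. snd (\<beta> s v)"]) (use \<beta> P(3) in auto)
  have "\<exists>!w. w \<in> car P s \<and> act p1 s w = u \<and> act p2 s w = v"
    if "u \<in> car a s" "v \<in> car b s" for s u v
  proof -
    have "\<exists>!w. w \<in> car P s \<and> \<beta> s w = (u, v)"
      using that by (intro bij_betw_ex1[OF P(2)]) auto
    moreover have "\<beta> s w = (u, v) \<longleftrightarrow> act p1 s w = u \<and> act p2 s w = v" if "w \<in> car P s" for w
      using that by (auto simp: p1(2) p2(2) prod_eq_iff)
    ultimately show ?thesis
      by blast
  qed
  then have "pointwise_product a b P p1 p2"
    using a b p1 p2 by (simp add: pointwise_product_def)
  then show thesis
    by (rule that)
qed

text \<open>For the comparison arrows \<open>g\<close> to a canonical product and \<open>f\<close>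
  back, the universal property of \<open>P\<close> makes \<open>f \<cdot> g\<close> the identity. So
  \<open>f\<close> carries canonical pairs to elements of \<open>P\<close> with the same
  coordinates, and every element of \<open>P\<close> is recovered from its image under
  \<open>g\<close>, which its coordinates determine.\<close>

lemma product_iff: "is_product C a b P p1 p2 \<longleftrightarrow> pointwise_product a b P p1 p2"
proof
  assume P: "is_product C a b P p1 p2"
  then have O: "a \<in> Obj C" "b \<in> Obj C" "P \<in> Obj C" "p1 \<in> Hom C P a" "p2 \<in> Hom C P b"
    and U: "\<And>x f g. x \<in> Obj C \<Longrightarrow> f \<in> Hom C x a \<Longrightarrow> g \<in> Hom C x b
      \<Longrightarrow> \<exists>!h. h \<in> Hom C x P \<and> p1 \<cdot> h = f \<and> p2 \<cdot> h = g"
    unfolding is_product_def by blast+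
  obtain P' q1 q2 where P': "pointwise_product a b P' q1 q2"
    using O pointwise_product_exists by metis
  note O' = pointwise_productD[OF P']
  have "is_product C a b P' q1 q2"
    using P' by (rule pointwise_product_imp_product)
  then obtain g where g: "g \<in> Hom C P P'" "q1 \<cdot> g = p1" "q2 \<cdot> g = p2"
    using O unfolding is_product_def by blast
  obtain f where f: "f \<in> Hom C P' P" "p1 \<cdot> f = q1" "p2 \<cdot> f = q2"
    using U[OF O'(3,4,5)] by blast
  have "p1 \<cdot> (f \<cdot> g) = p1" "p2 \<cdot> (f \<cdot> g) = p2"
    using f g Comp_assoc[OF g(1) f(1) O(4)] Comp_assoc[OF g(1) f(1) O(5)] by simp_all
  then have "f \<cdot> g = Id C P"
    using U[OF O(3,4,5)] Comp_Hom[OF g(1) f(1)] Id_Hom[OF O(3)] Id_right O(4,5) by blast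
  then have fg: "act f s (act g s w) = w" if "w \<in> car P s" for s w
    using act_comp_eq[OF _ g(1) f(1) that] act_Id[OF O(3) that] by simp
  have "\<exists>!w. w \<in> car P s \<and> act p1 s w = u \<and> act p2 s w = v"
    if uv: "u \<in> car a s" "v \<in> car b s" for s u v
  proof -
    let ?w = "pairing P' q1 q2 s u v"
    note w = pairing[OF P' uv]
    show ?thesis
    proof (rule ex1I[of _ "act f s ?w"], intro conjI)
      show "act f s ?w \<in> car P s"
        using f(1) w(1) by (rule act_car)
      show "act p1 s (act f s ?w) = u" "act p2 s (act f s ?w) = v"
        using act_comp_eq[OF f(2,1) O(4) w(1)] act_comp_eq[OF f(3,1) O(5) w(1)] w by simp_all
      fix w' assume w': "w' \<in> car P s \<and> act p1 s w' = u \<and> act p2 s w' = v"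
      then have "act g s w' = ?w"
        using w act_comp_eq[OF g(2,1) O'(4)] act_comp_eq[OF g(3,1) O'(5)]
        by (intro pointwise_product_inj[OF P' act_car[OF g(1)] w(1)]) simp_all
      with fg w' show "w' = act f s ?w"
        by metis
    qed
  qed
  with O show "pointwise_product a b P p1 p2"
    by (simp add: pointwise_product_def)
qed (rule pointwise_product_imp_product)

end

section \<open>Limits\<close>

context presheaves begin

text \<open>The compatible families are the elements of the limit of the diagram of sets found at
  sort \<open>s\<close>. Values outside \<open>Obj J\<close> are left free.\<close>

definition compatible :: "('i, 'k) cat \<Rightarrow> ('i, 'k, 'o, 'm) functr \<Rightarrow> 's \<Rightarrow> ('i \<Rightarrow> 'u) \<Rightarrow> bool"
  where "compatible J D s w \<longleftrightarrow> (\<forall>j\<in>Obj J. w j \<in> car (FO D j) s)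
    \<and> (\<forall>u\<in>Arr J. act (FA D u) s (w (Dom J u)) = w (Cod J u))"

definition pointwise_limit ::
  "('i, 'k) cat \<Rightarrow> ('i, 'k, 'o, 'm) functr \<Rightarrow> 'o \<Rightarrow> ('i \<Rightarrow> 'm) \<Rightarrow> bool"
  where "pointwise_limit J D x p \<longleftrightarrow> is_functor J C D \<and> is_cone J C D x p
    \<and> (\<forall>s w. compatible J D s w \<longrightarrow> (\<exists>!u. u \<in> car x s \<and> (\<forall>j\<in>Obj J. act (p j) s u = w j)))"

lemma functor_Arr_Hom:
  assumes "is_functor J C D" "u \<in> Arr J"
  shows "FA D u \<in> Hom C (FO D (Dom J u)) (FO D (Cod J u))" "Dom J u \<in> Obj J" "Cod J u \<in> Obj J"
  using assms category.Dom_Obj category.Cod_Obj unfolding is_functor_def Hom_def by fastforce+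

lemma cone_compatible:
  assumes D: "is_functor J C D" and p: "is_cone J C D x p" and v: "v \<in> car x s"
  shows "compatible J D s (\<lambda>j. act (p j) s v)"
  unfolding compatible_def
proof (intro conjI ballI)
  show "act (p j) s v \<in> car (FO D j) s" if "j \<in> Obj J" for j
    using p v that act_car unfolding is_cone_def by blast
  show "act (FA D u) s (act (p (Dom J u)) s v) = act (p (Cod J u)) s v" if u: "u \<in> Arr J" for u
    using functor_Arr_Hom[OF D u] p u v unfolding is_cone_def
    by (intro act_comp_eq[of _ _ _ x]) auto
qed

lemma pointwise_limit_imp_limit:
  assumes x: "pointwise_limit J D x p" shows "is_limit J C D x p"
  unfolding is_limit_def
proof (intro conjI allI impI)
  show D: "is_functor J C D" and p: "is_cone J C D x p"
    using x by (simp_all add: pointwise_limit_def)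
  have ex1: "\<exists>!u. u \<in> car x s \<and> (\<forall>j\<in>Obj J. act (p j) s u = w j)" if "compatible J D s w" for s w
    using x that by (simp add: pointwise_limit_def)
  have xO: "x \<in> Obj C" and pH: "\<And>j. j \<in> Obj J \<Longrightarrow> p j \<in> Hom C x (FO D j)"
    using p by (simp_all add: is_cone_def)
  \<comment> \<open>The projections of \<open>u\<close> form a compatible family, which both
    \<open>u\<close> and \<open>v\<close> realise; so the projections are jointly injective.\<close>
  have inj: "u = v"
    if "u \<in> car x s" "v \<in> car x s" "\<And>j. j \<in> Obj J \<Longrightarrow> act (p j) s u = act (p j) s v" for u v s
    using ex1[OF cone_compatible[OF D p that(1)]] that by metis
  fix y q assume q: "is_cone J C D y q"
  then have yO: "y \<in> Obj C" and qH: "\<And>j. j \<in> Obj J \<Longrightarrow> q j \<in> Hom C y (FO D j)"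
    by (simp_all add: is_cone_def)
  define h where "h s v = (THE u. u \<in> car x s \<and> (\<forall>j\<in>Obj J. act (p j) s u = act (q j) s v))" for s v
  have h: "h s v \<in> car x s" "\<And>j. j \<in> Obj J \<Longrightarrow> act (p j) s (h s v) = act (q j) s v"
    if "v \<in> car y s" for s v
    using theI'[OF ex1[OF cone_compatible[OF D q that]]] unfolding h_def by simp_all
  have "h (k c) (inc y c e) = inc x c (h e0 e)" if e: "e \<in> car y e0" for c e
  proof (rule inj)
    show "h (k c) (inc y c e) \<in> car x (k c)" "inc x c (h e0 e) \<in> car x (k c)"
      using h e inc_car[OF yO] inc_car[OF xO] by simp_all
    show "act (p j) (k c) (h (k c) (inc y c e)) = act (p j) (k c) (inc x c (h e0 e))"
      if j: "j \<in> Obj J" for j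
      using j h e inc_car[OF yO] by (simp add: act_inc[OF pH[OF j]] act_inc[OF qH[OF j]])
  qed
  then obtain f where f: "f \<in> Hom C y x" "\<And>s v. v \<in> car y s \<Longrightarrow> act f s v = h s v"
    using obtain_hom[OF yO xO, of h] h(1) by metis
  show "\<exists>!f. f \<in> Hom C y x \<and> (\<forall>j\<in>Obj J. p j \<cdot> f = q j)"
  proof (rule ex1I[of _ f], intro conjI ballI)
    show "f \<in> Hom C y x" by (rule f)
    show "p j \<cdot> f = q j" if "j \<in> Obj J" for j
      by (rule comp_eqI[OF f(1) pH qH]) (simp_all add: that f(2) h)
    fix g assume g: "g \<in> Hom C y x \<and> (\<forall>j\<in>Obj J. p j \<cdot> g = q j)"
    show "g = f"
    proof (rule hom_eqI)
      show "g \<in> Hom C y x" "f \<in> Hom C y x"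
        using g f by simp_all
      fix s v assume v: "v \<in> car y s"
      have "act (p j) s (act g s v) = act (q j) s v" if "j \<in> Obj J" for j
        using g that by (intro act_comp_eq[OF _ _ pH[OF that] v]) simp_all
      with v g f show "act g s v = act f s v"
        by (intro inj[of "act g s v" s "act f s v"]; simp add: h act_car[of _ y x])
    qed
  qed
qed

lemma pointwise_limit_exists:
  assumes J: "finite_category J" and D: "is_functor J C D"
  obtains x p where "pointwise_limit J D x p"
proof -
  \<comment> \<open>Extensionality fixes the values outside \<open>Obj J\<close>, so that each
    compatible family is counted once. With finitely many indices the set of families is small
    enough to be realised.\<close>
  let ?S = "\<lambda>s. {w \<in> extensional (Obj J). compatible J D s w}"
  let ?i = "\<lambda>c w. \<lambda>j\<in>Obj J. inc (FO D j) c (w j)"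
  have DO: "FO D j \<in> Obj C" if "j \<in> Obj J" for j
    using D that by (simp add: is_functor_def)
  have S: "?S s \<prec> (UNIV :: 'u set)" for s
  proof (rule lesspoll_subset)
    show "?S s \<subseteq> (\<Pi>\<^sub>E j\<in>Obj J. car (FO D j) s)"
      by (auto simp: compatible_def PiE_iff extensional_def)
    show "(\<Pi>\<^sub>E j\<in>Obj J. car (FO D j) s) \<prec> (UNIV :: 'u set)"
      using J car_small[OF DO]
      by (intro lesspoll_UNIV_PiE lesspoll_UNIV_finite_UN)
        (simp_all add: finite_category_def small_def finite_lesspoll_UNIV)
  qed
  have i: "?i c w \<in> ?S (k c)" if w: "w \<in> ?S e0" for c w
  proof -
    have "act (FA D u) (k c) (?i c w (Dom J u)) = ?i c w (Cod J u)" if u: "u \<in> Arr J" for u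
      using functor_Arr_Hom[OF D u] u w by (auto simp: compatible_def act_inc)
    then show ?thesis
      using w DO by (auto simp: compatible_def inc_car)
  qed
  obtain x \<beta> where x: "x \<in> Obj C" "\<And>s. bij_betw (\<beta> s) (car x s) (?S s)"
    "\<And>c e. e \<in> car x e0 \<Longrightarrow> \<beta> (k c) (inc x c e) = ?i c (\<beta> e0 e)"
    by (rule realize[of ?S ?i, OF S i]) (assumption | rule that)+
  have \<beta>: "compatible J D s (\<beta> s v)" if "v \<in> car x s" for s v
    using bij_betw_apply[OF x(2) that] by simp
  have "\<exists>p. p \<in> Hom C x (FO D j) \<and> (\<forall>s. \<forall>v\<in>car x s. act p s v = \<beta> s v j)" if j: "j \<in> Obj J" for j
    using \<beta> j by (intro hom_ex[OF x(1) DO[OF j], unfolded Bex_def]) (auto simp: compatible_def x(3))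
  then obtain p where pH: "\<And>j. j \<in> Obj J \<Longrightarrow> p j \<in> Hom C x (FO D j)"
    and p: "\<And>j s v. j \<in> Obj J \<Longrightarrow> v \<in> car x s \<Longrightarrow> act (p j) s v = \<beta> s v j"
    by metis
  have "is_cone J C D x p"
    unfolding is_cone_def
  proof (intro conjI ballI x(1) pH)
    fix u assume u: "u \<in> Arr J"
    note u' = functor_Arr_Hom[OF D u]
    show "FA D u \<cdot> p (Dom J u) = p (Cod J u)"
      by (rule comp_eqI[OF pH[OF u'(2)] u'(1) pH[OF u'(3)]])
        (use \<beta> u in \<open>simp add: p u' compatible_def\<close>)
  qed
  moreover have "\<exists>!u. u \<in> car x s \<and> (\<forall>j\<in>Obj J. act (p j) s u = w j)" if w: "compatible J D s w" for s w
  proof -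
    have "restrict w (Obj J) \<in> ?S s"
      using w functor_Arr_Hom[OF D] by (auto simp: compatible_def)
    then have "\<exists>!u. u \<in> car x s \<and> \<beta> s u = restrict w (Obj J)"
      by (rule bij_betw_ex1[OF x(2)])
    moreover have "\<beta> s u = restrict w (Obj J) \<longleftrightarrow> (\<forall>j\<in>Obj J. act (p j) s u = w j)"
      if u: "u \<in> car x s" for u
      using bij_betw_apply[OF x(2) u] u
      by (auto simp: p fun_eq_iff restrict_def extensional_def)
    ultimately show ?thesis
      by (metis (no_types, lifting))
  qed
  ultimately have "pointwise_limit J D x p"
    using D by (simp add: pointwise_limit_def)
  then show thesis
    by (rule that)
qed

text \<open>The comparison argument for products again, now with a canonical limit, which is
  available because \<open>J\<close> is finite.\<close>

lemma limit_iff: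
  assumes J: "finite_category J"
  shows "is_limit J C D x p \<longleftrightarrow> pointwise_limit J D x p"
proof
  assume x: "is_limit J C D x p"
  then have D: "is_functor J C D" and p: "is_cone J C D x p"
    and U: "\<And>y q. is_cone J C D y q \<Longrightarrow> \<exists>!h. h \<in> Hom C y x \<and> (\<forall>j\<in>Obj J. p j \<cdot> h = q j)"
    by (auto simp: is_limit_def)
  have xO: "x \<in> Obj C" and pH: "\<And>j. j \<in> Obj J \<Longrightarrow> p j \<in> Hom C x (FO D j)"
    using p by (simp_all add: is_cone_def)
  obtain y q where y: "pointwise_limit J D y q"
    using pointwise_limit_exists[OF J D] by metis
  then have q: "is_cone J C D y q"
    and ex1: "\<And>s w. compatible J D s w \<Longrightarrow> \<exists>!u. u \<in> car y s \<and> (\<forall>j\<in>Obj J. act (q j) s u = w j)"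
    by (auto simp: pointwise_limit_def)
  have qH: "\<And>j. j \<in> Obj J \<Longrightarrow> q j \<in> Hom C y (FO D j)"
    using q by (simp_all add: is_cone_def)
  obtain f where f: "f \<in> Hom C y x" "\<And>j. j \<in> Obj J \<Longrightarrow> p j \<cdot> f = q j"
    using U[OF q] by metis
  obtain g where g: "g \<in> Hom C x y" "\<And>j. j \<in> Obj J \<Longrightarrow> q j \<cdot> g = p j"
    using pointwise_limit_imp_limit[OF y] p unfolding is_limit_def by metis
  have "p j \<cdot> (f \<cdot> g) = p j" if j: "j \<in> Obj J" for j
    using Comp_assoc[OF g(1) f(1) pH[OF j]] f(2)[OF j] g(2)[OF j] by simp
  moreover have "p j \<cdot> Id C x = p j" if j: "j \<in> Obj J" for j
    using pH[OF j] by (rule Id_right)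
  ultimately have "f \<cdot> g = Id C x"
    using U[OF p] Comp_Hom[OF g(1) f(1)] Id_Hom[OF xO] by metis
  then have fg: "act f s (act g s w) = w" if "w \<in> car x s" for s w
    using act_comp_eq[OF _ g(1) f(1) that] act_Id[OF xO that] by simp
  have "\<exists>!u. u \<in> car x s \<and> (\<forall>j\<in>Obj J. act (p j) s u = w j)" if w: "compatible J D s w" for s w
  proof -
    obtain u where u: "u \<in> car y s" "\<And>j. j \<in> Obj J \<Longrightarrow> act (q j) s u = w j"
      and uniq: "\<And>u'. u' \<in> car y s \<Longrightarrow> (\<And>j. j \<in> Obj J \<Longrightarrow> act (q j) s u' = w j) \<Longrightarrow> u' = u"
      using ex1[OF w] by metis
    show ?thesis
    proof (rule ex1I[of _ "act f s u"], intro conjI ballI)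
      show "act f s u \<in> car x s"
        using f(1) u(1) by (rule act_car)
      show "act (p j) s (act f s u) = w j" if j: "j \<in> Obj J" for j
        using act_comp_eq[OF f(2)[OF j] f(1) pH[OF j] u(1)] u(2)[OF j] by simp
      fix v assume v: "v \<in> car x s \<and> (\<forall>j\<in>Obj J. act (p j) s v = w j)"
      have "act g s v = u"
      proof (rule uniq)
        show "act g s v \<in> car y s"
          using v act_car[OF g(1)] by simp
        show "act (q j) s (act g s v) = w j" if j: "j \<in> Obj J" for j
          using act_comp_eq[OF g(2)[OF j] g(1) qH[OF j]] v j by simp
      qed
      with fg v show "v = act f s u"
        by metis
    qed
  qed
  with D p show "pointwise_limit J D x p"
    by (simp add: pointwise_limit_def)
qed (rule pointwise_limit_imp_limit)

lemma has_finite_limits: "has_finite_limits C"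
  unfolding has_finite_limits_def
  using pointwise_limit_exists pointwise_limit_imp_limit by metis

end

section \<open>Exponentials\<close>

context presheaves begin

text \<open>The element \<open>x\<close> of the exponential acts as the function \<open>f\<close> at
  sort \<open>s\<close>. Quantifying over the elements of \<open>P\<close> above \<open>x\<close>,
  and not over pairs, lets the relation be transported along arrows between products.\<close>

definition curries :: "'o \<Rightarrow> 'm \<Rightarrow> 'm \<Rightarrow> 'm \<Rightarrow> 's \<Rightarrow> 'u \<Rightarrow> ('u \<Rightarrow> 'u) \<Rightarrow> bool"
  where "curries P p1 p2 ev s x f
    \<longleftrightarrow> (\<forall>w\<in>car P s. act p1 s w = x \<longrightarrow> act ev s w = f (act p2 s w))"

text \<open>By the Yoneda lemma an element of the exponential at sort \<open>s\<close> is an arrow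
  to \<open>b\<close> from the product of \<open>a\<close> with the representable at
  \<open>s\<close>. The representable at a vertex sort is a single vertex, which leaves one
  function; at \<open>e0\<close> it is an edge with two separate ends, which leaves a function for
  each end and one for edges. The end functions are indexed by the end \<open>c\<close> and not by
  its sort, so they may differ even where \<open>k\<close> is constant.\<close>

definition pointwise_exponential ::
  "'o \<Rightarrow> 'o \<Rightarrow> 'o \<Rightarrow> 'o \<Rightarrow> 'm \<Rightarrow> 'm \<Rightarrow> 'm \<Rightarrow> bool"
  where "pointwise_exponential a b X P p1 p2 ev \<longleftrightarrow>
    pointwise_product X a P p1 p2 \<and> ev \<in> Hom C P b
    \<and> (\<forall>s f. s \<noteq> e0 \<longrightarrow> f \<in> car a s \<rightarrow>\<^sub>E car b s \<longrightarrow>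
          (\<exists>!x. x \<in> car X s \<and> curries P p1 p2 ev s x f))
    \<and> (\<forall>f h. (\<forall>c. f c \<in> car a (k c) \<rightarrow>\<^sub>E car b (k c)) \<longrightarrow> h \<in> car a e0 \<rightarrow>\<^sub>E car b e0 \<longrightarrow>
          (\<forall>c. \<forall>e\<in>car a e0. f c (inc a c e) = inc b c (h e)) \<longrightarrow>
          (\<exists>!x. x \<in> car X e0 \<and> curries P p1 p2 ev e0 x h
            \<and> (\<forall>c. curries P p1 p2 ev (k c) (inc X c x) (f c))))"

lemma pointwise_exponential_imp_exponential:
  assumes E: "pointwise_exponential a b X P p1 p2 ev"
  shows "is_exponential C a b X P p1 p2 ev"
  unfolding is_exponential_def
proof (intro conjI allI impI)
  have P: "pointwise_product X a P p1 p2" and ev: "ev \<in> Hom C P b"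
    using E by (simp_all add: pointwise_exponential_def)
  then show "is_product C X a P p1 p2" "ev \<in> Hom C P b"
    by (simp_all add: product_iff)
  note O = pointwise_productD[OF P]
  fix z R r1 r2 f assume "is_product C z a R r1 r2" and f: "f \<in> Hom C R b"
  then have R: "pointwise_product z a R r1 r2"
    by (simp add: product_iff)
  note O' = pointwise_productD[OF R]
  \<comment> \<open>The function that \<open>w\<close> must act as: fix the first argument of
    \<open>f\<close> at \<open>w\<close>.\<close>
  define \<phi> where "\<phi> s w = (\<lambda>v\<in>car a s. act f s (pairing R r1 r2 s w v))" for s w
  have \<phi>: "\<phi> s w \<in> car a s \<rightarrow>\<^sub>E car b s" if "w \<in> car z s" for s w
    using that by (simp add: \<phi>_def act_car[OF f] pairing[OF R])
  have \<phi>_inc: "\<phi> (k c) (inc z c w) (inc a c u) = inc b c (\<phi> e0 w u)"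
    if "w \<in> car z e0" "u \<in> car a e0" for c w u
    using that O O' by (simp add: \<phi>_def inc_car act_inc[OF f] pairing[OF R] flip: inc_pairing[OF R])
  \<comment> \<open>\<open>Q s w x\<close> says that \<open>x\<close> is a correct value of the
    transpose at \<open>w\<close>. At the edge sort the ends of \<open>x\<close> have to act
    correctly as well, since evaluation on edges alone does not determine \<open>x\<close>.\<close>
  define Q where "Q s w x \<longleftrightarrow> x \<in> car X s \<and> curries P p1 p2 ev s x (\<phi> s w)
      \<and> (s = e0 \<longrightarrow> (\<forall>c. curries P p1 p2 ev (k c) (inc X c x) (\<phi> (k c) (inc z c w))))" for s w x
  have ex1: "\<exists>!x. Q s w x" if w: "w \<in> car z s" for s w
  proof (cases "s = e0")
    case True
    have "\<forall>c. \<phi> (k c) (inc z c w) \<in> car a (k c) \<rightarrow>\<^sub>E car b (k c)"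
      using w O' by (simp add: \<phi> inc_car True)
    moreover have "\<forall>c. \<forall>e\<in>car a e0. \<phi> (k c) (inc z c w) (inc a c e) = inc b c (\<phi> e0 w e)"
      using w by (simp add: \<phi>_inc True)
    ultimately show ?thesis
      using E \<phi>[OF w] unfolding pointwise_exponential_def Q_def True by simp
  next
    case False
    then show ?thesis
      using E \<phi>[OF w] unfolding pointwise_exponential_def Q_def by simp
  qed
  define g0 where "g0 s w = (THE x. Q s w x)" for s w
  have g0: "Q s w (g0 s w)" if "w \<in> car z s" for s w
    unfolding g0_def using ex1[OF that] by (rule theI')
  have g0_eq: "g0 s w = x" if "Q s w x" "w \<in> car z s" for s w x
    unfolding g0_def using ex1 that by (blast intro: the1_equality)
  \<comment> \<open>An end of \<open>g0 e0 w\<close> acts as the function prescribed for that end of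
    \<open>w\<close>, by the last clause of \<open>Q\<close>; uniqueness at the vertex sort
    identifies it with \<open>g0 (k c) (inc z c w)\<close>.\<close>
  have "g0 (k c) (inc z c w) = inc X c (g0 e0 w)" if w: "w \<in> car z e0" for c w
    using g0[OF w] w O O' by (intro g0_eq) (simp_all add: Q_def k_neq inc_car)
  moreover have "g0 s w \<in> car X s" if "w \<in> car z s" for s w
    using g0[OF that] by (simp add: Q_def)
  ultimately obtain g where g: "g \<in> Hom C z X" "\<And>s w. w \<in> car z s \<Longrightarrow> act g s w = g0 s w"
    using obtain_hom[OF O'(1) O(1), of g0] by metis
  have "is_product C X a P p1 p2"
    using P by (simp add: product_iff)
  \<comment> \<open>\<open>m\<close> is the arrow written \<open>k\<close> in the definition of
    exponentials, the product of \<open>g\<close> with the identity of \<open>a\<close>.\<close>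
  then obtain m where m: "m \<in> Hom C R P" "p1 \<cdot> m = g \<cdot> r1" "p2 \<cdot> m = r2"
    using O'(3,5) Comp_Hom[OF O'(4) g(1)] unfolding is_product_def by blast
  have m1: "act p1 s (act m s r) = g0 s (act r1 s r)" "act p2 s (act m s r) = act r2 s r"
    "act m s r \<in> car P s" "act r1 s r \<in> car z s" "act r2 s r \<in> car a s" if r: "r \<in> car R s" for s r
    using act_comp_eq[OF m(2,1) O(4) r] act_comp_eq[OF m(3,1) O(5) r] act_Comp[OF O'(4) g(1) r]
      g(2) act_car r m(1) O'(4,5) by auto
  have "ev \<cdot> m = f"
  proof (rule comp_eqI[OF m(1) ev f])
    fix s r assume r: "r \<in> car R s"
    have "act ev s (act m s r) = \<phi> s (act r1 s r) (act r2 s r)"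
      using g0[OF m1(4)[OF r]] m1(1-3)[OF r] unfolding Q_def curries_def by metis
    also have "\<dots> = act f s r"
      using r m1(5) by (simp add: \<phi>_def pairing_act[OF R])
    finally show "act ev s (act m s r) = act f s r" .
  qed
  moreover have "g' = g" if g': "g' \<in> Hom C z X" and m': "m' \<in> Hom C R P"
    and eq: "p1 \<cdot> m' = g' \<cdot> r1" "p2 \<cdot> m' = r2" "ev \<cdot> m' = f" for g' m'
  proof (rule hom_eqI[OF g' g(1)])
    \<comment> \<open>Any other transpose \<open>g'\<close> also satisfies the property by which
      \<open>g0\<close> was chosen: an element \<open>p\<close> above the value of \<open>g'\<close>
      at \<open>w\<close> is the image under \<open>m'\<close> of the pair of \<open>w\<close> and
      the second coordinate of \<open>p\<close>.\<close>
    have cur: "curries P p1 p2 ev s (act g' s w) (\<phi> s w)" if w: "w \<in> car z s" for s w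
      unfolding curries_def
    proof (intro ballI impI)
      fix p assume p: "p \<in> car P s" and p1: "act p1 s p = act g' s w"
      let ?v = "act p2 s p" and ?r = "pairing R r1 r2 s w (act p2 s p)"
      have v: "?v \<in> car a s"
        using O(5) p by (rule act_car)
      note r = pairing[OF R w v]
      have "act m' s ?r = p"
        using act_comp_eq[OF eq(1) m' O(4) r(1)] act_comp_eq[OF eq(2) m' O(5) r(1)] r p1
          act_Comp[OF O'(4) g' r(1)]
        by (intro pointwise_product_inj[OF P act_car[OF m' r(1)] p]) simp_all
      then show "act ev s p = \<phi> s w ?v"
        using act_comp_eq[OF eq(3) m' ev r(1)] v by (simp add: \<phi>_def)
    qed
    show "act g' s w = act g s w" if w: "w \<in> car z s" for s w
    proof -
      have "Q s w (act g' s w)"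
        using cur w O' by (auto simp: Q_def act_car[OF g'] inc_car simp flip: act_inc[OF g'])
      with w show ?thesis
        by (simp add: g(2) g0_eq)
    qed
  qed
  ultimately show "\<exists>!g. g \<in> Hom C z X
      \<and> (\<exists>m\<in>Hom C R P. p1 \<cdot> m = g \<cdot> r1 \<and> p2 \<cdot> m = r2 \<and> ev \<cdot> m = f)"
    using g(1) m by (intro ex1I[of _ g]) blast+
qed

lemma pointwise_exponential_exists:
  assumes a: "a \<in> Obj C" and b: "b \<in> Obj C"
  obtains X P p1 p2 ev where "pointwise_exponential a b X P p1 p2 ev"
proof -
  \<comment> \<open>\<open>realize\<close> requires one element type for all sorts, so triples are
    used throughout: \<open>\<pi>\<close> reads the source or target function off a triple at the
    edge sort, and \<open>\<Delta>\<close> stores the single function of a vertex sort three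
    times.\<close>
  define \<pi> :: "bool \<Rightarrow> ('u \<Rightarrow> 'u) \<times> ('u \<Rightarrow> 'u) \<times> ('u \<Rightarrow> 'u) \<Rightarrow> 'u \<Rightarrow> 'u"
    where "\<pi> c t = (if c then fst (snd t) else fst t)" for c t
  define \<Delta> :: "('u \<Rightarrow> 'u) \<Rightarrow> ('u \<Rightarrow> 'u) \<times> ('u \<Rightarrow> 'u) \<times> ('u \<Rightarrow> 'u)"
    where "\<Delta> f = (f, f, f)" for f
  define F where "F s = (car a s \<rightarrow>\<^sub>E car b s)" for s
  define S where "S s = (if s = e0 then {t. (\<forall>c. \<pi> c t \<in> F (k c)) \<and> snd (snd t) \<in> F e0
      \<and> (\<forall>c. \<forall>e\<in>car a e0. \<pi> c t (inc a c e) = inc b c (snd (snd t) e))} else \<Delta> ` F s)" for s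
  have F: "F s \<prec> (UNIV :: 'u set)" for s
    unfolding F_def using car_small[OF a, of s] car_small[OF b, of s]
    by (intro lesspoll_UNIV_PiE) (auto simp: small_def finite_lesspoll_UNIV)
  have "S s \<prec> (UNIV :: 'u set)" for s
  proof (cases "s = e0")
    case True
    have "fst t \<in> F (k False) \<and> fst (snd t) \<in> F (k True)" if "\<forall>c. \<pi> c t \<in> F (k c)" for t
      using that[rule_format, of False] that[rule_format, of True] by (simp add: \<pi>_def)
    then have "S s \<subseteq> F (k False) \<times> F (k True) \<times> F e0"
      by (auto simp: S_def True)
    then show ?thesis
      by (rule lesspoll_subset) (intro lesspoll_UNIV_Times F)
  qed (simp add: S_def F lesspoll_image)
  moreover have "\<Delta> (\<pi> c t) \<in> S (k c)" if "t \<in> S e0" for c t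
    using that by (auto simp: S_def k_neq)
  ultimately obtain X \<beta> where X: "X \<in> Obj C" "\<And>s. bij_betw (\<beta> s) (car X s) (S s)"
    "\<And>c e. e \<in> car X e0 \<Longrightarrow> \<beta> (k c) (inc X c e) = \<Delta> (\<pi> c (\<beta> e0 e))"
    by (rule realize[of S "\<lambda>c t. \<Delta> (\<pi> c t)"]) (assumption | rule that)+
  \<comment> \<open>The last component is the edge function at \<open>e0\<close> and one of three
    equal copies at the other sorts, so a single formula serves as evaluation at every sort.\<close>
  define ap where "ap s x = snd (snd (\<beta> s x))" for s x
  have \<beta>: "\<beta> s x \<in> S s" if "x \<in> car X s" for s x
    using X(2) that by (rule bij_betw_apply)
  have ap: "ap s x \<in> F s" if "x \<in> car X s" for s x
    using \<beta>[OF that] by (auto simp: S_def ap_def \<Delta>_def split: if_splits)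
  have ap_inc: "ap (k c) (inc X c x) = \<pi> c (\<beta> e0 x)" if "x \<in> car X e0" for c x
    using that by (simp add: ap_def X(3) \<Delta>_def)
  have ap_inc_inc: "ap (k c) (inc X c x) (inc a c u) = inc b c (ap e0 x u)"
    if "x \<in> car X e0" "u \<in> car a e0" for c x u
    using \<beta>[OF that(1)] that by (simp add: ap_inc S_def) (simp add: ap_def)
  obtain P p1 p2 where P: "pointwise_product X a P p1 p2"
    using pointwise_product_exists[OF X(1) a] by metis
  note O = pointwise_productD[OF P]
  obtain ev where ev: "ev \<in> Hom C P b"
    "\<And>s w. w \<in> car P s \<Longrightarrow> act ev s w = ap s (act p1 s w) (act p2 s w)"
  proof (rule obtain_hom[OF O(3) b, of "\<lambda>s w. ap s (act p1 s w) (act p2 s w)"])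
    show "ap s (act p1 s w) (act p2 s w) \<in> car b s" if w: "w \<in> car P s" for s w
      using ap[OF act_car[OF O(4) w]] act_car[OF O(5) w] by (auto simp: F_def)
    show "ap (k c) (act p1 (k c) (inc P c e)) (act p2 (k c) (inc P c e))
        = inc b c (ap e0 (act p1 e0 e) (act p2 e0 e))" if e: "e \<in> car P e0" for c e
      using e act_car[OF O(4) e] act_car[OF O(5) e]
      by (simp add: act_inc[OF O(4)] act_inc[OF O(5)] ap_inc_inc)
  qed (rule that)
  \<comment> \<open>Every element of \<open>car a s\<close> is the second coordinate of some element
    of \<open>P\<close> above \<open>x\<close>, so \<open>curries\<close> determines the function
    completely.\<close>
  have curries_iff: "curries P p1 p2 ev s x f \<longleftrightarrow> ap s x = f"
    if x: "x \<in> car X s" and f: "f \<in> F s" for s x f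
  proof
    assume cur: "curries P p1 p2 ev s x f"
    have "ap s x u = f u" if u: "u \<in> car a s" for u
      using cur pairing[OF P x u] ev(2) unfolding curries_def by metis
    then show "ap s x = f"
      using ap[OF x] f unfolding F_def by (intro PiE_ext) auto
  qed (auto simp: curries_def ev(2))
  have "\<exists>!x. x \<in> car X s \<and> curries P p1 p2 ev s x f" if s: "s \<noteq> e0" and f: "f \<in> F s" for s f
  proof -
    have "\<exists>!x. x \<in> car X s \<and> \<beta> s x = \<Delta> f"
      using s f by (intro bij_betw_ex1[OF X(2)]) (simp add: S_def)
    moreover have "\<beta> s x = \<Delta> f \<longleftrightarrow> ap s x = f" if "x \<in> car X s" for x
      using \<beta>[OF that] s by (auto simp: S_def ap_def \<Delta>_def)
    ultimately show ?thesis
      using f curries_iff by (metis (no_types, lifting))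
  qed
  moreover have "\<exists>!x. x \<in> car X e0 \<and> curries P p1 p2 ev e0 x h
      \<and> (\<forall>c. curries P p1 p2 ev (k c) (inc X c x) (f c))"
    if f: "\<forall>c. f c \<in> F (k c)" and h: "h \<in> F e0"
      and fh: "\<forall>c. \<forall>e\<in>car a e0. f c (inc a c e) = inc b c (h e)" for f h
  proof -
    let ?t = "(f False, f True, h)"
    have \<pi>: "\<pi> c ?t = f c" for c
      by (cases c) (simp_all add: \<pi>_def)
    have "\<exists>!x. x \<in> car X e0 \<and> \<beta> e0 x = ?t"
      using f h fh by (intro bij_betw_ex1[OF X(2)]) (simp add: S_def \<pi>)
    moreover have "\<beta> e0 x = ?t \<longleftrightarrow> ap e0 x = h \<and> (\<forall>c. ap (k c) (inc X c x) = f c)"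
      if "x \<in> car X e0" for x
      using that by (auto simp: prod_eq_iff ap_inc all_bool_eq) (auto simp: ap_def \<pi>_def)
    ultimately show ?thesis
      using f h curries_iff inc_car[OF X(1)] by (metis (no_types, lifting))
  qed
  ultimately have "pointwise_exponential a b X P p1 p2 ev"
    using P ev(1) unfolding pointwise_exponential_def F_def by simp
  then show thesis
    by (rule that)
qed

lemma has_exponentials: "has_exponentials C"
  unfolding has_exponentials_def
  using pointwise_exponential_exists pointwise_exponential_imp_exponential by metis

end


section \<open>Transport of exponentials along comparison arrows, and monomorphisms\<close>

lemma ex1_transport:
  assumes "\<exists>!y. y \<in> B \<and> R y"
    and "\<And>y. y \<in> B \<Longrightarrow> R y \<Longrightarrow> g y \<in> A \<and> Q (g y)"
    and "\<And>x. x \<in> A \<Longrightarrow> Q x \<Longrightarrow> g' x \<in> B \<and> R (g' x) \<and> g (g' x) = x"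
  shows "\<exists>!x. x \<in> A \<and> Q x"
  using assms by metis

context presheaves begin

text \<open>Both \<open>g\<close> and the identity are transposes of \<open>ev\<close> itself, and
  transposes are unique.\<close>

lemma exponential_endo_Id:
  assumes E: "is_exponential C a b X P p1 p2 ev"
    and g: "g \<in> Hom C X X" and m: "m \<in> Hom C P P"
    and eq: "p1 \<cdot> m = g \<cdot> p1" "p2 \<cdot> m = p2" "ev \<cdot> m = ev"
  shows "g = Id C X"
proof -
  have P: "is_product C X a P p1 p2" and ev: "ev \<in> Hom C P b"
    using E by (simp_all add: is_exponential_def)
  then have O: "X \<in> Obj C" "P \<in> Obj C" "p1 \<in> Hom C P X" "p2 \<in> Hom C P a"
    by (simp_all add: is_product_def)
  have "\<exists>!g. g \<in> Hom C X X
      \<and> (\<exists>m\<in>Hom C P P. p1 \<cdot> m = g \<cdot> p1 \<and> p2 \<cdot> m = p2 \<and> ev \<cdot> m = ev)"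
    using E P ev unfolding is_exponential_def by blast
  moreover have "p1 \<cdot> Id C P = Id C X \<cdot> p1" "p2 \<cdot> Id C P = p2" "ev \<cdot> Id C P = ev"
    using O ev by (simp_all add: Id_right[of _ P] Id_left[of _ P])
  ultimately show ?thesis
    using g m eq Id_Hom[OF O(1)] Id_Hom[OF O(2)] by blast
qed

text \<open>Each comparison arrow is the transpose of the other evaluation, so both composites are
  identities. The accompanying arrows between the products preserve the second coordinate and the
  value of evaluation, and they send elements above an image under a comparison arrow to elements
  above the original; hence \<open>curries\<close> passes in both directions.\<close>

lemma exponential_comparison:
  assumes E: "is_exponential C a b X P p1 p2 ev" and E': "is_exponential C a b X' P' q1 q2 ev'"
  obtains g g' where "g \<in> Hom C X' X" "g' \<in> Hom C X X'"
    "\<And>s x. x \<in> car X s \<Longrightarrow> act g s (act g' s x) = x"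
    "\<And>s x f. x \<in> car X s \<Longrightarrow> curries P p1 p2 ev s x f \<Longrightarrow> curries P' q1 q2 ev' s (act g' s x) f"
    "\<And>s x f. x \<in> car X' s \<Longrightarrow> curries P' q1 q2 ev' s x f \<Longrightarrow> curries P p1 p2 ev s (act g s x) f"
proof -
  have P: "is_product C X a P p1 p2" and ev: "ev \<in> Hom C P b"
    and P': "is_product C X' a P' q1 q2" and ev': "ev' \<in> Hom C P' b"
    using E E' by (simp_all add: is_exponential_def)
  then have O: "X \<in> Obj C" "P \<in> Obj C" "p1 \<in> Hom C P X" "p2 \<in> Hom C P a"
    and O': "X' \<in> Obj C" "P' \<in> Obj C" "q1 \<in> Hom C P' X'" "q2 \<in> Hom C P' a"
    by (simp_all add: is_product_def)
  obtain g m where g: "g \<in> Hom C X' X" and m: "m \<in> Hom C P' P"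
    and gm: "p1 \<cdot> m = g \<cdot> q1" "p2 \<cdot> m = q2" "ev \<cdot> m = ev'"
    using E P' ev' unfolding is_exponential_def by blast
  obtain g' m' where g': "g' \<in> Hom C X X'" and m': "m' \<in> Hom C P P'"
    and gm': "q1 \<cdot> m' = g' \<cdot> p1" "q2 \<cdot> m' = p2" "ev' \<cdot> m' = ev"
    using E' P ev unfolding is_exponential_def by blast
  have "p1 \<cdot> (m \<cdot> m') = (g \<cdot> g') \<cdot> p1" "p2 \<cdot> (m \<cdot> m') = p2" "ev \<cdot> (m \<cdot> m') = ev"
    using Comp_assoc[OF m' m O(3)] Comp_assoc[OF m' O'(3) g] Comp_assoc[OF O(3) g' g]
      Comp_assoc[OF m' m O(4)] Comp_assoc[OF m' m ev] gm gm' by simp_all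
  then have gg': "g \<cdot> g' = Id C X"
    by (intro exponential_endo_Id[OF E Comp_Hom[OF g' g] Comp_Hom[OF m' m]])
  have "q1 \<cdot> (m' \<cdot> m) = (g' \<cdot> g) \<cdot> q1" "q2 \<cdot> (m' \<cdot> m) = q2" "ev' \<cdot> (m' \<cdot> m) = ev'"
    using Comp_assoc[OF m m' O'(3)] Comp_assoc[OF m O(3) g'] Comp_assoc[OF O'(3) g g']
      Comp_assoc[OF m m' O'(4)] Comp_assoc[OF m m' ev'] gm gm' by simp_all
  then have g'g: "g' \<cdot> g = Id C X'"
    by (intro exponential_endo_Id[OF E' Comp_Hom[OF g g'] Comp_Hom[OF m m']])
  show thesis
  proof (rule that[OF g g'])
    show gg'x: "act g s (act g' s x) = x" if "x \<in> car X s" for s x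
      using act_comp_eq[OF gg' g' g that] act_Id[OF O(1) that] by simp
    have g'gx: "act g' s (act g s x) = x" if "x \<in> car X' s" for s x
      using act_comp_eq[OF g'g g g' that] act_Id[OF O'(1) that] by simp
    show "curries P' q1 q2 ev' s (act g' s x) f"
      if x: "x \<in> car X s" and cur: "curries P p1 p2 ev s x f" for s x f
      unfolding curries_def
    proof (intro ballI impI)
      fix w assume w: "w \<in> car P' s" and "act q1 s w = act g' s x"
      then have "act p1 s (act m s w) = x"
        using act_comp_eq[OF gm(1) m O(3) w] act_Comp[OF O'(3) g w] gg'x[OF x] by simp
      with cur act_car[OF m w] have "act ev s (act m s w) = f (act p2 s (act m s w))"
        unfolding curries_def by blast
      then show "act ev' s w = f (act q2 s w)"
        using act_comp_eq[OF gm(2) m O(4) w] act_comp_eq[OF gm(3) m ev w] by simp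
    qed
    show "curries P p1 p2 ev s (act g s x) f"
      if x: "x \<in> car X' s" and cur: "curries P' q1 q2 ev' s x f" for s x f
      unfolding curries_def
    proof (intro ballI impI)
      fix w assume w: "w \<in> car P s" and "act p1 s w = act g s x"
      then have "act q1 s (act m' s w) = x"
        using act_comp_eq[OF gm'(1) m' O'(3) w] act_Comp[OF O(3) g' w] g'gx[OF x] by simp
      with cur act_car[OF m' w] have "act ev' s (act m' s w) = f (act q2 s (act m' s w))"
        unfolding curries_def by blast
      then show "act ev s w = f (act p2 s w)"
        using act_comp_eq[OF gm'(2) m' O'(4) w] act_comp_eq[OF gm'(3) m' ev' w] by simp
    qed
  qed
qed

lemma exponential_iff: "is_exponential C a b X P p1 p2 ev \<longleftrightarrow> pointwise_exponential a b X P p1 p2 ev"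
proof
  assume E: "is_exponential C a b X P p1 p2 ev"
  then have P: "pointwise_product X a P p1 p2" and ev: "ev \<in> Hom C P b"
    by (simp_all add: is_exponential_def product_iff)
  obtain X' P' q1 q2 ev' where E': "pointwise_exponential a b X' P' q1 q2 ev'"
    using pointwise_exponential_exists[OF pointwise_productD(2)[OF P] Hom_Obj(2)[OF ev]] by metis
  obtain g g' where g: "g \<in> Hom C X' X" and g': "g' \<in> Hom C X X'"
    and gg': "\<And>s x. x \<in> car X s \<Longrightarrow> act g s (act g' s x) = x"
    and c': "\<And>s x f. x \<in> car X s \<Longrightarrow> curries P p1 p2 ev s x f
      \<Longrightarrow> curries P' q1 q2 ev' s (act g' s x) f"
    and c: "\<And>s x f. x \<in> car X' s \<Longrightarrow> curries P' q1 q2 ev' s x f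
      \<Longrightarrow> curries P p1 p2 ev s (act g s x) f"
    using exponential_comparison[OF E pointwise_exponential_imp_exponential[OF E']] by metis
  have "\<exists>!x. x \<in> car X s \<and> curries P p1 p2 ev s x f"
    if "s \<noteq> e0" "f \<in> car a s \<rightarrow>\<^sub>E car b s" for s f
  proof (rule ex1_transport[where g = "act g s" and g' = "act g' s"])
    show "\<exists>!x. x \<in> car X' s \<and> curries P' q1 q2 ev' s x f"
      using E' that unfolding pointwise_exponential_def by blast
  qed (auto simp: gg' act_car[OF g] act_car[OF g'] intro: c c')
  moreover have "\<exists>!x. x \<in> car X e0 \<and> curries P p1 p2 ev e0 x h
      \<and> (\<forall>c. curries P p1 p2 ev (k c) (inc X c x) (f c))"
    if "\<forall>c. f c \<in> car a (k c) \<rightarrow>\<^sub>E car b (k c)" "h \<in> car a e0 \<rightarrow>\<^sub>E car b e0"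
      "\<forall>c. \<forall>e\<in>car a e0. f c (inc a c e) = inc b c (h e)" for f h
  proof (rule ex1_transport[where g = "act g e0" and g' = "act g' e0"])
    show "\<exists>!x. x \<in> car X' e0 \<and> curries P' q1 q2 ev' e0 x h
        \<and> (\<forall>c. curries P' q1 q2 ev' (k c) (inc X' c x) (f c))"
      using E' that unfolding pointwise_exponential_def by blast
  qed (auto simp: gg' act_car[OF g] act_car[OF g'] inc_car[OF Hom_Obj(1)[OF g]]
      inc_car[OF Hom_Obj(1)[OF g']] intro: c c' simp flip: act_inc[OF g] act_inc[OF g'])
  ultimately show "pointwise_exponential a b X P p1 p2 ev"
    using P ev by (simp add: pointwise_exponential_def)
qed (rule pointwise_exponential_imp_exponential)

text \<open>The kernel pair of \<open>m\<close> is realised as an object \<open>K\<close>. Its two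
  projections agree after composition with \<open>m\<close>, so a monomorphism forces them to be
  equal, which is injectivity at every sort.\<close>

lemma mono_iff: "is_mono C m \<longleftrightarrow> m \<in> Arr C \<and> (\<forall>s. inj_on (act m s) (car (Dom C m) s))"
proof
  assume m: "is_mono C m"
  then have mH: "m \<in> Hom C (Dom C m) (Cod C m)"
    by (simp add: is_mono_def Hom_Arr)
  let ?x = "Dom C m"
  note xO = Hom_Obj(1)[OF mH]
  let ?S = "\<lambda>s. {(u, v). u \<in> car ?x s \<and> v \<in> car ?x s \<and> act m s u = act m s v}"
  have S: "?S s \<prec> (UNIV :: 'u set)" for s
    by (rule lesspoll_subset[of _ "car ?x s \<times> car ?x s"])
      (use car_small[OF xO] in \<open>auto simp: small_def intro!: lesspoll_UNIV_Times\<close>)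
  obtain K \<beta> where K: "K \<in> Obj C" "\<And>s. bij_betw (\<beta> s) (car K s) (?S s)"
    "\<And>c e. e \<in> car K e0 \<Longrightarrow> \<beta> (k c) (inc K c e) = map_prod (inc ?x c) (inc ?x c) (\<beta> e0 e)"
    by (rule realize[of ?S "\<lambda>c. map_prod (inc ?x c) (inc ?x c)"])
      (use S in \<open>auto simp: inc_car[OF xO] act_inc[OF mH]\<close>)
  have \<beta>: "fst (\<beta> s w) \<in> car ?x s" "snd (\<beta> s w) \<in> car ?x s"
    "act m s (fst (\<beta> s w)) = act m s (snd (\<beta> s w))" if "w \<in> car K s" for s w
    using bij_betw_apply[OF K(2) that] by auto
  obtain p1 where p1: "p1 \<in> Hom C K ?x" "\<And>s v. v \<in> car K s \<Longrightarrow> act p1 s v = fst (\<beta> s v)"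
    by (rule obtain_hom[OF K(1) xO, of "\<lambda>s v. fst (\<beta> s v)"]) (use \<beta> K(3) in auto)
  obtain p2 where p2: "p2 \<in> Hom C K ?x" "\<And>s v. v \<in> car K s \<Longrightarrow> act p2 s v = snd (\<beta> s v)"
    by (rule obtain_hom[OF K(1) xO, of "\<lambda>s v. snd (\<beta> s v)"]) (use \<beta> K(3) in auto)
  have "m \<cdot> p1 = m \<cdot> p2"
    by (rule comp_eqI[OF p1(1) mH Comp_Hom[OF p2(1) mH]])
      (simp add: act_Comp[OF p2(1) mH] p1(2) p2(2) \<beta>)
  with m K(1) p1(1) p2(1) have eq: "p1 = p2"
    unfolding is_mono_def by blast
  have "u = v" if uv: "u \<in> car ?x s" "v \<in> car ?x s" "act m s u = act m s v" for s u v
  proof -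
    obtain w where "w \<in> car K s" "\<beta> s w = (u, v)"
      using bij_betw_ex1[OF K(2), of "(u, v)" s] uv by auto
    then show ?thesis
      using p1(2) p2(2) eq by (metis fst_conv snd_conv)
  qed
  then show "m \<in> Arr C \<and> (\<forall>s. inj_on (act m s) (car (Dom C m) s))"
    using m by (simp add: is_mono_def inj_on_def)
next
  assume m: "m \<in> Arr C \<and> (\<forall>s. inj_on (act m s) (car (Dom C m) s))"
  then have mH: "m \<in> Hom C (Dom C m) (Cod C m)"
    by (simp add: Hom_Arr)
  have "f = g" if f: "f \<in> Hom C x (Dom C m)" and g: "g \<in> Hom C x (Dom C m)" and eq: "m \<cdot> f = m \<cdot> g"
    for x f g
  proof (rule hom_eqI[OF f g])
    fix s v assume v: "v \<in> car x s"
    have "act m s (act f s v) = act m s (act g s v)"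
      using act_comp_eq[OF eq f mH v] act_Comp[OF g mH v] by simp
    then show "act f s v = act g s v"
      using m act_car[OF f v] act_car[OF g v] unfolding inj_on_def by blast
  qed
  with m show "is_mono C m"
    unfolding is_mono_def by blast
qed

end

section \<open>The subobject classifier\<close>

context presheaves begin

text \<open>Arrows into the terminal object carry no information, so the pullback condition only
  says that the image of \<open>m\<close> consists of the elements which \<open>\<chi>\<close> sends
  to truth. This removes arrows from the definition of a classifier and leaves a condition on
  carriers.\<close>

lemma pullback_true_iff:
  assumes m: "is_mono C m" "m \<in> Hom C X Y" and \<chi>: "\<chi> \<in> Hom C Y \<Omega>"
    and tr: "tr \<in> Hom C T \<Omega>" and T: "is_terminal C T"
  shows "(\<exists>u\<in>Hom C X T. is_pullback C \<chi> tr m u) \<longleftrightarrow>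
    (\<forall>s. \<forall>y\<in>car Y s. (\<exists>t\<in>car T s. act \<chi> s y = act tr s t) \<longleftrightarrow> y \<in> act m s ` car X s)"
proof
  have XY: "X \<in> Obj C" "Y \<in> Obj C" and dc: "Dom C m = X" "Cod C m = Y" "Dom C \<chi> = Y" "Cod C \<chi> = \<Omega>"
    "Dom C tr = T" "Cod C tr = \<Omega>" "m \<in> Arr C" "\<chi> \<in> Arr C" "tr \<in> Arr C"
    using m \<chi> tr Hom_Obj[OF m(2)] by (simp_all add: Hom_def)
  have T1: "t = t'" if "t \<in> car T s" "t' \<in> car T s" for s t t'
    using T that unfolding terminal_iff pointwise_terminal_def by blast
  have toT: "\<exists>u. u \<in> Hom C x T" if "x \<in> Obj C" for x
    using T that unfolding is_terminal_def by blast
  {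
    assume "\<exists>u\<in>Hom C X T. is_pullback C \<chi> tr m u"
    then obtain u where u: "u \<in> Hom C X T" and eq: "\<chi> \<cdot> m = tr \<cdot> u"
      and U: "\<And>x q1 q2. x \<in> Obj C \<Longrightarrow> q1 \<in> Hom C x Y \<Longrightarrow> q2 \<in> Hom C x T \<Longrightarrow> \<chi> \<cdot> q1 = tr \<cdot> q2
        \<Longrightarrow> \<exists>h. h \<in> Hom C x X \<and> m \<cdot> h = q1"
      unfolding is_pullback_def dc by blast
    \<comment> \<open>The elements sent to truth are closed under the end maps and form a subobject
      \<open>K\<close> of \<open>Y\<close>. The pullback property makes its inclusion factor through
      \<open>m\<close>.\<close>
    define A where "A s = {y \<in> car Y s. \<exists>t\<in>car T s. act \<chi> s y = act tr s t}" for s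
    have "inc Y c y \<in> A (k c)" if "y \<in> A e0" for c y
      using that inc_car[OF XY(2)] inc_car[OF Hom_Obj(1)[OF tr]] act_inc[OF \<chi>] act_inc[OF tr]
      unfolding A_def by (auto intro!: bexI[rotated])
    moreover have "small (A s)" for s
      using car_small[OF XY(2), of s] unfolding small_def
      by (rule lesspoll_subset[rotated]) (auto simp: A_def)
    ultimately obtain K where K: "K \<in> Obj C" "\<forall>s. car K s = A s" "\<forall>c. \<forall>e\<in>A e0. inc K c e = inc Y c e"
      using obj_ex[of A "inc Y"] by blast
    obtain j where j: "j \<in> Hom C K Y" "\<And>s v. v \<in> car K s \<Longrightarrow> act j s v = v"
      by (rule obtain_hom[OF K(1) XY(2), of "\<lambda>_ v. v"]) (use K in \<open>auto simp: A_def\<close>)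
    obtain q where q: "q \<in> Hom C K T"
      using toT[OF K(1)] by blast
    have "\<chi> \<cdot> j = tr \<cdot> q"
    proof (rule comp_eqI[OF j(1) \<chi> Comp_Hom[OF q tr]])
      fix s v assume v: "v \<in> car K s"
      then obtain t where t: "t \<in> car T s" "act \<chi> s v = act tr s t"
        using K(2) by (auto simp: A_def)
      then show "act \<chi> s (act j s v) = act (tr \<cdot> q) s v"
        using v T1[OF t(1) act_car[OF q v]] by (simp add: j(2) act_Comp[OF q tr])
    qed
    then obtain h where h: "h \<in> Hom C K X" "m \<cdot> h = j"
      using U[OF K(1) j(1) q] by blast
    show "\<forall>s. \<forall>y\<in>car Y s. (\<exists>t\<in>car T s. act \<chi> s y = act tr s t) \<longleftrightarrow> y \<in> act m s ` car X s"
    proof (intro allI ballI iffI)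
      fix s y assume "y \<in> car Y s" "\<exists>t\<in>car T s. act \<chi> s y = act tr s t"
      then have y: "y \<in> car K s"
        using K(2) by (simp add: A_def)
      then have "act m s (act h s y) = y"
        using act_comp_eq[OF h(2,1) m(2) y] j(2) by simp
      then show "y \<in> act m s ` car X s"
        using act_car[OF h(1) y] by (metis imageI)
    next
      fix s y assume "y \<in> act m s ` car X s"
      then obtain x where x: "x \<in> car X s" "y = act m s x"
        by blast
      then have "act \<chi> s y = act tr s (act u s x)"
        using act_comp_eq[OF eq m(2) \<chi> x(1)] act_Comp[OF u tr x(1)] by simp
      with act_car[OF u x(1)] show "\<exists>t\<in>car T s. act \<chi> s y = act tr s t"
        by blast
    qed
  }
  assume im: "\<forall>s. \<forall>y\<in>car Y s. (\<exists>t\<in>car T s. act \<chi> s y = act tr s t) \<longleftrightarrow> y \<in> act m s ` car X s"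
  obtain u where u: "u \<in> Hom C X T"
    using toT[OF XY(1)] by blast
  have "\<chi> \<cdot> m = tr \<cdot> u"
  proof (rule comp_eqI[OF m(2) \<chi> Comp_Hom[OF u tr]])
    fix s v assume v: "v \<in> car X s"
    then obtain t where t: "t \<in> car T s" "act \<chi> s (act m s v) = act tr s t"
      using im act_car[OF m(2) v] by blast
    then show "act \<chi> s (act m s v) = act (tr \<cdot> u) s v"
      using T1[OF t(1) act_car[OF u v]] v by (simp add: act_Comp[OF u tr])
  qed
  moreover have "\<exists>!h. h \<in> Hom C x X \<and> m \<cdot> h = q1 \<and> u \<cdot> h = q2"
    if x: "x \<in> Obj C" and q1: "q1 \<in> Hom C x Y" and q2: "q2 \<in> Hom C x T" and eq: "\<chi> \<cdot> q1 = tr \<cdot> q2"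
    for x q1 q2
  proof -
    have inj: "inj_on (act m s) (car X s)" for s
      using m(1) by (simp add: mono_iff dc)
    have im': "act q1 s v \<in> act m s ` car X s" if v: "v \<in> car x s" for s v
      using im act_car[OF q1 v] act_car[OF q2 v] act_comp_eq[OF eq q1 \<chi> v] act_Comp[OF q2 tr v]
      by metis
    \<comment> \<open>Preimages under \<open>m\<close> are unique, so choosing them sort by sort is
      compatible with the end maps.\<close>
    let ?h = "\<lambda>s v. inv_into (car X s) (act m s) (act q1 s v)"
    have mh: "act m s (?h s v) = act q1 s v" "?h s v \<in> car X s" if "v \<in> car x s" for s v
      using im'[OF that] by (rule f_inv_into_f, rule inv_into_into)
    have "?h (k c) (inc x c e) = inc X c (?h e0 e)" if e: "e \<in> car x e0" for c e
    proof (rule inj_onD[OF inj])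
      show "act m (k c) (?h (k c) (inc x c e)) = act m (k c) (inc X c (?h e0 e))"
        using mh(1)[OF e] mh(1)[OF inc_car[OF x e]] act_inc[OF m(2) mh(2)[OF e]] act_inc[OF q1 e]
        by simp
    qed (use e mh(2) inc_car XY(1) x in blast)+
    then obtain h where h: "h \<in> Hom C x X" "\<And>s v. v \<in> car x s \<Longrightarrow> act h s v = ?h s v"
      using obtain_hom[OF x XY(1), of ?h] mh(2) by metis
    have "m \<cdot> h = q1"
      by (rule comp_eqI[OF h(1) m(2) q1]) (simp add: h(2) mh(1))
    moreover have "u \<cdot> h = q2"
      using T x Comp_Hom[OF h(1) u] q2 unfolding is_terminal_def by blast
    ultimately show ?thesis
      using h(1) m x unfolding is_mono_def dc by (intro ex1I[of _ h]) auto
  qed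
  ultimately show "\<exists>u\<in>Hom C X T. is_pullback C \<chi> tr m u"
    using u m(2) dc unfolding is_pullback_def by (intro bexI[of _ u]) auto
qed

definition classifies :: "'m \<Rightarrow> 'm \<Rightarrow> 'm \<Rightarrow> bool"
  where "classifies tr \<chi> m \<longleftrightarrow> (\<forall>s. \<forall>y\<in>car (Cod C m) s.
    (\<exists>t\<in>car (Dom C tr) s. act \<chi> s y = act tr s t) \<longleftrightarrow> y \<in> act m s ` car (Dom C m) s)"

lemma subobject_classifier_iff_classifies:
  "is_subobject_classifier C \<Omega> tr \<longleftrightarrow> tr \<in> Arr C \<and> Cod C tr = \<Omega> \<and> is_terminal C (Dom C tr)
    \<and> (\<forall>m. is_mono C m \<longrightarrow> (\<exists>!\<chi>. \<chi> \<in> Hom C (Cod C m) \<Omega> \<and> classifies tr \<chi> m))"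
proof -
  have "\<chi> \<in> Hom C (Cod C m) \<Omega> \<and> (\<exists>u\<in>Hom C (Dom C m) (Dom C tr). is_pullback C \<chi> tr m u)
      \<longleftrightarrow> \<chi> \<in> Hom C (Cod C m) \<Omega> \<and> classifies tr \<chi> m"
    if "tr \<in> Arr C" "Cod C tr = \<Omega>" "is_terminal C (Dom C tr)" "is_mono C m" for \<chi> m
    using that pullback_true_iff[OF that(4), of "Dom C m" "Cod C m" \<chi> \<Omega> tr "Dom C tr"]
    by (auto simp: classifies_def is_mono_def Hom_Arr Hom_def)
  then show ?thesis
    unfolding is_subobject_classifier_def by (auto cong: conj_cong)
qed

text \<open>A truth value at the edge sort of the presheaf topos is a triple: whether the two ends of an
  edge, and the edge itself, belong to a subobject. At the other sorts the triple is constant.\<close>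

definition truth :: "'s \<Rightarrow> (bool \<times> bool \<times> bool) set"
  where "truth s = (if s = e0 then {(a, b, c). c \<longrightarrow> a \<and> b} else {(b, b, b) | b. True})"

text \<open>Of the five values at the edge sort, which are the sieves there, an end retains only its
  own membership, repeated to form a constant triple.\<close>

definition truth_end :: "bool \<Rightarrow> bool \<times> bool \<times> bool \<Rightarrow> bool \<times> bool \<times> bool"
  where "truth_end c t = (let b = (if c then fst (snd t) else fst t) in (b, b, b))"

abbreviation (input) "true \<equiv> (True, True, True)"

lemma truth_end_true: "truth_end c true = true"
  by (simp add: truth_end_def)

text \<open>A bijection is used in place of an equality of carriers because an arbitrary classifier
  agrees with the canonical one only up to isomorphism.\<close>

definition truth_coding :: "'o \<Rightarrow> ('s \<Rightarrow> 'u \<Rightarrow> bool \<times> bool \<times> bool) \<Rightarrow> bool"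
  where "truth_coding \<Omega> \<beta> \<longleftrightarrow> (\<forall>s. bij_betw (\<beta> s) (car \<Omega> s) (truth s))
    \<and> (\<forall>c. \<forall>e\<in>car \<Omega> e0. \<beta> (k c) (inc \<Omega> c e) = truth_end c (\<beta> e0 e))"

definition pointwise_classifier :: "'o \<Rightarrow> 'm \<Rightarrow> bool"
  where "pointwise_classifier \<Omega> tr \<longleftrightarrow> tr \<in> Arr C \<and> Cod C tr = \<Omega> \<and> pointwise_terminal (Dom C tr)
    \<and> (\<exists>\<beta>. truth_coding \<Omega> \<beta> \<and> (\<forall>s. \<forall>t\<in>car (Dom C tr) s. \<beta> s (act tr s t) = true))"

text \<open>Knowing whether a value at the edge sort is \<open>true\<close> does not determine it,
  as four of the five values are not. The ends of \<open>v\<close> supply the remaining two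
  components, because \<open>\<chi>\<close> commutes with the end maps. So an arrow into
  \<open>\<Omega>\<close> is determined by which elements it sends to truth.\<close>

lemma truth_coding_determined:
  assumes \<beta>: "truth_coding \<Omega> \<beta>" and \<chi>: "\<chi> \<in> Hom C y \<Omega>"
    and I: "\<And>s v. v \<in> car y s \<Longrightarrow> \<beta> s (act \<chi> s v) = true \<longleftrightarrow> I s v" and v: "v \<in> car y s"
  shows "\<beta> s (act \<chi> s v)
    = (if s = e0 then (I (k False) (inc y False v), I (k True) (inc y True v), I s v)
       else (I s v, I s v, I s v))"
proof -
  have t: "\<beta> s (act \<chi> s v) \<in> truth s"
    using \<beta> act_car[OF \<chi> v] by (auto simp: truth_coding_def intro: bij_betw_apply)
  have "I (k c) (inc y c v) \<longleftrightarrow> truth_end c (\<beta> s (act \<chi> s v)) = true" if "s = e0" for c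
    using I[of "inc y c v" "k c"] v inc_car[OF Hom_Obj(1)[OF \<chi>]] \<beta> act_car[OF \<chi>] that
    by (simp add: act_inc[OF \<chi>] truth_coding_def)
  from this[of False] this[of True] t I[OF v] show ?thesis
    by (cases "\<beta> s (act \<chi> s v)") (auto simp: truth_def truth_end_def split: if_splits)
qed

lemma pointwise_classifier_imp_classifier:
  assumes \<Omega>: "pointwise_classifier \<Omega> tr" shows "is_subobject_classifier C \<Omega> tr"
  unfolding subobject_classifier_iff_classifies
proof (intro conjI allI impI)
  obtain \<beta> where tr: "tr \<in> Arr C" "Cod C tr = \<Omega>" and T: "pointwise_terminal (Dom C tr)"
    and \<beta>: "truth_coding \<Omega> \<beta>" and tt: "\<And>s t. t \<in> car (Dom C tr) s \<Longrightarrow> \<beta> s (act tr s t) = true"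
    using \<Omega> unfolding pointwise_classifier_def by blast
  show "tr \<in> Arr C" "Cod C tr = \<Omega>" "is_terminal C (Dom C tr)"
    using tr T by (simp_all add: terminal_iff)
  have trH: "tr \<in> Hom C (Dom C tr) \<Omega>"
    using tr by (simp add: Hom_def)
  have bij: "bij_betw (\<beta> s) (car \<Omega> s) (truth s)" for s
    using \<beta> by (simp add: truth_coding_def)
  have true_iff: "(\<exists>t\<in>car (Dom C tr) s. v = act tr s t) \<longleftrightarrow> \<beta> s v = true" if v: "v \<in> car \<Omega> s" for s v
  proof
    assume "\<beta> s v = true"
    obtain t where t: "t \<in> car (Dom C tr) s"
      using T unfolding pointwise_terminal_def by blast
    with \<open>\<beta> s v = true\<close> v have "v = act tr s t"
      using tt[OF t] act_car[OF trH t] bij[of s] by (metis bij_betw_def inj_onD)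
    with t show "\<exists>t\<in>car (Dom C tr) s. v = act tr s t"
      by blast
  qed (use tt in blast)
  fix m assume m: "is_mono C m"
  define y where "y = Cod C m"
  have mH: "m \<in> Hom C (Dom C m) y"
    using m by (simp add: is_mono_def Hom_def y_def)
  note yO = Hom_Obj(2)[OF mH] and \<Omega>O = Hom_Obj(2)[OF trH]
  define I where "I s v \<longleftrightarrow> v \<in> act m s ` car (Dom C m) s" for s v
  have I_inc: "I (k c) (inc y c v)" if "I e0 v" for c v
    using that inc_car[OF Hom_Obj(1)[OF mH]] unfolding I_def by (auto simp flip: act_inc[OF mH])
  \<comment> \<open>The values that the characteristic arrow of \<open>m\<close> must have. They lie
    in \<open>truth\<close> because the ends of an edge in the image of \<open>m\<close> are also in
    the image.\<close>
  define \<tau> where "\<tau> s v = (if s = e0 then (I (k False) (inc y False v), I (k True) (inc y True v), I s v)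
    else (I s v, I s v, I s v))" for s v
  have \<tau>: "\<tau> s v \<in> truth s" for s v
    using I_inc by (auto simp: \<tau>_def truth_def)
  have \<tau>_true: "\<tau> s v = true \<longleftrightarrow> I s v" for s v
    using I_inc by (auto simp: \<tau>_def)
  \<comment> \<open>Classifying \<open>m\<close> thus means having the values \<open>\<tau>\<close>;
    existence and uniqueness of the classifying arrow both come from decoding \<open>\<tau>\<close>
    with the bijection \<open>\<beta>\<close>.\<close>
  have classifies_iff: "classifies tr \<chi> m \<longleftrightarrow> (\<forall>s. \<forall>v\<in>car y s. \<beta> s (act \<chi> s v) = \<tau> s v)"
    if \<chi>: "\<chi> \<in> Hom C y \<Omega>" for \<chi>
  proof -
    have "classifies tr \<chi> m \<longleftrightarrow> (\<forall>s. \<forall>v\<in>car y s. \<beta> s (act \<chi> s v) = true \<longleftrightarrow> I s v)"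
      using true_iff[OF act_car[OF \<chi>]] by (simp add: classifies_def I_def y_def)
    also have "\<dots> \<longleftrightarrow> (\<forall>s. \<forall>v\<in>car y s. \<beta> s (act \<chi> s v) = \<tau> s v)"
    proof (intro iffI allI ballI)
      show "\<beta> s (act \<chi> s v) = \<tau> s v"
        if "\<forall>s. \<forall>v\<in>car y s. \<beta> s (act \<chi> s v) = true \<longleftrightarrow> I s v" "v \<in> car y s" for s v
        unfolding \<tau>_def using that by (intro truth_coding_determined[OF \<beta> \<chi>]) simp_all
    qed (simp_all add: \<tau>_true)
    finally show ?thesis .
  qed
  let ?h = "\<lambda>s v. inv_into (car \<Omega> s) (\<beta> s) (\<tau> s v)"
  have h: "?h s v \<in> car \<Omega> s" "\<beta> s (?h s v) = \<tau> s v" for s v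
    using bij[of s] \<tau>[of s v] by (auto simp: bij_betw_def intro: inv_into_into f_inv_into_f)
  have "?h (k c) (inc y c e) = inc \<Omega> c (?h e0 e)" if e: "e \<in> car y e0" for c e
  proof (rule inj_onD[OF bij_betw_imp_inj_on[OF bij]])
    show "\<beta> (k c) (?h (k c) (inc y c e)) = \<beta> (k c) (inc \<Omega> c (?h e0 e))"
      using \<beta> h by (simp add: truth_coding_def) (simp add: \<tau>_def truth_end_def k_neq Let_def)
  qed (use h inc_car[OF \<Omega>O] in auto)
  then obtain \<chi> where \<chi>: "\<chi> \<in> Hom C y \<Omega>" "\<And>s v. v \<in> car y s \<Longrightarrow> act \<chi> s v = ?h s v"
    using obtain_hom[OF yO \<Omega>O, of ?h] h(1) by metis
  have "\<exists>!\<chi>. \<chi> \<in> Hom C y \<Omega> \<and> classifies tr \<chi> m"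
  proof (rule ex1I[of _ \<chi>], intro conjI)
    show "\<chi> \<in> Hom C y \<Omega>" by (rule \<chi>)
    show "classifies tr \<chi> m"
      using \<chi> h(2) by (simp add: classifies_iff)
    fix \<chi>' assume \<chi>': "\<chi>' \<in> Hom C y \<Omega> \<and> classifies tr \<chi>' m"
    then have \<chi>'H: "\<chi>' \<in> Hom C y \<Omega>"
      by blast
    show "\<chi>' = \<chi>"
    proof (rule hom_eqI[OF \<chi>'H \<chi>(1)], rule inj_onD[OF bij_betw_imp_inj_on[OF bij]])
      fix s v assume v: "v \<in> car y s"
      then show "\<beta> s (act \<chi>' s v) = \<beta> s (act \<chi> s v)"
        using \<chi>' classifies_iff[OF \<chi>'H] \<chi>(2) h(2) by simp
      show "act \<chi>' s v \<in> car \<Omega> s" "act \<chi> s v \<in> car \<Omega> s"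
        using act_car[OF \<chi>'H v] act_car[OF \<chi>(1) v] by simp_all
    qed
  qed
  then show "\<exists>!\<chi>. \<chi> \<in> Hom C (Cod C m) \<Omega> \<and> classifies tr \<chi> m"
    by (simp add: y_def)
qed

lemma pointwise_classifier_exists:
  obtains \<Omega> tr where "pointwise_classifier \<Omega> tr"
proof -
  obtain \<Omega> \<beta> where \<Omega>: "\<Omega> \<in> Obj C" "\<And>s. bij_betw (\<beta> s) (car \<Omega> s) (truth s)"
    "\<And>c e. e \<in> car \<Omega> e0 \<Longrightarrow> \<beta> (k c) (inc \<Omega> c e) = truth_end c (\<beta> e0 e)"
    by (rule realize[of truth truth_end])
      (auto simp: truth_def truth_end_def k_neq Let_def intro: finite_lesspoll_UNIV)
  then have \<beta>: "truth_coding \<Omega> \<beta>"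
    by (simp add: truth_coding_def)
  obtain T where T: "pointwise_terminal T"
    using pointwise_terminal_exists by blast
  define \<omega> where "\<omega> s = inv_into (car \<Omega> s) (\<beta> s) true" for s
  have "true \<in> \<beta> s ` car \<Omega> s" for s
    using \<Omega>(2)[of s] by (auto simp: bij_betw_def truth_def)
  then have \<omega>: "\<omega> s \<in> car \<Omega> s" "\<beta> s (\<omega> s) = true" for s
    unfolding \<omega>_def by (blast intro: inv_into_into f_inv_into_f)+
  have "\<omega> (k c) = inc \<Omega> c (\<omega> e0)" for c
    by (rule inj_onD[OF bij_betw_imp_inj_on[OF \<Omega>(2)[of "k c"]]])
      (simp_all add: \<omega> \<Omega>(3) truth_end_true inc_car[OF \<Omega>(1)])
  then obtain tr where tr: "tr \<in> Hom C T \<Omega>" "\<And>s v. v \<in> car T s \<Longrightarrow> act tr s v = \<omega> s"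
    using obtain_hom[of T \<Omega> "\<lambda>s _. \<omega> s"] T \<omega>(1) \<Omega>(1) unfolding pointwise_terminal_def by metis
  have "pointwise_classifier \<Omega> tr"
    unfolding pointwise_classifier_def
    using tr T \<beta> \<omega> by (auto simp: Hom_def)
  then show thesis
    by (rule that)
qed

lemma inverse_bij:
  assumes "f \<in> Hom C x y" "g \<in> Hom C y x" "g \<cdot> f = Id C x" "f \<cdot> g = Id C y"
  shows "bij_betw (act f s) (car x s) (car y s)"
proof (rule bij_betw_byWitness[where f' = "act g s"])
  show "\<forall>v\<in>car x s. act g s (act f s v) = v" "\<forall>v\<in>car y s. act f s (act g s v) = v"
    using assms act_comp_eq[of g f _ x y x] act_comp_eq[of f g _ y x y] act_Id Hom_Obj by simp_all
qed (use assms act_car in blast)+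

text \<open>The truth arrows of both classifiers start at terminal objects and are therefore
  monomorphisms, so each classifier classifies the truth arrow of the other. A composite of these
  two arrows classifies a truth arrow by itself, as the identity does; by uniqueness they are
  mutually inverse, and a truth coding can be carried along.\<close>

lemma subobject_classifier_iff: "is_subobject_classifier C \<Omega> tr \<longleftrightarrow> pointwise_classifier \<Omega> tr"
proof
  assume \<Omega>: "is_subobject_classifier C \<Omega> tr"
  obtain \<Omega>' tr' where pc: "pointwise_classifier \<Omega>' tr'"
    using pointwise_classifier_exists by metis
  then have \<Omega>': "is_subobject_classifier C \<Omega>' tr'"
    by (rule pointwise_classifier_imp_classifier)
  have mono: "is_mono C t" if "t \<in> Arr C" "is_terminal C (Dom C t)" for t
    using that unfolding mono_iff terminal_iff pointwise_terminal_def by (auto simp: inj_on_def)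
  have classifies_self: "classifies t (Id C (Cod C t)) t" if "t \<in> Arr C" for t
    using that act_Id[OF Cod_Obj[OF that]] by (auto simp: classifies_def)
  have classifies_comp: "classifies t (\<chi> \<cdot> \<chi>') t"
    if "classifies t' \<chi>' t" "classifies t \<chi> t'" "t \<in> Arr C" "t' \<in> Arr C"
      "\<chi>' \<in> Hom C (Cod C t) (Cod C t')" "\<chi> \<in> Hom C (Cod C t') (Cod C t)" for t t' \<chi> \<chi>'
    unfolding classifies_def
  proof (intro allI ballI)
    fix s v assume v: "v \<in> car (Cod C t) s"
    then show "(\<exists>r\<in>car (Dom C t) s. act (\<chi> \<cdot> \<chi>') s v = act t s r) \<longleftrightarrow> v \<in> act t s ` car (Dom C t) s"
      using that(1,2) act_car[OF that(5) v] act_Comp[OF that(5,6) v]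
      by (auto simp: classifies_def image_iff)
  qed
  from \<Omega> \<Omega>' have tr: "tr \<in> Arr C" "Cod C tr = \<Omega>" "is_terminal C (Dom C tr)"
    and tr': "tr' \<in> Arr C" "Cod C tr' = \<Omega>'" "is_terminal C (Dom C tr')"
    and U: "\<And>m. is_mono C m \<Longrightarrow> \<exists>!\<chi>. \<chi> \<in> Hom C (Cod C m) \<Omega> \<and> classifies tr \<chi> m"
    and U': "\<And>m. is_mono C m \<Longrightarrow> \<exists>!\<chi>. \<chi> \<in> Hom C (Cod C m) \<Omega>' \<and> classifies tr' \<chi> m"
    unfolding subobject_classifier_iff_classifies by blast+
  obtain \<chi> where \<chi>: "\<chi> \<in> Hom C \<Omega>' \<Omega>" "classifies tr \<chi> tr'"
    using U[OF mono[OF tr'(1,3)]] tr'(2) by blast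
  obtain \<chi>' where \<chi>': "\<chi>' \<in> Hom C \<Omega> \<Omega>'" "classifies tr' \<chi>' tr"
    using U'[OF mono[OF tr(1,3)]] tr(2) by blast
  note I = Id_Hom[OF Hom_Obj(1)[OF \<chi>'(1)]] and I' = Id_Hom[OF Hom_Obj(1)[OF \<chi>(1)]]
  have "\<chi> \<cdot> \<chi>' = Id C \<Omega>"
    using U[OF mono[OF tr(1,3)]] classifies_self[OF tr(1)] Comp_Hom[OF \<chi>'(1) \<chi>(1)] I
      classifies_comp[OF \<chi>'(2) \<chi>(2) tr(1) tr'(1)] \<chi>(1) \<chi>'(1) tr(2) tr'(2) by blast
  moreover have "\<chi>' \<cdot> \<chi> = Id C \<Omega>'"
    using U'[OF mono[OF tr'(1,3)]] classifies_self[OF tr'(1)] Comp_Hom[OF \<chi>(1) \<chi>'(1)] I'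
      classifies_comp[OF \<chi>(2) \<chi>'(2) tr'(1) tr(1)] \<chi>(1) \<chi>'(1) tr(2) tr'(2) by blast
  ultimately have bij: "bij_betw (act \<chi>' s) (car \<Omega> s) (car \<Omega>' s)" for s
    by (rule inverse_bij[OF \<chi>'(1) \<chi>(1)])
  obtain \<beta> where \<beta>: "truth_coding \<Omega>' \<beta>"
    and tt: "\<And>s t. t \<in> car (Dom C tr') s \<Longrightarrow> \<beta> s (act tr' s t) = true"
    using pc unfolding pointwise_classifier_def by blast
  have "bij_betw (\<lambda>v. \<beta> s (act \<chi>' s v)) (car \<Omega> s) (truth s)" for s
    using bij_betw_trans[OF bij, of "\<beta> s"] \<beta> by (simp add: truth_coding_def o_def)
  then have "truth_coding \<Omega> (\<lambda>s v. \<beta> s (act \<chi>' s v))"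
    using \<beta> act_car[OF \<chi>'(1)] by (simp add: truth_coding_def act_inc[OF \<chi>'(1)])
  moreover have "\<beta> s (act \<chi>' s (act tr s t)) = true" if t: "t \<in> car (Dom C tr) s" for s t
  proof -
    have "act tr s t \<in> car (Cod C tr) s"
      using tr(1) t by (intro act_car[OF Hom_Arr])
    with \<chi>'(2) t tt show ?thesis
      unfolding classifies_def by (metis imageI)
  qed
  ultimately show "pointwise_classifier \<Omega> tr"
    using tr by (auto simp: pointwise_classifier_def terminal_iff)
qed (rule pointwise_classifier_imp_classifier)

lemma topos: "topos C"
  unfolding topos_def has_subobject_classifier_def
  using category_axioms has_finite_limits has_exponentials pointwise_classifier_exists
    pointwise_classifier_imp_classifier by metis

end

section \<open>Functors that preserve sorts\<close>

lemma is_functor_Obj: "is_functor C D F \<Longrightarrow> a \<in> Obj C \<Longrightarrow> FO F a \<in> Obj D"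
  by (simp add: is_functor_def)

lemma is_functor_Hom: "is_functor C D F \<Longrightarrow> f \<in> Hom C a b \<Longrightarrow> FA F f \<in> Hom D (FO F a) (FO F b)"
  unfolding is_functor_def Hom_def using category.Dom_Obj category.Cod_Obj by fastforce

lemma is_functor_Comp:
  "is_functor C D F \<Longrightarrow> f \<in> Hom C a b \<Longrightarrow> g \<in> Hom C b c
    \<Longrightarrow> FA F (g \<cdot>\<^bsub>C\<^esub> f) = FA F g \<cdot>\<^bsub>D\<^esub> FA F f"
  by (simp add: is_functor_def Hom_def)

lemma fcomp_simps [simp]: "FO (fcomp G F) a = FO G (FO F a)" "FA (fcomp G F) f = FA G (FA F f)"
  by (simp_all add: fcomp_def)

lemma idfun_simps [simp]: "FO idfun a = a" "FA idfun f = f"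
  by (simp_all add: idfun_def)

lemma is_functor_fcomp:
  assumes F: "is_functor C D F" and G: "is_functor D E G"
  shows "is_functor C E (fcomp G F)"
  unfolding is_functor_def
proof (intro conjI ballI impI)
  show "category C" "category E"
    using F G by (simp_all add: is_functor_def)
  show "FO (fcomp G F) a \<in> Obj E" if "a \<in> Obj C" for a
    using that by (simp add: is_functor_Obj[OF F] is_functor_Obj[OF G])
  show "FA (fcomp G F) f \<in> Hom E (FO (fcomp G F) a) (FO (fcomp G F) b)"
    if "f \<in> Hom C a b" for f a b
    using that by (simp add: is_functor_Hom[OF F] is_functor_Hom[OF G])
  show "FA (fcomp G F) (Id C a) = Id E (FO (fcomp G F) a)" if "a \<in> Obj C" for a
    using F G that by (simp add: is_functor_def)
  show "FA (fcomp G F) (g \<cdot>\<^bsub>C\<^esub> f) = FA (fcomp G F) g \<cdot>\<^bsub>E\<^esub> FA (fcomp G F) f"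
    if "f \<in> Arr C" "g \<in> Arr C" "Cod C f = Dom C g" for f g
  proof -
    have f: "f \<in> Hom C (Dom C f) (Dom C g)" and g: "g \<in> Hom C (Dom C g) (Cod C g)"
      using that by (simp_all add: Hom_def)
    show ?thesis
      using is_functor_Comp[OF F f g]
        is_functor_Comp[OF G is_functor_Hom[OF F f] is_functor_Hom[OF F g]] by simp
  qed
qed

lemma is_functor_idfun: "category C \<Longrightarrow> is_functor C C idfun"
  by (simp add: is_functor_def)

text \<open>A functor that reindexes sorts along \<open>\<sigma>\<close> and otherwise leaves
  carriers, functions and end maps as they are. Vertex sorts must go to vertex sorts, because the
  pointwise conditions on exponentials and truth values treat the edge sort differently.\<close>

locale presheaf_functor =
  B: presheaves B carB actB incB e0B kB + E: presheaves E carE actE incE e0E kE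
  for B :: "('o1, 'm1) cat" and carB :: "'o1 \<Rightarrow> 's \<Rightarrow> 'u::set_universe set" and actB incB e0B kB
    and E :: "('o2, 'm2) cat" and carE :: "'o2 \<Rightarrow> 't \<Rightarrow> 'u set" and actE incE e0E kE +
  fixes F :: "('o1, 'm1, 'o2, 'm2) functr" and \<sigma> :: "'t \<Rightarrow> 's"
  assumes F: "is_functor B E F"
    and car_F: "carE (FO F x) s = carB x (\<sigma> s)"
    and act_F: "actE (FA F f) s = actB f (\<sigma> s)"
    and inc_F: "incE (FO F x) = incB x"
    and \<sigma>_e0: "\<sigma> e0E = e0B"
    and \<sigma>_neq: "s \<noteq> e0E \<Longrightarrow> \<sigma> s \<noteq> e0B"
    and \<sigma>_k: "\<sigma> (kE c) = kB c"
begin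

lemma pointwise_terminal_F: "B.pointwise_terminal t \<Longrightarrow> E.pointwise_terminal (FO F t)"
  by (simp add: B.pointwise_terminal_def E.pointwise_terminal_def car_F is_functor_Obj[OF F])

lemma pointwise_product_F:
  "B.pointwise_product a b P p1 p2
    \<Longrightarrow> E.pointwise_product (FO F a) (FO F b) (FO F P) (FA F p1) (FA F p2)"
  by (auto simp: B.pointwise_product_def E.pointwise_product_def car_F act_F
      is_functor_Obj[OF F] intro: is_functor_Hom[OF F])

lemma pointwise_limit_F:
  assumes x: "B.pointwise_limit J D x p"
  shows "E.pointwise_limit J (fcomp F D) (FO F x) (\<lambda>j. FA F (p j))"
proof -
  have D: "is_functor J B D" and p: "is_cone J B D x p"
    using x by (simp_all add: B.pointwise_limit_def)
  have "is_cone J E (fcomp F D) (FO F x) (\<lambda>j. FA F (p j))"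
    unfolding is_cone_def
  proof (intro conjI ballI)
    show "FO F x \<in> Obj E"
      using p by (simp add: is_cone_def is_functor_Obj[OF F])
    show "FA F (p j) \<in> Hom E (FO F x) (FO (fcomp F D) j)" if "j \<in> Obj J" for j
      using p that by (simp add: is_cone_def is_functor_Hom[OF F])
    fix u assume u: "u \<in> Arr J"
    note u' = B.functor_Arr_Hom[OF D u]
    have "p (Dom J u) \<in> Hom B x (FO D (Dom J u))" "FA D u \<cdot>\<^bsub>B\<^esub> p (Dom J u) = p (Cod J u)"
      using p u u'(2) by (simp_all add: is_cone_def)
    then show "FA (fcomp F D) u \<cdot>\<^bsub>E\<^esub> FA F (p (Dom J u)) = FA F (p (Cod J u))"
      using is_functor_Comp[OF F _ u'(1)] by fastforce
  qed
  moreover have "E.compatible J (fcomp F D) s w \<longleftrightarrow> B.compatible J D (\<sigma> s) w" for s w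
    by (simp add: E.compatible_def B.compatible_def car_F act_F)
  ultimately show ?thesis
    using x is_functor_fcomp[OF D F]
    by (simp add: E.pointwise_limit_def B.pointwise_limit_def car_F act_F)
qed

text \<open>Since the end functions are indexed by ends, the conditions in \<open>B\<close> and in
  \<open>E\<close> coincide after renaming sorts, even if \<open>kE\<close> separates two ends whose
  sorts \<open>kB\<close> identifies.\<close>

lemma pointwise_exponential_F:
  assumes "B.pointwise_exponential a b X P p1 p2 ev"
  shows "E.pointwise_exponential (FO F a) (FO F b) (FO F X) (FO F P) (FA F p1) (FA F p2) (FA F ev)"
proof -
  have "E.curries (FO F P) (FA F p1) (FA F p2) (FA F ev) s x f
      \<longleftrightarrow> B.curries P p1 p2 ev (\<sigma> s) x f" for s x f
    by (simp add: E.curries_def B.curries_def car_F act_F)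
  then show ?thesis
    using assms is_functor_Hom[OF F] pointwise_product_F
    unfolding E.pointwise_exponential_def B.pointwise_exponential_def
    by (simp add: car_F inc_F \<sigma>_e0 \<sigma>_neq \<sigma>_k)
qed

lemma pointwise_classifier_F:
  assumes "B.pointwise_classifier \<Omega> tr"
  shows "E.pointwise_classifier (FO F \<Omega>) (FA F tr)"
proof -
  obtain \<beta> where tr: "tr \<in> Arr B" "Cod B tr = \<Omega>" "B.pointwise_terminal (Dom B tr)"
    and \<beta>: "B.truth_coding \<Omega> \<beta>" "\<And>s t. t \<in> carB (Dom B tr) s \<Longrightarrow> \<beta> s (actB tr s t) = (True, True, True)"
    using assms unfolding B.pointwise_classifier_def by blast
  have "FA F tr \<in> Hom E (FO F (Dom B tr)) (FO F \<Omega>)"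
    using tr by (intro is_functor_Hom[OF F]) (simp add: Hom_def)
  moreover have "E.truth_coding (FO F \<Omega>) (\<lambda>s. \<beta> (\<sigma> s))"
    unfolding E.truth_coding_def
  proof (intro conjI allI ballI)
    have "B.truth (\<sigma> s) = E.truth s" for s
      by (cases "s = e0E") (simp_all add: B.truth_def E.truth_def \<sigma>_e0 \<sigma>_neq)
    then show "bij_betw (\<beta> (\<sigma> s)) (carE (FO F \<Omega>) s) (E.truth s)" for s
      using \<beta>(1) by (metis B.truth_coding_def car_F)
    show "\<beta> (\<sigma> (kE c)) (incE (FO F \<Omega>) c e) = E.truth_end c (\<beta> (\<sigma> e0E) e)"
      if "e \<in> carE (FO F \<Omega>) e0E" for c e
      using \<beta>(1) that
      by (simp add: B.truth_coding_def car_F inc_F \<sigma>_k \<sigma>_e0 E.truth_end_def B.truth_end_def)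
  qed
  ultimately show ?thesis
    using tr(3) pointwise_terminal_F \<beta>(2) unfolding E.pointwise_classifier_def
    by (auto simp: Hom_def car_F act_F intro!: exI[of _ "\<lambda>s. \<beta> (\<sigma> s)"])
qed

lemma logical: "logical_functor B E F"
  unfolding logical_functor_def preserves_finite_limits_def preserves_exponentials_def
    preserves_subobject_classifier_def
  by (auto simp: B.limit_iff E.limit_iff B.exponential_iff E.exponential_iff
      B.subobject_classifier_iff E.subobject_classifier_iff
      intro: F pointwise_limit_F pointwise_exponential_F pointwise_classifier_F)

end

section \<open>Quivers and incidence hypergraphs\<close>

lemma Quiv_simps [simp]:
  "Obj Quiv = quivers" "Arr Quiv = quiver_homs" "Dom Quiv = qdom" "Cod Quiv = qcod"
  by (simp_all add: Quiv_def)

lemma Quiv_comp_simps [simp]: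
  "qdom (g \<cdot>\<^bsub>Quiv\<^esub> f) = qdom f" "qcod (g \<cdot>\<^bsub>Quiv\<^esub> f) = qcod g"
  "qdom (Id Quiv Q) = Q" "qcod (Id Quiv Q) = Q"
  "v \<in> Vert (qdom f) \<Longrightarrow> onV (g \<cdot>\<^bsub>Quiv\<^esub> f) v = onV g (onV f v)"
  "e \<in> Edge (qdom f) \<Longrightarrow> onE (g \<cdot>\<^bsub>Quiv\<^esub> f) e = onE g (onE f e)"
  "v \<in> Vert Q \<Longrightarrow> onV (Id Quiv Q) v = v" "e \<in> Edge Q \<Longrightarrow> onE (Id Quiv Q) e = e"
  by (simp_all add: Quiv_def compose_eq)

lemma Hom_Quiv_iff:
  "f \<in> Hom Quiv x y \<longleftrightarrow> x \<in> quivers \<and> y \<in> quivers \<and> qdom f = x \<and> qcod f = y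
    \<and> onV f \<in> Vert x \<rightarrow>\<^sub>E Vert y \<and> onE f \<in> Edge x \<rightarrow>\<^sub>E Edge y
    \<and> (\<forall>e\<in>Edge x. src y (onE f e) = onV f (src x e) \<and> tgt y (onE f e) = onV f (tgt x e))"
  by (auto simp: Hom_def quiver_homs_def)

lemma Hom_QuivD:
  assumes "f \<in> Hom Quiv x y"
  shows "x \<in> quivers" "y \<in> quivers" "qdom f = x" "qcod f = y"
    "v \<in> Vert x \<Longrightarrow> onV f v \<in> Vert y" "e \<in> Edge x \<Longrightarrow> onE f e \<in> Edge y"
    "e \<in> Edge x \<Longrightarrow> src y (onE f e) = onV f (src x e)"
    "e \<in> Edge x \<Longrightarrow> tgt y (onE f e) = onV f (tgt x e)"
  using assms by (auto simp: Hom_Quiv_iff)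

lemma quiversD:
  assumes "Q \<in> quivers"
  shows "small (Vert Q)" "small (Edge Q)" "e \<in> Edge Q \<Longrightarrow> src Q e \<in> Vert Q"
    "e \<in> Edge Q \<Longrightarrow> tgt Q e \<in> Vert Q"
  using assms by (auto simp: quivers_def)

lemma quiver_hom_eqI:
  assumes f: "f \<in> Hom Quiv x y" and g: "g \<in> Hom Quiv x y"
    and "\<And>v. v \<in> Vert x \<Longrightarrow> onV f v = onV g v" "\<And>e. e \<in> Edge x \<Longrightarrow> onE f e = onE g e"
  shows "f = g"
proof -
  have "onV f = onV g" "onE f = onE g"
    using assms by (auto simp: Hom_Quiv_iff intro: PiE_ext)
  with f g show ?thesis
    by (simp add: Hom_Quiv_iff)
qed

lemma quiver_homI:
  assumes "x \<in> quivers" "y \<in> quivers" "\<And>v. v \<in> Vert x \<Longrightarrow> p v \<in> Vert y"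
    "\<And>e. e \<in> Edge x \<Longrightarrow> q e \<in> Edge y" "\<And>e. e \<in> Edge x \<Longrightarrow> src y (q e) = p (src x e)"
    "\<And>e. e \<in> Edge x \<Longrightarrow> tgt y (q e) = p (tgt x e)"
  shows "\<lparr>qdom = x, qcod = y, onV = restrict p (Vert x), onE = restrict q (Edge x)\<rparr> \<in> Hom Quiv x y"
  using assms by (auto simp: Hom_Quiv_iff quiversD)

lemma Id_Quiv: "Id Quiv Q = \<lparr>qdom = Q, qcod = Q, onV = (\<lambda>v\<in>Vert Q. v), onE = (\<lambda>e\<in>Edge Q. e)\<rparr>"
  by (simp add: Quiv_def)

lemma Comp_Quiv:
  "g \<cdot>\<^bsub>Quiv\<^esub> f = \<lparr>qdom = qdom f, qcod = qcod g,
    onV = (\<lambda>v\<in>Vert (qdom f). onV g (onV f v)), onE = (\<lambda>e\<in>Edge (qdom f). onE g (onE f e))\<rparr>"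
  by (simp add: Quiv_def compose_def)

interpretation Quiv: category Quiv
proof
  show Comp: "g \<cdot>\<^bsub>Quiv\<^esub> f \<in> Hom Quiv a c" if "f \<in> Hom Quiv a b" "g \<in> Hom Quiv b c" for f g a b c
    using that unfolding Comp_Quiv Hom_QuivD(3)[OF that(1)] Hom_QuivD(4)[OF that(2)]
    by (intro quiver_homI) (simp_all add: Hom_QuivD)
  show Id: "Id Quiv a \<in> Hom Quiv a a" if "a \<in> Obj Quiv" for a
    using that unfolding Id_Quiv by (intro quiver_homI) simp_all
  show "Id Quiv b \<cdot>\<^bsub>Quiv\<^esub> f = f" "f \<cdot>\<^bsub>Quiv\<^esub> Id Quiv a = f" if f: "f \<in> Hom Quiv a b" for f a b
    using Comp[OF f Id] Comp[OF Id f] f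
    by (auto intro!: quiver_hom_eqI[of _ a b] simp: Hom_QuivD[OF f])
  show "(h \<cdot>\<^bsub>Quiv\<^esub> g) \<cdot>\<^bsub>Quiv\<^esub> f = h \<cdot>\<^bsub>Quiv\<^esub> (g \<cdot>\<^bsub>Quiv\<^esub> f)"
    if "f \<in> Hom Quiv a b" "g \<in> Hom Quiv b c" "h \<in> Hom Quiv c d" for f g h a b c d
    using that Comp[OF Comp[OF that(1,2)] that(3)] Comp[OF that(1) Comp[OF that(2,3)]]
    by (auto intro!: quiver_hom_eqI[of _ a d] simp: Hom_QuivD)
qed (auto simp: quiver_homs_def)

lemma IncHyp_simps [simp]:
  "Obj IncHyp = ihyps" "Arr IncHyp = ihyp_homs" "Dom IncHyp = hdom" "Cod IncHyp = hcod"
  by (simp_all add: IncHyp_def)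

lemma IncHyp_comp_simps [simp]:
  "hdom (g \<cdot>\<^bsub>IncHyp\<^esub> f) = hdom f" "hcod (g \<cdot>\<^bsub>IncHyp\<^esub> f) = hcod g"
  "hdom (Id IncHyp G) = G" "hcod (Id IncHyp G) = G"
  "v \<in> HVert (hdom f) \<Longrightarrow> onHV (g \<cdot>\<^bsub>IncHyp\<^esub> f) v = onHV g (onHV f v)"
  "e \<in> HEdge (hdom f) \<Longrightarrow> onHE (g \<cdot>\<^bsub>IncHyp\<^esub> f) e = onHE g (onHE f e)"
  "i \<in> Inc (hdom f) \<Longrightarrow> onI (g \<cdot>\<^bsub>IncHyp\<^esub> f) i = onI g (onI f i)"
  "v \<in> HVert G \<Longrightarrow> onHV (Id IncHyp G) v = v" "e \<in> HEdge G \<Longrightarrow> onHE (Id IncHyp G) e = e"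
  "i \<in> Inc G \<Longrightarrow> onI (Id IncHyp G) i = i"
  by (simp_all add: IncHyp_def compose_eq)

lemma Hom_IncHyp_iff:
  "f \<in> Hom IncHyp x y \<longleftrightarrow> x \<in> ihyps \<and> y \<in> ihyps \<and> hdom f = x \<and> hcod f = y
    \<and> onHV f \<in> HVert x \<rightarrow>\<^sub>E HVert y \<and> onHE f \<in> HEdge x \<rightarrow>\<^sub>E HEdge y \<and> onI f \<in> Inc x \<rightarrow>\<^sub>E Inc y
    \<and> (\<forall>i\<in>Inc x. port y (onI f i) = onHV f (port x i) \<and> att y (onI f i) = onHE f (att x i))"
  by (auto simp: Hom_def ihyp_homs_def)

lemma Hom_IncHypD:
  assumes "f \<in> Hom IncHyp x y"
  shows "x \<in> ihyps" "y \<in> ihyps" "hdom f = x" "hcod f = y"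
    "v \<in> HVert x \<Longrightarrow> onHV f v \<in> HVert y" "e \<in> HEdge x \<Longrightarrow> onHE f e \<in> HEdge y"
    "i \<in> Inc x \<Longrightarrow> onI f i \<in> Inc y"
    "i \<in> Inc x \<Longrightarrow> port y (onI f i) = onHV f (port x i)"
    "i \<in> Inc x \<Longrightarrow> att y (onI f i) = onHE f (att x i)"
  using assms by (auto simp: Hom_IncHyp_iff)

lemma ihypsD:
  assumes "G \<in> ihyps"
  shows "small (HVert G)" "small (HEdge G)" "small (Inc G)" "i \<in> Inc G \<Longrightarrow> port G i \<in> HVert G"
    "i \<in> Inc G \<Longrightarrow> att G i \<in> HEdge G"
  using assms by (auto simp: ihyps_def)

lemma ihyp_hom_eqI:
  assumes f: "f \<in> Hom IncHyp x y" and g: "g \<in> Hom IncHyp x y"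
    and "\<And>v. v \<in> HVert x \<Longrightarrow> onHV f v = onHV g v" "\<And>e. e \<in> HEdge x \<Longrightarrow> onHE f e = onHE g e"
    "\<And>i. i \<in> Inc x \<Longrightarrow> onI f i = onI g i"
  shows "f = g"
proof -
  have "onHV f = onHV g" "onHE f = onHE g" "onI f = onI g"
    using assms by (auto simp: Hom_IncHyp_iff intro: PiE_ext)
  with f g show ?thesis
    by (simp add: Hom_IncHyp_iff)
qed

lemma ihyp_homI:
  assumes "x \<in> ihyps" "y \<in> ihyps" "\<And>v. v \<in> HVert x \<Longrightarrow> p v \<in> HVert y"
    "\<And>e. e \<in> HEdge x \<Longrightarrow> q e \<in> HEdge y" "\<And>i. i \<in> Inc x \<Longrightarrow> r i \<in> Inc y"
    "\<And>i. i \<in> Inc x \<Longrightarrow> port y (r i) = p (port x i)" "\<And>i. i \<in> Inc x \<Longrightarrow> att y (r i) = q (att x i)"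
  shows "\<lparr>hdom = x, hcod = y, onHV = restrict p (HVert x), onHE = restrict q (HEdge x),
    onI = restrict r (Inc x)\<rparr> \<in> Hom IncHyp x y"
  using assms by (auto simp: Hom_IncHyp_iff ihypsD)

lemma Id_IncHyp:
  "Id IncHyp G = \<lparr>hdom = G, hcod = G, onHV = (\<lambda>v\<in>HVert G. v), onHE = (\<lambda>e\<in>HEdge G. e),
    onI = (\<lambda>i\<in>Inc G. i)\<rparr>"
  by (simp add: IncHyp_def)

lemma Comp_IncHyp:
  "g \<cdot>\<^bsub>IncHyp\<^esub> f = \<lparr>hdom = hdom f, hcod = hcod g,
    onHV = (\<lambda>v\<in>HVert (hdom f). onHV g (onHV f v)), onHE = (\<lambda>e\<in>HEdge (hdom f). onHE g (onHE f e)),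
    onI = (\<lambda>i\<in>Inc (hdom f). onI g (onI f i))\<rparr>"
  by (simp add: IncHyp_def compose_def)

interpretation IncHyp: category IncHyp
proof
  show Comp: "g \<cdot>\<^bsub>IncHyp\<^esub> f \<in> Hom IncHyp a c"
    if "f \<in> Hom IncHyp a b" "g \<in> Hom IncHyp b c" for f g a b c
    using that unfolding Comp_IncHyp Hom_IncHypD(3)[OF that(1)] Hom_IncHypD(4)[OF that(2)]
    by (intro ihyp_homI) (simp_all add: Hom_IncHypD)
  show Id: "Id IncHyp a \<in> Hom IncHyp a a" if "a \<in> Obj IncHyp" for a
    using that unfolding Id_IncHyp by (intro ihyp_homI) simp_all
  show "Id IncHyp b \<cdot>\<^bsub>IncHyp\<^esub> f = f" "f \<cdot>\<^bsub>IncHyp\<^esub> Id IncHyp a = f"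
    if f: "f \<in> Hom IncHyp a b" for f a b
    using Comp[OF f Id] Comp[OF Id f] f
    by (auto intro!: ihyp_hom_eqI[of _ a b] simp: Hom_IncHypD[OF f])
  show "(h \<cdot>\<^bsub>IncHyp\<^esub> g) \<cdot>\<^bsub>IncHyp\<^esub> f = h \<cdot>\<^bsub>IncHyp\<^esub> (g \<cdot>\<^bsub>IncHyp\<^esub> f)"
    if "f \<in> Hom IncHyp a b" "g \<in> Hom IncHyp b c" "h \<in> Hom IncHyp c d" for f g h a b c d
    using that Comp[OF Comp[OF that(1,2)] that(3)] Comp[OF that(1) Comp[OF that(2,3)]]
    by (auto intro!: ihyp_hom_eqI[of _ a d] simp: Hom_IncHypD)
qed (auto simp: ihyp_homs_def)

section \<open>Sorts and end maps of quivers and incidence hypergraphs\<close>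

datatype quiver_sort = QV | QE

datatype ihyp_sort = HV | HE | HI

definition quiver_car :: "'u quiver \<Rightarrow> quiver_sort \<Rightarrow> 'u set"
  where "quiver_car Q s = (case s of QV \<Rightarrow> Vert Q | QE \<Rightarrow> Edge Q)"

definition quiver_act :: "'u quiver_hom \<Rightarrow> quiver_sort \<Rightarrow> 'u \<Rightarrow> 'u"
  where "quiver_act f s = (case s of QV \<Rightarrow> onV f | QE \<Rightarrow> onE f)"

definition quiver_inc :: "'u quiver \<Rightarrow> bool \<Rightarrow> 'u \<Rightarrow> 'u"
  where "quiver_inc Q c = (if c then tgt Q else src Q)"

definition ihyp_car :: "'u ihyp \<Rightarrow> ihyp_sort \<Rightarrow> 'u set"
  where "ihyp_car G s = (case s of HV \<Rightarrow> HVert G | HE \<Rightarrow> HEdge G | HI \<Rightarrow> Inc G)"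

definition ihyp_act :: "'u ihyp_hom \<Rightarrow> ihyp_sort \<Rightarrow> 'u \<Rightarrow> 'u"
  where "ihyp_act f s = (case s of HV \<Rightarrow> onHV f | HE \<Rightarrow> onHE f | HI \<Rightarrow> onI f)"

definition ihyp_inc :: "'u ihyp \<Rightarrow> bool \<Rightarrow> 'u \<Rightarrow> 'u"
  where "ihyp_inc G c = (if c then att G else port G)"

lemma all_quiver_sort: "(\<forall>s. P s) \<longleftrightarrow> P QV \<and> P QE"
  by (metis quiver_sort.exhaust)

lemma all_ihyp_sort: "(\<forall>s. P s) \<longleftrightarrow> P HV \<and> P HE \<and> P HI"
  by (metis ihyp_sort.exhaust)

interpretation Quiv: presheaves Quiv quiver_car quiver_act quiver_inc QE "\<lambda>_. QV"
\<comment> \<open>Case 8 is extensionality of arrows; cases 9 and 10 provide an object with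
  prescribed carriers and an arrow with prescribed functions. The other assumptions only need
  unfolding.\<close>
proof (unfold_locales, goal_cases)
  case (8 f x y g)
  then show ?case
    using 8(3)[of _ QV] 8(3)[of _ QE]
    by (auto simp: quiver_car_def quiver_act_def intro: quiver_hom_eqI)
next
  case (9 W i)
  let ?Q = "\<lparr>Vert = W QV, Edge = W QE, src = restrict (i False) (W QE),
    tgt = restrict (i True) (W QE)\<rparr>"
  have "?Q \<in> quivers"
    using 9 by (auto simp: quivers_def)
  then show ?case
    by (intro bexI[of _ ?Q]) (auto simp: quiver_car_def quiver_inc_def split: quiver_sort.split)
next
  case (10 x y h)
  let ?f = "\<lparr>qdom = x, qcod = y, onV = restrict (h QV) (Vert x), onE = restrict (h QE) (Edge x)\<rparr>"
  have "?f \<in> Hom Quiv x y"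
    using 10(1,2) 10(3)[of _ QV] 10(3)[of _ QE] 10(4)[of _ False] 10(4)[of _ True]
    by (intro quiver_homI) (simp_all add: quiver_car_def quiver_inc_def)
  then show ?case
    by (intro bexI[of _ ?f]) (auto simp: quiver_car_def quiver_act_def split: quiver_sort.split)
qed (auto simp: quiver_car_def quiver_act_def quiver_inc_def quiversD Hom_QuivD
    split: quiver_sort.splits)

interpretation IncHyp: presheaves IncHyp ihyp_car ihyp_act ihyp_inc HI "\<lambda>c. if c then HE else HV"
proof (unfold_locales, goal_cases)
  case (8 f x y g)
  then show ?case
    using 8(3)[of _ HV] 8(3)[of _ HE] 8(3)[of _ HI]
    by (auto simp: ihyp_car_def ihyp_act_def intro: ihyp_hom_eqI)
next
  case (9 W i)
  let ?G = "\<lparr>HVert = W HV, HEdge = W HE, Inc = W HI, port = restrict (i False) (W HI),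
    att = restrict (i True) (W HI)\<rparr>"
  have "?G \<in> ihyps"
    using 9(1) 9(2)[of _ False] 9(2)[of _ True] by (auto simp: ihyps_def)
  then show ?case
    by (intro bexI[of _ ?G]) (auto simp: ihyp_car_def ihyp_inc_def split: ihyp_sort.split)
next
  case (10 x y h)
  let ?f = "\<lparr>hdom = x, hcod = y, onHV = restrict (h HV) (HVert x), onHE = restrict (h HE) (HEdge x),
    onI = restrict (h HI) (Inc x)\<rparr>"
  have "?f \<in> Hom IncHyp x y"
    using 10(1,2) 10(3)[of _ HV] 10(3)[of _ HE] 10(3)[of _ HI] 10(4)[of _ False] 10(4)[of _ True]
    by (intro ihyp_homI) (simp_all add: ihyp_car_def ihyp_inc_def)
  then show ?case
    by (intro bexI[of _ ?f]) (auto simp: ihyp_car_def ihyp_act_def split: ihyp_sort.split)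
qed (auto simp: ihyp_car_def ihyp_act_def ihyp_inc_def ihypsD Hom_IncHypD
    split: ihyp_sort.splits)

section \<open>\<open>\<Upsilon>\<close> and its adjoints\<close>

lemma is_functorI:
  assumes "category C" "category D" "\<And>a. a \<in> Obj C \<Longrightarrow> FO F a \<in> Obj D"
    and "\<And>f a b. f \<in> Hom C a b \<Longrightarrow> FA F f \<in> Hom D (FO F a) (FO F b)"
    and "\<And>a. a \<in> Obj C \<Longrightarrow> FA F (Id C a) = Id D (FO F a)"
    and "\<And>f g a b c. f \<in> Hom C a b \<Longrightarrow> g \<in> Hom C b c
      \<Longrightarrow> FA F (g \<cdot>\<^bsub>C\<^esub> f) = FA F g \<cdot>\<^bsub>D\<^esub> FA F f"
  shows "is_functor C D F"
  unfolding is_functor_def using assms by (auto simp: Hom_def)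

lemma natural_transI:
  assumes "is_functor C D F" "is_functor C D G" "\<And>a. a \<in> Obj C \<Longrightarrow> t a \<in> Hom D (FO F a) (FO G a)"
    and "\<And>f a b. f \<in> Hom C a b \<Longrightarrow> t b \<cdot>\<^bsub>D\<^esub> FA F f = FA G f \<cdot>\<^bsub>D\<^esub> t a"
  shows "natural_trans C D F G t"
  unfolding natural_trans_def using assms by (auto simp: Hom_def)

lemma adjunctionI:
  assumes L: "is_functor C D L" and R: "is_functor D C R"
    and "\<And>a. a \<in> Obj C \<Longrightarrow> \<eta> a \<in> Hom C a (FO R (FO L a))"
    and "\<And>f a b. f \<in> Hom C a b \<Longrightarrow> \<eta> b \<cdot>\<^bsub>C\<^esub> f = FA R (FA L f) \<cdot>\<^bsub>C\<^esub> \<eta> a"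
    and "\<And>b. b \<in> Obj D \<Longrightarrow> \<epsilon> b \<in> Hom D (FO L (FO R b)) b"
    and "\<And>f a b. f \<in> Hom D a b \<Longrightarrow> \<epsilon> b \<cdot>\<^bsub>D\<^esub> FA L (FA R f) = f \<cdot>\<^bsub>D\<^esub> \<epsilon> a"
    and "\<And>a. a \<in> Obj C \<Longrightarrow> \<epsilon> (FO L a) \<cdot>\<^bsub>D\<^esub> FA L (\<eta> a) = Id D (FO L a)"
    and "\<And>b. b \<in> Obj D \<Longrightarrow> FA R (\<epsilon> b) \<cdot>\<^bsub>C\<^esub> \<eta> (FO R b) = Id C (FO R b)"
  shows "adjunction C D L R \<eta> \<epsilon>"
proof -
  have "category C" "category D"
    using L by (simp_all add: is_functor_def)
  then show ?thesis
    unfolding adjunction_def using assms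
    by (auto intro!: natural_transI is_functor_idfun is_functor_fcomp[OF L R] is_functor_fcomp[OF R L])
qed

section \<open>Pairs and smallness in the universe\<close>

lemma pfst_pr [simp]: "pfst (pr a b) = a"
  unfolding pfst_def by (rule the_equality) (auto simp: pr_inject)

lemma psnd_pr [simp]: "psnd (pr a b) = b"
  unfolding psnd_def by (rule the_equality) (auto simp: pr_inject)

lemma pmap_pr [simp]: "pmap f g (pr a b) = pr (f a) (g b)"
  by (simp add: pmap_def)

declare pr_inject [simp] tag1_neq_tag2 [simp] tag1_neq_tag2 [symmetric, simp]

lemma pr_mem_ptimes [simp]: "pr a b \<in> A \<otimes> B \<longleftrightarrow> a \<in> A \<and> b \<in> B"
  by (auto simp: ptimes_def)

lemma ptimesE:
  assumes "z \<in> A \<otimes> B" obtains a b where "z = pr a b" "a \<in> A" "b \<in> B"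
  using assms by (auto simp: ptimes_def)

lemma small_finite: "finite A \<Longrightarrow> small (A :: 'u::set_universe set)"
  by (simp add: small_def finite_lesspoll_UNIV)

lemma small_Un: "small A \<Longrightarrow> small B \<Longrightarrow> small (A \<union> B :: 'u::set_universe set)"
  by (simp add: small_def lesspoll_UNIV_Un)

lemma small_subset: "A \<subseteq> B \<Longrightarrow> small B \<Longrightarrow> small A"
  unfolding small_def by (rule lesspoll_subset)

lemma small_ptimes: "small A \<Longrightarrow> small B \<Longrightarrow> small (A \<otimes> B :: 'u::set_universe set)"
proof -
  assume "small A" "small B"
  then have "(\<lambda>(a, b). pr a b) ` (A \<times> B) \<prec> (UNIV :: 'u set)"
    by (intro lesspoll_image lesspoll_UNIV_Times) (simp_all add: small_def)
  moreover have "(\<lambda>(a, b). pr a b) ` (A \<times> B) = A \<otimes> B"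
    by (auto simp: ptimes_def)
  ultimately show ?thesis
    by (simp add: small_def)
qed

section \<open>Functoriality of \<Upsilon> and its two adjoints\<close>

lemma Ups_simps [simp]:
  "FO Ups Q = Ups_obj Q" "HVert (Ups_obj Q) = Vert Q" "HEdge (Ups_obj Q) = Vert Q"
  "Inc (Ups_obj Q) = Edge Q" "port (Ups_obj Q) = src Q" "att (Ups_obj Q) = tgt Q"
  "hdom (FA Ups f) = Ups_obj (qdom f)" "hcod (FA Ups f) = Ups_obj (qcod f)"
  "onHV (FA Ups f) = onV f" "onHE (FA Ups f) = onV f" "onI (FA Ups f) = onE f"
  by (simp_all add: Ups_def Ups_obj_def)

lemma Ups_dia_simps [simp]:
  "FO Ups_dia G = Ups_dia_obj G" "Edge (Ups_dia_obj G) = Inc G"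
  "i \<in> Inc G \<Longrightarrow> src (Ups_dia_obj G) i = pr tag1 (port G i)"
  "i \<in> Inc G \<Longrightarrow> tgt (Ups_dia_obj G) i = pr tag2 (att G i)"
  "qdom (FA Ups_dia f) = Ups_dia_obj (hdom f)" "qcod (FA Ups_dia f) = Ups_dia_obj (hcod f)"
  "onE (FA Ups_dia f) = onI f"
  "pr t x \<in> Vert (Ups_dia_obj G) \<longleftrightarrow> t = tag1 \<and> x \<in> HVert G \<or> t = tag2 \<and> x \<in> HEdge G"
  "x \<in> HVert (hdom f) \<Longrightarrow> onV (FA Ups_dia f) (pr tag1 x) = pr tag1 (onHV f x)"
  "e \<in> HEdge (hdom f) \<Longrightarrow> onV (FA Ups_dia f) (pr tag2 e) = pr tag2 (onHE f e)"
  by (auto simp: Ups_dia_def Ups_dia_obj_def)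

lemma Vert_Ups_diaE:
  assumes "v \<in> Vert (Ups_dia_obj G)"
  obtains x where "v = pr tag1 x" "x \<in> HVert G" | e where "v = pr tag2 e" "e \<in> HEdge G"
  using assms by (auto simp: Ups_dia_obj_def elim!: ptimesE)

lemma Ups_star_simps [simp]:
  "FO Ups_star G = Ups_star_obj G" "Vert (Ups_star_obj G) = HVert G \<otimes> HEdge G"
  "Edge (Ups_star_obj G) = HVert G \<otimes> Inc G \<otimes> HEdge G"
  "v \<in> HVert G \<Longrightarrow> i \<in> Inc G \<Longrightarrow> e \<in> HEdge G \<Longrightarrow> src (Ups_star_obj G) (pr v (pr i e)) = pr (port G i) e"
  "v \<in> HVert G \<Longrightarrow> i \<in> Inc G \<Longrightarrow> e \<in> HEdge G \<Longrightarrow> tgt (Ups_star_obj G) (pr v (pr i e)) = pr v (att G i)"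
  "qdom (FA Ups_star f) = Ups_star_obj (hdom f)" "qcod (FA Ups_star f) = Ups_star_obj (hcod f)"
  "v \<in> HVert (hdom f) \<Longrightarrow> e \<in> HEdge (hdom f)
    \<Longrightarrow> onV (FA Ups_star f) (pr v e) = pr (onHV f v) (onHE f e)"
  "v \<in> HVert (hdom f) \<Longrightarrow> i \<in> Inc (hdom f) \<Longrightarrow> e \<in> HEdge (hdom f)
    \<Longrightarrow> onE (FA Ups_star f) (pr v (pr i e)) = pr (onHV f v) (pr (onI f i) (onHE f e))"
  by (auto simp: Ups_star_def Ups_star_obj_def)

lemma Ups_obj_ihyps: "Q \<in> quivers \<Longrightarrow> Ups_obj Q \<in> ihyps"
  by (auto simp: quivers_def ihyps_def)

lemma Ups_functor: "is_functor Quiv IncHyp Ups"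
proof (rule is_functorI)
  show "FA Ups f \<in> Hom IncHyp (FO Ups a) (FO Ups b)" if "f \<in> Hom Quiv a b" for f and a b :: "'a quiver"
    using that by (auto simp: Hom_Quiv_iff Hom_IncHyp_iff Ups_obj_ihyps)
  show "FA Ups (Id Quiv a) = Id IncHyp (FO Ups a)" for a :: "'a quiver"
    by (simp add: Id_Quiv Id_IncHyp Ups_def Ups_obj_def)
  show "FA Ups (g \<cdot>\<^bsub>Quiv\<^esub> f) = FA Ups g \<cdot>\<^bsub>IncHyp\<^esub> FA Ups f" for g f :: "'a quiver_hom"
    by (simp add: Comp_Quiv Comp_IncHyp Ups_def Ups_obj_def)
qed (simp_all add: Quiv.category_axioms IncHyp.category_axioms Ups_obj_ihyps)

lemma Ups_dia_obj_quivers: "G \<in> ihyps \<Longrightarrow> Ups_dia_obj G \<in> quivers"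
  by (auto simp: quivers_def Ups_dia_obj_def small_Un small_ptimes small_finite ihypsD)

lemma Ups_dia_Hom: "f \<in> Hom IncHyp a b \<Longrightarrow> FA Ups_dia f \<in> Hom Quiv (Ups_dia_obj a) (Ups_dia_obj b)"
  by (auto simp: Hom_Quiv_iff Hom_IncHyp_iff Ups_dia_obj_quivers ihypsD PiE_iff extensional_def
      elim!: Vert_Ups_diaE) (auto simp: Ups_dia_def)

lemma Ups_dia_functor: "is_functor IncHyp Quiv Ups_dia"
proof (rule is_functorI)
  show "FA Ups_dia f \<in> Hom Quiv (FO Ups_dia a) (FO Ups_dia b)"
    if "f \<in> Hom IncHyp a b" for f and a b :: "'a ihyp"
    using that by (simp add: Ups_dia_Hom)
  show "FA Ups_dia (Id IncHyp a) = Id Quiv (FO Ups_dia a)" if "a \<in> Obj IncHyp" for a :: "'a ihyp"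
    using that Ups_dia_Hom[OF IncHyp.Id_Hom[OF that]] Ups_dia_obj_quivers[of a]
    by (intro quiver_hom_eqI[of _ "Ups_dia_obj a" "Ups_dia_obj a"])
      (auto elim!: Vert_Ups_diaE intro: Quiv.Id_Hom)
  show "FA Ups_dia (g \<cdot>\<^bsub>IncHyp\<^esub> f) = FA Ups_dia g \<cdot>\<^bsub>Quiv\<^esub> FA Ups_dia f"
    if f: "f \<in> Hom IncHyp a b" and g: "g \<in> Hom IncHyp b c" for g f and a b c :: "'a ihyp"
    by (rule quiver_hom_eqI[OF Ups_dia_Hom[OF IncHyp.Comp_Hom[OF f g]]
          Quiv.Comp_Hom[OF Ups_dia_Hom[OF f] Ups_dia_Hom[OF g]]])
      (auto simp: Hom_IncHypD[OF f] Hom_IncHypD[OF g] elim!: Vert_Ups_diaE)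
qed (simp_all add: Quiv.category_axioms IncHyp.category_axioms Ups_dia_obj_quivers)

lemma Ups_star_obj_quivers: "G \<in> ihyps \<Longrightarrow> Ups_star_obj G \<in> quivers"
  by (auto simp: quivers_def Ups_star_obj_def small_ptimes ihypsD elim!: ptimesE)

lemma Ups_star_Hom:
  "f \<in> Hom IncHyp a b \<Longrightarrow> FA Ups_star f \<in> Hom Quiv (Ups_star_obj a) (Ups_star_obj b)"
  by (auto simp: Hom_Quiv_iff Hom_IncHyp_iff Ups_star_obj_quivers ihypsD PiE_iff extensional_def
      elim!: ptimesE) (auto simp: Ups_star_def)

lemma Ups_star_functor: "is_functor IncHyp Quiv Ups_star"
proof (rule is_functorI)
  show "FA Ups_star f \<in> Hom Quiv (FO Ups_star a) (FO Ups_star b)"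
    if "f \<in> Hom IncHyp a b" for f and a b :: "'a ihyp"
    using that by (simp add: Ups_star_Hom)
  show "FA Ups_star (Id IncHyp a) = Id Quiv (FO Ups_star a)" if "a \<in> Obj IncHyp" for a :: "'a ihyp"
    using that Ups_star_Hom[OF IncHyp.Id_Hom[OF that]] Ups_star_obj_quivers[of a]
    by (intro quiver_hom_eqI[of _ "Ups_star_obj a" "Ups_star_obj a"])
      (auto elim!: ptimesE intro: Quiv.Id_Hom)
  show "FA Ups_star (g \<cdot>\<^bsub>IncHyp\<^esub> f) = FA Ups_star g \<cdot>\<^bsub>Quiv\<^esub> FA Ups_star f"
    if f: "f \<in> Hom IncHyp a b" and g: "g \<in> Hom IncHyp b c" for g f and a b c :: "'a ihyp"
    by (rule quiver_hom_eqI[OF Ups_star_Hom[OF IncHyp.Comp_Hom[OF f g]]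
          Quiv.Comp_Hom[OF Ups_star_Hom[OF f] Ups_star_Hom[OF g]]])
      (auto simp: Hom_IncHypD[OF f] Hom_IncHypD[OF g] elim!: ptimesE)
qed (simp_all add: Quiv.category_axioms IncHyp.category_axioms Ups_star_obj_quivers)

interpretation Ups: presheaf_functor Quiv quiver_car quiver_act quiver_inc QE "\<lambda>_. QV"
  IncHyp ihyp_car ihyp_act ihyp_inc HI "\<lambda>c. if c then HE else HV"
  Ups "\<lambda>s. case s of HV \<Rightarrow> QV | HE \<Rightarrow> QV | HI \<Rightarrow> QE"
  by unfold_locales
    (auto simp: Ups_functor quiver_car_def quiver_act_def quiver_inc_def ihyp_car_def ihyp_act_def
      ihyp_inc_def fun_eq_iff split: ihyp_sort.splits)

section \<open>Units, counits and the two adjunctions\<close>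

definition Ups_dia_unit :: "'u::set_universe ihyp \<Rightarrow> 'u ihyp_hom"
  where "Ups_dia_unit G = \<lparr>hdom = G, hcod = Ups_obj (Ups_dia_obj G), onHV = restrict (pr tag1) (HVert G),
    onHE = restrict (pr tag2) (HEdge G), onI = (\<lambda>i\<in>Inc G. i)\<rparr>"

text \<open>The target stands first and the source last because the source of a triple
  \<open>(v, i, e)\<close> is \<open>(port i, e)\<close> and its target is
  \<open>(v, att i)\<close>: for these to lie on the diagonal, \<open>e\<close> must be the source
  and \<open>v\<close> the target of \<open>i\<close>.\<close>

definition Ups_star_unit :: "'u::set_universe quiver \<Rightarrow> 'u quiver_hom"
  where "Ups_star_unit Q = \<lparr>qdom = Q, qcod = Ups_star_obj (Ups_obj Q),
    onV = (\<lambda>v\<in>Vert Q. pr v v), onE = (\<lambda>e\<in>Edge Q. pr (tgt Q e) (pr e (src Q e)))\<rparr>"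

definition Ups_star_counit :: "'u::set_universe ihyp \<Rightarrow> 'u ihyp_hom"
  where "Ups_star_counit G = \<lparr>hdom = Ups_obj (Ups_star_obj G), hcod = G,
    onHV = restrict pfst (HVert G \<otimes> HEdge G), onHE = restrict psnd (HVert G \<otimes> HEdge G),
    onI = restrict (\<lambda>z. pfst (psnd z)) (HVert G \<otimes> Inc G \<otimes> HEdge G)\<rparr>"

lemma Ups_dia_unit_Hom:
  "G \<in> ihyps \<Longrightarrow> Ups_dia_unit G \<in> Hom IncHyp G (Ups_obj (Ups_dia_obj G))"
  unfolding Ups_dia_unit_def
  by (intro ihyp_homI) (simp_all add: Ups_obj_ihyps Ups_dia_obj_quivers)

lemma Ups_counit_Hom:
  assumes "Q \<in> quivers" shows "Ups_counit Q \<in> Hom Quiv (Ups_dia_obj (Ups_obj Q)) Q"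
  unfolding Ups_counit_def
  by (rule quiver_homI[of "Ups_dia_obj (Ups_obj Q)" Q psnd "\<lambda>e. e", unfolded Ups_dia_simps(2) Ups_simps(4)])
    (use assms in \<open>auto simp: Ups_dia_obj_quivers Ups_obj_ihyps elim!: Vert_Ups_diaE\<close>)

lemma Ups_star_unit_Hom:
  "Q \<in> quivers \<Longrightarrow> Ups_star_unit Q \<in> Hom Quiv Q (Ups_star_obj (Ups_obj Q))"
  unfolding Ups_star_unit_def
  by (intro quiver_homI) (simp_all add: Ups_obj_ihyps Ups_star_obj_quivers quiversD)

lemma Ups_star_counit_Hom:
  assumes "G \<in> ihyps" shows "Ups_star_counit G \<in> Hom IncHyp (Ups_obj (Ups_star_obj G)) G"
  unfolding Ups_star_counit_def
  by (rule ihyp_homI[of "Ups_obj (Ups_star_obj G)" G pfst psnd "\<lambda>z. pfst (psnd z)",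
        unfolded Ups_simps(2-4) Ups_star_simps(2,3)])
    (use assms in \<open>auto simp: Ups_star_obj_quivers Ups_obj_ihyps elim!: ptimesE\<close>)

lemma unit_counit_simps [simp]:
  "hdom (Ups_dia_unit G) = G" "hcod (Ups_dia_unit G) = Ups_obj (Ups_dia_obj G)"
  "v \<in> HVert G \<Longrightarrow> onHV (Ups_dia_unit G) v = pr tag1 v"
  "e \<in> HEdge G \<Longrightarrow> onHE (Ups_dia_unit G) e = pr tag2 e"
  "i \<in> Inc G \<Longrightarrow> onI (Ups_dia_unit G) i = i"
  "qdom (Ups_counit Q) = Ups_dia_obj (Ups_obj Q)" "qcod (Ups_counit Q) = Q"
  "v \<in> Vert Q \<Longrightarrow> onV (Ups_counit Q) (pr tag1 v) = v"
  "v \<in> Vert Q \<Longrightarrow> onV (Ups_counit Q) (pr tag2 v) = v"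
  "e \<in> Edge Q \<Longrightarrow> onE (Ups_counit Q) e = e"
  "qdom (Ups_star_unit Q) = Q" "qcod (Ups_star_unit Q) = Ups_star_obj (Ups_obj Q)"
  "v \<in> Vert Q \<Longrightarrow> onV (Ups_star_unit Q) v = pr v v"
  "e \<in> Edge Q \<Longrightarrow> onE (Ups_star_unit Q) e = pr (tgt Q e) (pr e (src Q e))"
  "hdom (Ups_star_counit G) = Ups_obj (Ups_star_obj G)" "hcod (Ups_star_counit G) = G"
  "v \<in> HVert G \<Longrightarrow> e \<in> HEdge G \<Longrightarrow> onHV (Ups_star_counit G) (pr v e) = v"
  "v \<in> HVert G \<Longrightarrow> e \<in> HEdge G \<Longrightarrow> onHE (Ups_star_counit G) (pr v e) = e"
  "v \<in> HVert G \<Longrightarrow> i \<in> Inc G \<Longrightarrow> e \<in> HEdge G \<Longrightarrow> onI (Ups_star_counit G) (pr v (pr i e)) = i"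
  by (simp_all add: Ups_dia_unit_def Ups_counit_def Ups_star_unit_def Ups_star_counit_def)

lemma Ups_Hom: "f \<in> Hom Quiv a b \<Longrightarrow> FA Ups f \<in> Hom IncHyp (Ups_obj a) (Ups_obj b)"
  using is_functor_Hom[OF Ups_functor] by simp

text \<open>Each equation compares arrows with known domain and codomain, so by extensionality it is
  checked on elements, with the vertices of \<open>Ups_dia_obj\<close> split by tag.\<close>

lemma Ups_dia_adjunction: "adjunction IncHyp Quiv Ups_dia Ups Ups_dia_unit Ups_counit"
proof (rule adjunctionI[OF Ups_dia_functor Ups_functor])
  fix a b :: "'a ihyp" and f assume f: "f \<in> Hom IncHyp a b"
  note D = Hom_IncHypD[OF f]
  show "Ups_dia_unit b \<cdot>\<^bsub>IncHyp\<^esub> f = FA Ups (FA Ups_dia f) \<cdot>\<^bsub>IncHyp\<^esub> Ups_dia_unit a"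
    by (rule ihyp_hom_eqI[OF IncHyp.Comp_Hom[OF f Ups_dia_unit_Hom[OF D(2)]]
          IncHyp.Comp_Hom[OF Ups_dia_unit_Hom[OF D(1)] Ups_Hom[OF Ups_dia_Hom[OF f]]]])
      (simp_all add: D)
next
  fix a b :: "'a quiver" and f assume f: "f \<in> Hom Quiv a b"
  note D = Hom_QuivD[OF f]
  show "Ups_counit b \<cdot>\<^bsub>Quiv\<^esub> FA Ups_dia (FA Ups f) = f \<cdot>\<^bsub>Quiv\<^esub> Ups_counit a"
    by (rule quiver_hom_eqI[OF Quiv.Comp_Hom[OF Ups_dia_Hom[OF Ups_Hom[OF f]] Ups_counit_Hom[OF D(2)]]
          Quiv.Comp_Hom[OF Ups_counit_Hom[OF D(1)] f]])
      (auto simp: D elim!: Vert_Ups_diaE)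
next
  fix a :: "'a ihyp" assume "a \<in> Obj IncHyp"
  then have a: "a \<in> ihyps" and a': "Ups_dia_obj a \<in> quivers"
    by (simp_all add: Ups_dia_obj_quivers)
  then show "Ups_dia_unit a \<in> Hom IncHyp a (FO Ups (FO Ups_dia a))"
    by (simp add: Ups_dia_unit_Hom)
  show "Ups_counit (FO Ups_dia a) \<cdot>\<^bsub>Quiv\<^esub> FA Ups_dia (Ups_dia_unit a) = Id Quiv (FO Ups_dia a)"
    unfolding Ups_dia_simps(1)
    by (rule quiver_hom_eqI[OF Quiv.Comp_Hom[OF Ups_dia_Hom[OF Ups_dia_unit_Hom[OF a]]
          Ups_counit_Hom[OF a']] Quiv.Id_Hom])
      (auto simp: a' elim!: Vert_Ups_diaE)
next
  fix b :: "'a quiver" assume "b \<in> Obj Quiv"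
  then have b: "b \<in> quivers" and b': "Ups_obj b \<in> ihyps"
    by (simp_all add: Ups_obj_ihyps)
  then show "Ups_counit b \<in> Hom Quiv (FO Ups_dia (FO Ups b)) b"
    by (simp add: Ups_counit_Hom)
  show "FA Ups (Ups_counit b) \<cdot>\<^bsub>IncHyp\<^esub> Ups_dia_unit (FO Ups b) = Id IncHyp (FO Ups b)"
    using ihyp_hom_eqI[OF IncHyp.Comp_Hom[OF Ups_dia_unit_Hom[OF b']
          Ups_Hom[OF Ups_counit_Hom[OF b]]] IncHyp.Id_Hom] b'
    by auto
qed

lemma Ups_star_adjunction: "adjunction Quiv IncHyp Ups Ups_star Ups_star_unit Ups_star_counit"
proof (rule adjunctionI[OF Ups_functor Ups_star_functor])
  fix a b :: "'a quiver" and f assume f: "f \<in> Hom Quiv a b"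
  note D = Hom_QuivD[OF f]
  show "Ups_star_unit b \<cdot>\<^bsub>Quiv\<^esub> f = FA Ups_star (FA Ups f) \<cdot>\<^bsub>Quiv\<^esub> Ups_star_unit a"
    by (rule quiver_hom_eqI[OF Quiv.Comp_Hom[OF f Ups_star_unit_Hom[OF D(2)]]
          Quiv.Comp_Hom[OF Ups_star_unit_Hom[OF D(1)] Ups_star_Hom[OF Ups_Hom[OF f]]]])
      (simp_all add: D quiversD)
next
  fix a b :: "'a ihyp" and f assume f: "f \<in> Hom IncHyp a b"
  note D = Hom_IncHypD[OF f]
  show "Ups_star_counit b \<cdot>\<^bsub>IncHyp\<^esub> FA Ups (FA Ups_star f) = f \<cdot>\<^bsub>IncHyp\<^esub> Ups_star_counit a"
    by (rule ihyp_hom_eqI[OF IncHyp.Comp_Hom[OF Ups_Hom[OF Ups_star_Hom[OF f]]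
          Ups_star_counit_Hom[OF D(2)]] IncHyp.Comp_Hom[OF Ups_star_counit_Hom[OF D(1)] f]])
      (auto simp: D elim!: ptimesE)
next
  fix a :: "'a quiver" assume "a \<in> Obj Quiv"
  then have a: "a \<in> quivers" and a': "Ups_obj a \<in> ihyps"
    by (simp_all add: Ups_obj_ihyps)
  then show "Ups_star_unit a \<in> Hom Quiv a (FO Ups_star (FO Ups a))"
    by (simp add: Ups_star_unit_Hom)
  show "Ups_star_counit (FO Ups a) \<cdot>\<^bsub>IncHyp\<^esub> FA Ups (Ups_star_unit a) = Id IncHyp (FO Ups a)"
    using ihyp_hom_eqI[OF IncHyp.Comp_Hom[OF Ups_Hom[OF Ups_star_unit_Hom[OF a]]
          Ups_star_counit_Hom[OF a']] IncHyp.Id_Hom] a a'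
    by (auto simp: quiversD)
next
  fix b :: "'a ihyp" assume "b \<in> Obj IncHyp"
  then have b: "b \<in> ihyps" and b': "Ups_star_obj b \<in> quivers"
    by (simp_all add: Ups_star_obj_quivers)
  then show "Ups_star_counit b \<in> Hom IncHyp (FO Ups (FO Ups_star b)) b"
    by (simp add: Ups_star_counit_Hom)
  show "FA Ups_star (Ups_star_counit b) \<cdot>\<^bsub>Quiv\<^esub> Ups_star_unit (FO Ups_star b) = Id Quiv (FO Ups_star b)"
    unfolding Ups_star_simps(1)
    by (rule quiver_hom_eqI[OF Quiv.Comp_Hom[OF Ups_star_unit_Hom[OF b']
          Ups_star_Hom[OF Ups_star_counit_Hom[OF b]]] Quiv.Id_Hom])
      (auto simp: b b' ihypsD elim!: ptimesE)
qed


section \<open>Isomorphisms and faithfulness\<close>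

context presheaves begin

text \<open>The inverse functions commute with the end maps because those of \<open>f\<close> do, so
  they form an arrow.\<close>

lemma iso_if_bij:
  assumes f: "f \<in> Hom C x y" and bij: "\<And>s. bij_betw (act f s) (car x s) (car y s)"
  shows "is_iso C f"
proof -
  note O = Hom_Obj[OF f]
  let ?g = "\<lambda>s. inv_into (car x s) (act f s)"
  have g: "?g s v \<in> car x s" "act f s (?g s v) = v" if "v \<in> car y s" for s v
    using bij[of s] that by (auto simp: bij_betw_def inv_into_into f_inv_into_f)
  have gf: "?g s (act f s v) = v" if "v \<in> car x s" for s v
    using bij[of s] that by (auto simp: bij_betw_def inv_into_f_f)
  have "?g (k c) (inc y c e) = inc x c (?g e0 e)" if e: "e \<in> car y e0" for c e
    using gf[OF inc_car[OF O(1) g(1)[OF e]]] by (simp add: act_inc[OF f g(1)[OF e]] g(2)[OF e])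
  then obtain g' where g': "g' \<in> Hom C y x" "\<And>s v. v \<in> car y s \<Longrightarrow> act g' s v = ?g s v"
    using obtain_hom[OF O(2,1), of ?g] g(1) by metis
  have "g' \<cdot> f = Id C x" "f \<cdot> g' = Id C y"
    by (auto intro!: comp_eqI[OF f g'(1) Id_Hom[OF O(1)]] comp_eqI[OF g'(1) f Id_Hom[OF O(2)]]
        simp: g'(2) g gf act_car[OF f] act_Id O)
  with f g'(1) show ?thesis
    by (auto simp: is_iso_def Hom_def)
qed

end

lemma Quiv_iso_if_bij:
  assumes "f \<in> Hom Quiv x y" "bij_betw (onV f) (Vert x) (Vert y)" "bij_betw (onE f) (Edge x) (Edge y)"
  shows "is_iso Quiv f"
  using assms(2,3)
  by (intro Quiv.iso_if_bij[OF assms(1)])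
    (auto simp: quiver_car_def quiver_act_def split: quiver_sort.split)

lemma IncHyp_iso_if_bij:
  assumes "f \<in> Hom IncHyp x y" "bij_betw (onHV f) (HVert x) (HVert y)"
    "bij_betw (onHE f) (HEdge x) (HEdge y)" "bij_betw (onI f) (Inc x) (Inc y)"
  shows "is_iso IncHyp f"
  using assms(2-4)
  by (intro IncHyp.iso_if_bij[OF assms(1)])
    (auto simp: ihyp_car_def ihyp_act_def split: ihyp_sort.split)

lemma Ups_faithful: "faithful_functor Quiv IncHyp Ups"
  unfolding faithful_functor_def
proof (intro conjI ballI inj_onI Ups_functor)
  fix a b :: "'a quiver" and f g
  assume f: "f \<in> Hom Quiv a b" and g: "g \<in> Hom Quiv a b" and eq: "FA Ups f = FA Ups g"
  show "f = g"
    using arg_cong[OF eq, of onHV] arg_cong[OF eq, of onI] by (intro quiver_hom_eqI[OF f g]) simp_all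
qed

text \<open>The tags keep the vertex function and the edge function of an arrow apart inside the one
  vertex function of its image.\<close>

lemma Ups_dia_faithful: "faithful_functor IncHyp Quiv Ups_dia"
  unfolding faithful_functor_def
proof (intro conjI ballI inj_onI Ups_dia_functor)
  fix a b :: "'a ihyp" and f g
  assume f: "f \<in> Hom IncHyp a b" and g: "g \<in> Hom IncHyp a b" and eq: "FA Ups_dia f = FA Ups_dia g"
  have V: "onV (FA Ups_dia f) v = onV (FA Ups_dia g) v" for v
    by (simp add: eq)
  show "f = g"
  proof (rule ihyp_hom_eqI[OF f g])
    show "onHV f v = onHV g v" if "v \<in> HVert a" for v
      using V[of "pr tag1 v"] that by (simp add: Hom_IncHypD[OF f] Hom_IncHypD[OF g])
    show "onHE f e = onHE g e" if "e \<in> HEdge a" for e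
      using V[of "pr tag2 e"] that by (simp add: Hom_IncHypD[OF f] Hom_IncHypD[OF g])
    show "onI f i = onI g i" for i
      using arg_cong[OF eq, of onE] by simp
  qed
qed

text \<open>\<open>Ups_star G\<close> has the pairs of a vertex and an edge of \<open>G\<close> as vertices. Hence it is empty if
  \<open>G\<close> has no edges, and it forgets how an arrow maps the vertices of such a \<open>G\<close>.\<close>

lemma Ups_star_not_faithful:
  "\<not> faithful_functor (IncHyp :: ('u::set_universe ihyp, 'u ihyp_hom) cat) Quiv Ups_star"
proof
  assume faithful: "faithful_functor (IncHyp :: ('u ihyp, 'u ihyp_hom) cat) Quiv Ups_star"
  define G :: "'u set \<Rightarrow> 'u ihyp" where
    "G V = \<lparr>HVert = V, HEdge = {}, Inc = {}, port = (\<lambda>i\<in>{}. i), att = (\<lambda>i\<in>{}. i)\<rparr>" for V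
  \<comment> \<open>\<open>f tag1\<close> and \<open>f tag2\<close> differ only in the image of the
    single vertex. Their images under \<open>Ups_star\<close> are arrows out of the empty quiver,
    hence equal.\<close>
  define f :: "'u \<Rightarrow> 'u ihyp_hom" where
    "f t = \<lparr>hdom = G {tag1}, hcod = G {tag1, tag2}, onHV = (\<lambda>v\<in>{tag1}. t),
      onHE = (\<lambda>e\<in>{}. e), onI = (\<lambda>i\<in>{}. i)\<rparr>" for t
  have "G V \<in> ihyps" if "finite V" for V
    using that by (auto simp: G_def ihyps_def small_finite)
  then have f: "f t \<in> Hom IncHyp (G {tag1}) (G {tag1, tag2})" if "t \<in> {tag1, tag2}" for t
    using that by (auto simp: Hom_IncHyp_iff f_def G_def)
  have "FA Ups_star (f tag1) = FA Ups_star (f tag2)"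
    by (rule quiver_hom_eqI[OF Ups_star_Hom Ups_star_Hom, OF f f])
      (auto simp: G_def elim!: ptimesE)
  then have "f tag1 = f tag2"
    using faithful f Hom_IncHypD(1,2)[OF f[of tag1]]
    by (auto simp: faithful_functor_def dest!: inj_onD)
  from arg_cong[OF this, of "\<lambda>f. onHV f tag1"] show False
    by (simp add: f_def)
qed

section \<open>Products and the Frobenius morphism\<close>

lemma hprod_cone_product:
  assumes G: "G \<in> ihyps" and H: "H \<in> ihyps" and "hprod_cone G H = (P, p1, p2)"
  shows "is_product IncHyp G H P p1 p2"
proof -
  have P: "P = hprod G H"
    and p1: "p1 = \<lparr>hdom = P, hcod = G, onHV = restrict pfst (HVert G \<otimes> HVert H),
      onHE = restrict pfst (HEdge G \<otimes> HEdge H), onI = restrict pfst (Inc G \<otimes> Inc H)\<rparr>"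
    and p2: "p2 = \<lparr>hdom = P, hcod = H, onHV = restrict psnd (HVert G \<otimes> HVert H),
      onHE = restrict psnd (HEdge G \<otimes> HEdge H), onI = restrict psnd (Inc G \<otimes> Inc H)\<rparr>"
    using assms(3) by (auto simp: hprod_cone_def)
  have "P \<in> ihyps"
    by (auto simp: P hprod_def ihyps_def small_ptimes ihypsD[OF G] ihypsD[OF H] elim!: ptimesE)
  then have "p1 \<in> Hom IncHyp P G" "p2 \<in> Hom IncHyp P H"
    using G H by (auto simp: Hom_IncHyp_iff p1 p2 P hprod_def ihypsD elim!: ptimesE)
  then have "IncHyp.pointwise_product G H P p1 p2"
    using G H by (auto simp: IncHyp.pointwise_product_def all_ihyp_sort ihyp_car_def ihyp_act_def
        p1 p2 P hprod_def intro!: ex1I[of _ "pr _ _"] elim!: ptimesE)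
  then show ?thesis
    by (simp add: IncHyp.product_iff)
qed

lemma qprod_cone_product:
  assumes Q: "Q \<in> quivers" and R: "R \<in> quivers" and "qprod_cone Q R = (P, p1, p2)"
  shows "is_product Quiv Q R P p1 p2"
proof -
  have P: "P = qprod Q R"
    and p1: "p1 = \<lparr>qdom = P, qcod = Q, onV = restrict pfst (Vert Q \<otimes> Vert R),
      onE = restrict pfst (Edge Q \<otimes> Edge R)\<rparr>"
    and p2: "p2 = \<lparr>qdom = P, qcod = R, onV = restrict psnd (Vert Q \<otimes> Vert R),
      onE = restrict psnd (Edge Q \<otimes> Edge R)\<rparr>"
    using assms(3) by (auto simp: qprod_cone_def)
  have "P \<in> quivers"
    by (auto simp: P qprod_def quivers_def small_ptimes quiversD[OF Q] quiversD[OF R] elim!: ptimesE)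
  then have "p1 \<in> Hom Quiv P Q" "p2 \<in> Hom Quiv P R"
    using Q R by (auto simp: Hom_Quiv_iff p1 p2 P qprod_def quiversD elim!: ptimesE)
  then have "Quiv.pointwise_product Q R P p1 p2"
    using Q R by (auto simp: Quiv.pointwise_product_def all_quiver_sort quiver_car_def quiver_act_def
        p1 p2 P qprod_def intro!: ex1I[of _ "pr _ _"] elim!: ptimesE)
  then show ?thesis
    by (simp add: Quiv.product_iff)
qed

definition Ups_frobenius :: "'u::set_universe quiver \<Rightarrow> 'u ihyp \<Rightarrow> 'u quiver_hom"
  where "Ups_frobenius Q G = \<lparr>qdom = Ups_dia_obj (hprod (Ups_obj Q) G), qcod = qprod Q (Ups_dia_obj G),
    onV = (\<lambda>z\<in>Vert (Ups_dia_obj (hprod (Ups_obj Q) G)).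
      pr (pfst (psnd z)) (pr (pfst z) (psnd (psnd z)))),
    onE = (\<lambda>i\<in>Edge Q \<otimes> Inc G. i)\<rparr>"

text \<open>The two equations prescribe the components of an arrow into the product
  \<open>T\<close>, so they have exactly one solution; it remains to verify that the explicit
  formula is an arrow and solves them.\<close>

lemma is_frobenius_morphism_iff:
  fixes Q :: "'u::set_universe quiver"
  assumes Q: "Q \<in> quivers" and G: "G \<in> ihyps"
  shows "is_frobenius_morphism IncHyp Quiv Ups_dia Ups Ups_counit Q G
    (hprod_cone (FO Ups Q) G) (qprod_cone Q (FO Ups_dia G)) h \<longleftrightarrow> h = Ups_frobenius Q G"
proof -
  obtain P p1 p2 where P: "hprod_cone (Ups_obj Q) G = (P, p1, p2)"
    by (metis prod_cases3)
  obtain T t1 t2 where T: "qprod_cone Q (Ups_dia_obj G) = (T, t1, t2)"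
    by (metis prod_cases3)
  note PP = hprod_cone_product[OF Ups_obj_ihyps[OF Q] G P]
  note TT = qprod_cone_product[OF Q Ups_dia_obj_quivers[OF G] T]
  have p: "P \<in> ihyps" "p1 \<in> Hom IncHyp P (Ups_obj Q)" "p2 \<in> Hom IncHyp P G"
    using PP by (simp_all add: is_product_def)
  have t: "T \<in> quivers" "t1 \<in> Hom Quiv T Q" "t2 \<in> Hom Quiv T (Ups_dia_obj G)"
    using TT by (simp_all add: is_product_def)
  note Lp1 = Quiv.Comp_Hom[OF Ups_dia_Hom[OF p(2)] Ups_counit_Hom[OF Q]]
  note Lp2 = Ups_dia_Hom[OF p(3)]
  have def: "P = hprod (Ups_obj Q) G" "T = qprod Q (Ups_dia_obj G)"
    and VP: "HVert P = Vert Q \<otimes> HVert G" "HEdge P = Vert Q \<otimes> HEdge G" "Inc P = Edge Q \<otimes> Inc G"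
    and VT: "Vert T = Vert Q \<otimes> Vert (Ups_dia_obj G)" "Edge T = Edge Q \<otimes> Inc G"
    and st: "e \<in> Edge Q \<Longrightarrow> i \<in> Inc G \<Longrightarrow> port P (pr e i) = pr (src Q e) (port G i)"
      "e \<in> Edge Q \<Longrightarrow> i \<in> Inc G \<Longrightarrow> att P (pr e i) = pr (tgt Q e) (att G i)"
      "e \<in> Edge Q \<Longrightarrow> i \<in> Inc G \<Longrightarrow> src T (pr e i) = pr (src Q e) (pr tag1 (port G i))"
      "e \<in> Edge Q \<Longrightarrow> i \<in> Inc G \<Longrightarrow> tgt T (pr e i) = pr (tgt Q e) (pr tag2 (att G i))"
    and proj: "\<And>v x. v \<in> Vert Q \<Longrightarrow> x \<in> HVert G \<Longrightarrow> onHV p1 (pr v x) = v \<and> onHV p2 (pr v x) = x"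
      "\<And>v x. v \<in> Vert Q \<Longrightarrow> x \<in> HEdge G \<Longrightarrow> onHE p1 (pr v x) = v \<and> onHE p2 (pr v x) = x"
      "\<And>e i. e \<in> Edge Q \<Longrightarrow> i \<in> Inc G \<Longrightarrow> onI p1 (pr e i) = e \<and> onI p2 (pr e i) = i"
      "\<And>v x. v \<in> Vert Q \<Longrightarrow> x \<in> Vert (Ups_dia_obj G) \<Longrightarrow> onV t1 (pr v x) = v \<and> onV t2 (pr v x) = x"
      "\<And>e i. e \<in> Edge Q \<Longrightarrow> i \<in> Inc G \<Longrightarrow> onE t1 (pr e i) = e \<and> onE t2 (pr e i) = i"
    for e i
    using P T by (auto simp: hprod_cone_def qprod_cone_def hprod_def qprod_def)
  let ?\<Phi> = "Ups_frobenius Q G"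
  have onV: "v \<in> Vert Q \<Longrightarrow> x \<in> HVert G \<Longrightarrow> onV ?\<Phi> (pr tag1 (pr v x)) = pr v (pr tag1 x)"
    "v \<in> Vert Q \<Longrightarrow> x \<in> HEdge G \<Longrightarrow> onV ?\<Phi> (pr tag2 (pr v x)) = pr v (pr tag2 x)"
    "e \<in> Edge Q \<otimes> Inc G \<Longrightarrow> onE ?\<Phi> e = e" for v x e
    by (simp_all add: Ups_frobenius_def VP flip: def)
  have \<Phi>: "?\<Phi> \<in> Hom Quiv (Ups_dia_obj P) T"
    using t(1) Ups_dia_obj_quivers[OF p(1)]
    by (auto simp: Hom_Quiv_iff VP VT onV st quiversD[OF Q] ihypsD[OF G] PiE_iff extensional_def
        elim!: Vert_Ups_diaE ptimesE) (auto simp: Ups_frobenius_def VP simp flip: def)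
  have "t1 \<cdot>\<^bsub>Quiv\<^esub> ?\<Phi> = Ups_counit Q \<cdot>\<^bsub>Quiv\<^esub> FA Ups_dia p1"
    by (rule quiver_hom_eqI[OF Quiv.Comp_Hom[OF \<Phi> t(2)] Lp1])
      (auto simp: VP onV proj Hom_QuivD[OF \<Phi>] Hom_IncHypD[OF p(2)] elim!: Vert_Ups_diaE ptimesE)
  moreover have "t2 \<cdot>\<^bsub>Quiv\<^esub> ?\<Phi> = FA Ups_dia p2"
    by (rule quiver_hom_eqI[OF Quiv.Comp_Hom[OF \<Phi> t(3)] Lp2])
      (auto simp: VP onV proj Hom_QuivD[OF \<Phi>] Hom_IncHypD[OF p(3)] elim!: Vert_Ups_diaE ptimesE)
  moreover have "\<exists>!h. h \<in> Hom Quiv (Ups_dia_obj P) T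
      \<and> t1 \<cdot>\<^bsub>Quiv\<^esub> h = Ups_counit Q \<cdot>\<^bsub>Quiv\<^esub> FA Ups_dia p1 \<and> t2 \<cdot>\<^bsub>Quiv\<^esub> h = FA Ups_dia p2"
    using TT Lp1 Lp2 Ups_dia_obj_quivers[OF p(1)] by (simp add: is_product_def)
  ultimately have "h \<in> Hom Quiv (Ups_dia_obj P) T
      \<and> t1 \<cdot>\<^bsub>Quiv\<^esub> h = Ups_counit Q \<cdot>\<^bsub>Quiv\<^esub> FA Ups_dia p1 \<and> t2 \<cdot>\<^bsub>Quiv\<^esub> h = FA Ups_dia p2
      \<longleftrightarrow> h = ?\<Phi>"
    using \<Phi> by metis
  moreover have "\<exists>\<eta>. adjunction IncHyp Quiv Ups_dia Ups \<eta> (Ups_counit :: 'u quiver \<Rightarrow> _)"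
    using Ups_dia_adjunction by blast
  ultimately show ?thesis
    using PP TT by (simp add: is_frobenius_morphism_def P T)
qed

section \<open>The slice over the directed path of length 1\<close>

lemma is_functor_Id: "is_functor C D F \<Longrightarrow> a \<in> Obj C \<Longrightarrow> FA F (Id C a) = Id D (FO F a)"
  by (simp add: is_functor_def)

lemma slice_simps [simp]:
  "Obj (slice C x) = {f \<in> Arr C. Cod C f = x}"
  "Dom (slice C x) (f, h, g) = f" "Cod (slice C x) (f, h, g) = g"
  "Id (slice C x) f = (f, Id C (Dom C f), f)"
  "(f', h', g') \<cdot>\<^bsub>slice C x\<^esub> (f, h, g) = (f, h' \<cdot>\<^bsub>C\<^esub> h, g')"
  by (simp_all add: slice_def)

lemma Arr_slice_iff:
  "(f, h, g) \<in> Arr (slice C x) \<longleftrightarrow> f \<in> Arr C \<and> Cod C f = x \<and> g \<in> Arr C \<and> Cod C g = x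
    \<and> h \<in> Hom C (Dom C f) (Dom C g) \<and> g \<cdot>\<^bsub>C\<^esub> h = f"
  by (simp add: slice_def)

lemma Hom_sliceE:
  assumes "u \<in> Hom (slice C x) f g"
  obtains h where "u = (f, h, g)" "f \<in> Hom C (Dom C f) x" "g \<in> Hom C (Dom C g) x"
    "h \<in> Hom C (Dom C f) (Dom C g)" "g \<cdot>\<^bsub>C\<^esub> h = f"
  using assms by (cases u) (auto simp: Hom_def Arr_slice_iff)

lemma Hom_sliceI:
  "f \<in> Hom C a x \<Longrightarrow> g \<in> Hom C b x \<Longrightarrow> h \<in> Hom C a b \<Longrightarrow> g \<cdot>\<^bsub>C\<^esub> h = f
    \<Longrightarrow> (f, h, g) \<in> Hom (slice C x) f g"
  by (auto simp: Hom_def Arr_slice_iff)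

context category begin

lemma category_slice: "category (slice C x)"
proof
  show "Dom (slice C x) u \<in> Obj (slice C x)" "Cod (slice C x) u \<in> Obj (slice C x)"
    if "u \<in> Arr (slice C x)" for u
    using that by (cases u; simp add: Arr_slice_iff)+
  show "Id (slice C x) f \<in> Hom (slice C x) f f" if "f \<in> Obj (slice C x)" for f
  proof -
    have f: "f \<in> Hom C (Dom C f) x"
      using that by (simp add: Hom_def)
    then show ?thesis
      using that by (simp, intro Hom_sliceI[OF f f Id_Hom Id_right[OF f]]) (simp add: Dom_Obj)
  qed
  show "v \<cdot>\<^bsub>slice C x\<^esub> u \<in> Hom (slice C x) f f''"
    if u: "u \<in> Hom (slice C x) f f'" and v: "v \<in> Hom (slice C x) f' f''" for u v f f' f''
    using u
  proof (rule Hom_sliceE)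
    fix h assume h: "u = (f, h, f')" "f \<in> Hom C (Dom C f) x" "h \<in> Hom C (Dom C f) (Dom C f')"
      "f' \<cdot> h = f"
    from v show ?thesis
    proof (rule Hom_sliceE)
      fix h' assume h': "v = (f', h', f'')" "f'' \<in> Hom C (Dom C f'') x"
        "h' \<in> Hom C (Dom C f') (Dom C f'')" "f'' \<cdot> h' = f'"
      show ?thesis
        unfolding h(1) h'(1) slice_simps
        using h h' Comp_assoc[OF h(3) h'(3,2)]
        by (intro Hom_sliceI[OF h(2) h'(2) Comp_Hom[OF h(3) h'(3)]]) simp
    qed
  qed
qed (auto elim!: Hom_sliceE intro: Id_left Id_right Comp_assoc)

text \<open>Composing \<open>g \<cdot> h = f\<close> with the inverse of \<open>h\<close> shows that
  this inverse is also an arrow over \<open>x\<close>.\<close>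

lemma is_iso_slice:
  assumes u: "(f, h, g) \<in> Arr (slice C x)" and iso: "is_iso C h"
  shows "is_iso (slice C x) (f, h, g)"
proof -
  have f: "f \<in> Hom C (Dom C f) x" and g: "g \<in> Hom C (Dom C g) x"
    and h: "h \<in> Hom C (Dom C f) (Dom C g)" and gh: "g \<cdot> h = f"
    using u by (auto simp: Arr_slice_iff Hom_def)
  then obtain k where k: "k \<in> Hom C (Dom C g) (Dom C f)" "k \<cdot> h = Id C (Dom C f)" "h \<cdot> k = Id C (Dom C g)"
    using iso by (auto simp: is_iso_def Hom_def)
  have "f \<cdot> k = g"
    using Comp_assoc[OF k(1) h g] Id_right[OF g] k(3) gh by simp
  then have "(g, k, f) \<in> Hom (slice C x) g f"
    by (rule Hom_sliceI[OF g f k(1)])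
  with u k(2,3) show ?thesis
    unfolding is_iso_def by (intro conjI bexI[of _ "(g, k, f)"]) simp_all
qed

end

section \<open>Incidence hypergraphs as quivers over \<open>dipath1\<close>\<close>

text \<open>An arrow between quivers of the form \<open>Ups_dia_obj G\<close> may send an isolated
  vertex to one with the other tag. Lying over \<open>dipath1\<close> excludes this. The value
  \<open>tag1\<close> on incidences is the code of the only edge of \<open>dipath1\<close>.\<close>

definition tagging :: "'u::set_universe ihyp \<Rightarrow> 'u quiver_hom"
  where "tagging G = \<lparr>qdom = Ups_dia_obj G, qcod = dipath1, onV = restrict pfst (Vert (Ups_dia_obj G)),
    onE = (\<lambda>i\<in>Inc G. tag1)\<rparr>"

definition to_slice ::
  "('u::set_universe ihyp, 'u ihyp_hom, 'u quiver_hom, 'u quiver_hom \<times> 'u quiver_hom \<times> 'u quiver_hom) functr"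
  where "to_slice = \<lparr>FO = tagging, FA = (\<lambda>f. (tagging (hdom f), FA Ups_dia f, tagging (hcod f)))\<rparr>"

text \<open>A quiver over \<open>dipath1\<close> is bipartite, with every edge running from the
  fibre over \<open>tag1\<close> to the fibre over \<open>tag2\<close>. Hence its source and target
  maps can serve as \<open>port\<close> and \<open>att\<close>.\<close>

definition fibres :: "'u::set_universe quiver_hom \<Rightarrow> 'u ihyp"
  where "fibres p = \<lparr>HVert = {v \<in> Vert (qdom p). onV p v = tag1},
    HEdge = {v \<in> Vert (qdom p). onV p v = tag2}, Inc = Edge (qdom p),
    port = src (qdom p), att = tgt (qdom p)\<rparr>"

definition from_slice ::
  "('u::set_universe quiver_hom, 'u quiver_hom \<times> 'u quiver_hom \<times> 'u quiver_hom, 'u ihyp, 'u ihyp_hom) functr"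
  where "from_slice = \<lparr>FO = fibres, FA = (\<lambda>(p, f, q). \<lparr>hdom = fibres p, hcod = fibres q,
    onHV = restrict (onV f) (HVert (fibres p)), onHE = restrict (onV f) (HEdge (fibres p)),
    onI = restrict (onE f) (Inc (fibres p))\<rparr>)\<rparr>"

lemma to_slice_simps [simp]:
  "FO to_slice G = tagging G" "FA to_slice f = (tagging (hdom f), FA Ups_dia f, tagging (hcod f))"
  by (simp_all add: to_slice_def)

lemma from_slice_simps [simp]:
  "FO from_slice p = fibres p"
  "hdom (FA from_slice (p, f, q)) = fibres p" "hcod (FA from_slice (p, f, q)) = fibres q"
  "v \<in> HVert (fibres p) \<Longrightarrow> onHV (FA from_slice (p, f, q)) v = onV f v"
  "v \<in> HEdge (fibres p) \<Longrightarrow> onHE (FA from_slice (p, f, q)) v = onV f v"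
  "e \<in> Edge (qdom p) \<Longrightarrow> onI (FA from_slice (p, f, q)) e = onE f e"
  by (simp_all add: from_slice_def fibres_def)

lemma tagging_simps [simp]:
  "qdom (tagging G) = Ups_dia_obj G" "qcod (tagging G) = dipath1"
  "v \<in> HVert G \<Longrightarrow> onV (tagging G) (pr tag1 v) = tag1"
  "e \<in> HEdge G \<Longrightarrow> onV (tagging G) (pr tag2 e) = tag2"
  "i \<in> Inc G \<Longrightarrow> onE (tagging G) i = tag1"
  by (simp_all add: tagging_def)

lemma fibres_simps [simp]:
  "v \<in> HVert (fibres p) \<longleftrightarrow> v \<in> Vert (qdom p) \<and> onV p v = tag1"
  "v \<in> HEdge (fibres p) \<longleftrightarrow> v \<in> Vert (qdom p) \<and> onV p v = tag2"
  "Inc (fibres p) = Edge (qdom p)" "port (fibres p) = src (qdom p)" "att (fibres p) = tgt (qdom p)"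
  by (simp_all add: fibres_def)

lemma dipath1_quivers: "dipath1 \<in> quivers"
  by (auto simp: dipath1_def quivers_def small_finite)

lemma Vert_dipath1: "v \<in> Vert dipath1 \<longleftrightarrow> v = tag1 \<or> v = tag2"
  by (simp add: dipath1_def)

lemma Edge_dipath1: "e \<in> Edge dipath1 \<longleftrightarrow> e = tag1"
  by (simp add: dipath1_def)

lemma tagging_Hom: "G \<in> ihyps \<Longrightarrow> tagging G \<in> Hom Quiv (Ups_dia_obj G) dipath1"
  by (auto simp: Hom_Quiv_iff dipath1_quivers Ups_dia_obj_quivers ihypsD PiE_iff extensional_def
      elim!: Vert_Ups_diaE) (auto simp: tagging_def dipath1_def ihypsD elim!: Vert_Ups_diaE)

lemma fibres_ends:
  assumes p: "p \<in> Hom Quiv x dipath1" and e: "e \<in> Edge x"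
  shows "onV p (src x e) = tag1" "onV p (tgt x e) = tag2"
  using Hom_QuivD(6-8)[OF p e] by (simp_all add: dipath1_def)

lemma fibres_ihyps:
  assumes p: "p \<in> Hom Quiv x dipath1" shows "fibres p \<in> ihyps"
proof -
  note D = Hom_QuivD(1-4)[OF p]
  have "small {v \<in> Vert x. onV p v = t}" for t
    by (rule small_subset[OF _ quiversD(1)[OF D(1)]]) blast
  then show ?thesis
    using D(1) by (auto simp: fibres_def ihyps_def D quivers_def PiE_iff fibres_ends[OF p])
qed

lemma to_slice_functor: "is_functor IncHyp (slice Quiv dipath1) to_slice"
proof (rule is_functorI)
  show "FO to_slice a \<in> Obj (slice Quiv dipath1)" if "a \<in> Obj IncHyp" for a :: "'a ihyp"
    using tagging_Hom[of a] that by (simp add: Hom_def)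
  show "FA to_slice f \<in> Hom (slice Quiv dipath1) (FO to_slice a) (FO to_slice b)"
    if f: "f \<in> Hom IncHyp a b" for f and a b :: "'a ihyp"
  proof -
    note D = Hom_IncHypD[OF f]
    have "tagging b \<cdot>\<^bsub>Quiv\<^esub> FA Ups_dia f = tagging a"
      by (rule quiver_hom_eqI[OF Quiv.Comp_Hom[OF Ups_dia_Hom[OF f] tagging_Hom[OF D(2)]]
            tagging_Hom[OF D(1)]]) (auto simp: D elim!: Vert_Ups_diaE)
    then show ?thesis
      unfolding to_slice_simps D(3,4)
      by (rule Hom_sliceI[OF tagging_Hom[OF D(1)] tagging_Hom[OF D(2)] Ups_dia_Hom[OF f]])
  qed
  show "FA to_slice (Id IncHyp a) = Id (slice Quiv dipath1) (FO to_slice a)"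
    if "a \<in> Obj IncHyp" for a :: "'a ihyp"
    using that by (simp add: is_functor_Id[OF Ups_dia_functor])
  show "FA to_slice (g \<cdot>\<^bsub>IncHyp\<^esub> f) = FA to_slice g \<cdot>\<^bsub>slice Quiv dipath1\<^esub> FA to_slice f"
    if f: "f \<in> Hom IncHyp a b" and g: "g \<in> Hom IncHyp b c" for g f and a b c :: "'a ihyp"
    by (simp add: is_functor_Comp[OF Ups_dia_functor f g])
qed (simp_all add: Quiv.category_slice IncHyp.category_axioms)

lemma from_slice_Hom:
  assumes p: "p \<in> Hom Quiv x dipath1" and q: "q \<in> Hom Quiv y dipath1" and f: "f \<in> Hom Quiv x y"
    and qf: "q \<cdot>\<^bsub>Quiv\<^esub> f = p"
  shows "FA from_slice (p, f, q) \<in> Hom IncHyp (fibres p) (fibres q)"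
proof -
  note D = Hom_QuivD[OF f] Hom_QuivD(3,4)[OF p] Hom_QuivD(3,4)[OF q]
  \<comment> \<open>The triangle over \<open>dipath1\<close> makes \<open>f\<close> preserve both
    fibres, so its vertex function splits into a function on vertices and one on edges.\<close>
  have "onV q (onV f v) = onV p v" if "v \<in> Vert x" for v
    using that by (simp add: D flip: qf)
  then show ?thesis
    unfolding from_slice_def functr.simps prod.case
    by (intro ihyp_homI fibres_ihyps[OF p] fibres_ihyps[OF q]) (auto simp: D)
qed

lemma from_slice_functor: "is_functor (slice Quiv dipath1) IncHyp from_slice"
proof (rule is_functorI)
  have Hom: "p \<in> Hom Quiv (qdom p) dipath1" if "p \<in> Obj (slice Quiv dipath1)" for p :: "'a quiver_hom"
    using that by (simp add: Hom_def)
  show "FO from_slice p \<in> Obj IncHyp" if "p \<in> Obj (slice Quiv dipath1)" for p :: "'a quiver_hom"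
    using fibres_ihyps[OF Hom[OF that]] by simp
  show "FA from_slice u \<in> Hom IncHyp (FO from_slice p) (FO from_slice q)"
    if "u \<in> Hom (slice Quiv dipath1) p q" for u and p q :: "'a quiver_hom"
    using that by (rule Hom_sliceE) (simp add: from_slice_Hom)
  show "FA from_slice (Id (slice Quiv dipath1) p) = Id IncHyp (FO from_slice p)" for p :: "'a quiver_hom"
    by (auto simp: from_slice_def Id_IncHyp Id_Quiv fibres_def restrict_def fun_eq_iff)
  show "FA from_slice (v \<cdot>\<^bsub>slice Quiv dipath1\<^esub> u) = FA from_slice v \<cdot>\<^bsub>IncHyp\<^esub> FA from_slice u"
    if u: "u \<in> Hom (slice Quiv dipath1) p q" and v: "v \<in> Hom (slice Quiv dipath1) q r"
    for u v and p q r :: "'a quiver_hom"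
    using u
  proof (rule Hom_sliceE)
    fix f assume f: "u = (p, f, q)" "p \<in> Hom Quiv (Dom Quiv p) dipath1"
      "f \<in> Hom Quiv (Dom Quiv p) (Dom Quiv q)" "q \<cdot>\<^bsub>Quiv\<^esub> f = p"
    have qf: "onV q (onV f w) = onV p w" if "w \<in> Vert (qdom p)" for w
      using arg_cong[OF f(4), of "\<lambda>u. onV u w"] that Hom_QuivD(3)[OF f(3)] by simp
    from v show ?thesis
      by (rule Hom_sliceE)
        (auto simp: f(1) from_slice_def Comp_IncHyp Comp_Quiv fibres_def restrict_def fun_eq_iff
          Hom_QuivD[OF f(3), simplified] qf)
  qed
qed (simp_all add: Quiv.category_slice IncHyp.category_axioms)

definition fibres_unit :: "'u::set_universe ihyp \<Rightarrow> 'u ihyp_hom"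
  where "fibres_unit G = \<lparr>hdom = G, hcod = fibres (tagging G), onHV = restrict (pr tag1) (HVert G),
    onHE = restrict (pr tag2) (HEdge G), onI = (\<lambda>i\<in>Inc G. i)\<rparr>"

definition tagging_counit :: "'u::set_universe quiver_hom \<Rightarrow> 'u quiver_hom"
  where "tagging_counit p = \<lparr>qdom = Ups_dia_obj (fibres p), qcod = qdom p,
    onV = restrict psnd (Vert (Ups_dia_obj (fibres p))), onE = (\<lambda>e\<in>Edge (qdom p). e)\<rparr>"

lemma fibres_unit_simps [simp]:
  "hdom (fibres_unit G) = G" "hcod (fibres_unit G) = fibres (tagging G)"
  "v \<in> HVert G \<Longrightarrow> onHV (fibres_unit G) v = pr tag1 v"
  "e \<in> HEdge G \<Longrightarrow> onHE (fibres_unit G) e = pr tag2 e"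
  "i \<in> Inc G \<Longrightarrow> onI (fibres_unit G) i = i"
  by (simp_all add: fibres_unit_def)

lemma tagging_counit_simps [simp]:
  "qdom (tagging_counit p) = Ups_dia_obj (fibres p)" "qcod (tagging_counit p) = qdom p"
  "v \<in> HVert (fibres p) \<Longrightarrow> onV (tagging_counit p) (pr tag1 v) = v"
  "v \<in> HEdge (fibres p) \<Longrightarrow> onV (tagging_counit p) (pr tag2 v) = v"
  "e \<in> Edge (qdom p) \<Longrightarrow> onE (tagging_counit p) e = e"
  by (simp_all add: tagging_counit_def)

lemma fibres_unit_Hom: "G \<in> ihyps \<Longrightarrow> fibres_unit G \<in> Hom IncHyp G (fibres (tagging G))"
  unfolding fibres_unit_def using fibres_ihyps[OF tagging_Hom]
  by (intro ihyp_homI) simp_all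

lemma fibres_unit_iso: "G \<in> ihyps \<Longrightarrow> is_iso IncHyp (fibres_unit G)"
  by (rule IncHyp_iso_if_bij[OF fibres_unit_Hom])
    (auto simp: bij_betw_def inj_on_def image_iff elim!: Vert_Ups_diaE)

lemma tagging_counit_Hom:
  assumes p: "p \<in> Hom Quiv x dipath1"
  shows "tagging_counit p \<in> Hom Quiv (Ups_dia_obj (fibres p)) x"
proof -
  note D = Hom_QuivD(1-4)[OF p]
  show ?thesis
    unfolding tagging_counit_def D(3)
    by (rule quiver_homI[of "Ups_dia_obj (fibres p)" x psnd "\<lambda>e. e",
          unfolded Ups_dia_simps(2) fibres_simps(3) D(3)])
      (auto simp: D Ups_dia_obj_quivers fibres_ihyps[OF p] elim!: Vert_Ups_diaE)
qed

lemma tagging_counit_iso: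
  assumes p: "p \<in> Hom Quiv x dipath1"
  shows "is_iso Quiv (tagging_counit p)"
proof (rule Quiv_iso_if_bij[OF tagging_counit_Hom[OF p]])
  note D = Hom_QuivD(1-5)[OF p]
  have tags: "onV p v = tag1 \<or> onV p v = tag2" if "v \<in> Vert x" for v
    using D(5)[OF that] by (simp add: Vert_dipath1)
  \<comment> \<open>The inverse of the counit restores the tag of a vertex \<open>v\<close>: it is
    the value of \<open>p\<close> at \<open>v\<close>.\<close>
  have "onV (tagging_counit p) (pr (onV p v) v) = v" if "v \<in> Vert x" for v
    using tags[OF that] that D(3) by auto
  with tags show "bij_betw (onV (tagging_counit p)) (Vert (Ups_dia_obj (fibres p))) (Vert x)"
    by (intro bij_betw_byWitness[where f' = "\<lambda>v. pr (onV p v) v"])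
      (auto simp: D elim!: Vert_Ups_diaE)
  show "bij_betw (onE (tagging_counit p)) (Edge (Ups_dia_obj (fibres p))) (Edge x)"
    by (auto simp: D bij_betw_def inj_on_def image_iff)
qed

lemma tagging_counit_comp:
  assumes p: "p \<in> Hom Quiv x dipath1"
  shows "p \<cdot>\<^bsub>Quiv\<^esub> tagging_counit p = tagging (fibres p)"
proof (rule quiver_hom_eqI[OF Quiv.Comp_Hom[OF tagging_counit_Hom[OF p] p]
      tagging_Hom[OF fibres_ihyps[OF p]]])
  note D = Hom_QuivD(1-6)[OF p]
  \<comment> \<open>Both sides lie in the one-element edge set of \<open>dipath1\<close>.\<close>
  show "onE (p \<cdot>\<^bsub>Quiv\<^esub> tagging_counit p) e = onE (tagging (fibres p)) e"
    if "e \<in> Edge (Ups_dia_obj (fibres p))" for e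
    using D(6)[of e] that by (simp add: D(1-4) Edge_dipath1)
qed (auto elim!: Vert_Ups_diaE)

lemma IncHyp_equivalent_slice:
  "equivalent_categories (IncHyp :: ('u::set_universe ihyp, 'u ihyp_hom) cat)
    (slice (Quiv :: ('u quiver, 'u quiver_hom) cat) dipath1)"
proof -
  let ?I = "IncHyp :: ('u ihyp, 'u ihyp_hom) cat"
  let ?S = "slice (Quiv :: ('u quiver, 'u quiver_hom) cat) dipath1"
  \<comment> \<open>The counit of quivers becomes an arrow of the slice; it is invertible there
    because its middle component is invertible in \<open>Quiv\<close>.\<close>
  define t where "t p = (tagging (fibres p), tagging_counit p, p)" for p :: "'u quiver_hom"
  have "natural_trans ?I ?I idfun (fcomp from_slice to_slice) fibres_unit"
  proof (rule natural_transI)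
    fix f and a b :: "'u ihyp" assume f: "f \<in> Hom IncHyp a b"
    note D = Hom_IncHypD[OF f]
    have "FA from_slice (FA to_slice f) \<in> Hom IncHyp (fibres (tagging a)) (fibres (tagging b))"
      using is_functor_Hom[OF from_slice_functor is_functor_Hom[OF to_slice_functor f]] by simp
    note H = IncHyp.Comp_Hom[OF f fibres_unit_Hom[OF D(2)]]
      IncHyp.Comp_Hom[OF fibres_unit_Hom[OF D(1)] this]
    show "fibres_unit b \<cdot>\<^bsub>IncHyp\<^esub> FA idfun f = FA (fcomp from_slice to_slice) f \<cdot>\<^bsub>IncHyp\<^esub> fibres_unit a"
      unfolding fcomp_simps idfun_simps by (rule ihyp_hom_eqI[OF H]) (simp_all add: D)
  qed (simp_all add: is_functor_idfun IncHyp.category_axioms fibres_unit_Hom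
      is_functor_fcomp[OF to_slice_functor from_slice_functor])
  then have s: "natural_iso ?I ?I idfun (fcomp from_slice to_slice) fibres_unit"
    by (simp add: natural_iso_def fibres_unit_iso)
  have tH: "t p \<in> Hom ?S (tagging (fibres p)) p" if p: "p \<in> Hom Quiv x dipath1" for p x
    unfolding t_def
    by (rule Hom_sliceI[OF tagging_Hom[OF fibres_ihyps[OF p]] p tagging_counit_Hom[OF p]
          tagging_counit_comp[OF p]])
  have Hom: "p \<in> Hom Quiv (qdom p) dipath1" if "p \<in> Obj ?S" for p :: "'u quiver_hom"
    using that by (simp add: Hom_def)
  have "natural_trans ?S ?S (fcomp to_slice from_slice) idfun t"
  proof (rule natural_transI)
    fix u and p q :: "'u quiver_hom" assume u: "u \<in> Hom ?S p q"
    then show "t q \<cdot>\<^bsub>?S\<^esub> FA (fcomp to_slice from_slice) u = FA idfun u \<cdot>\<^bsub>?S\<^esub> t p"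
    proof (rule Hom_sliceE)
      fix f assume f: "u = (p, f, q)" "p \<in> Hom Quiv (Dom Quiv p) dipath1"
        "q \<in> Hom Quiv (Dom Quiv q) dipath1" "f \<in> Hom Quiv (Dom Quiv p) (Dom Quiv q)"
        "q \<cdot>\<^bsub>Quiv\<^esub> f = p"
      note D = Hom_QuivD[OF f(4), simplified]
      have qf: "onV q (onV f w) = onV p w" if "w \<in> Vert (qdom p)" for w
        using arg_cong[OF f(5), of "\<lambda>u. onV u w"] that D(3) by simp
      have "tagging_counit q \<cdot>\<^bsub>Quiv\<^esub> FA Ups_dia (FA from_slice u) = f \<cdot>\<^bsub>Quiv\<^esub> tagging_counit p"
        unfolding f(1)
        by (rule quiver_hom_eqI[OF Quiv.Comp_Hom[OF Ups_dia_Hom[OF from_slice_Hom[OF f(2-5)]]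
                tagging_counit_Hom[OF f(3)]] Quiv.Comp_Hom[OF tagging_counit_Hom[OF f(2)] f(4)]])
          (auto simp: D qf elim!: Vert_Ups_diaE)
      then show ?thesis
        by (simp add: t_def f(1))
    qed
  qed (simp_all add: is_functor_idfun Quiv.category_slice tH[OF Hom]
      is_functor_fcomp[OF from_slice_functor to_slice_functor])
  moreover have "is_iso ?S (t p)" if p: "p \<in> Obj ?S" for p
    using tH[OF Hom[OF p]] tagging_counit_iso[OF Hom[OF p]]
    unfolding t_def by (intro Quiv.is_iso_slice) (simp_all add: Hom_def)
  ultimately have "natural_iso ?S ?S (fcomp to_slice from_slice) idfun t"
    by (simp add: natural_iso_def)
  with s show ?thesis
    unfolding equivalent_categories_def
    by (intro exI[of _ to_slice] exI[of _ from_slice] exI[of _ fibres_unit] exI[of _ t] conjI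
        to_slice_functor from_slice_functor)
qed

theorem mainTheorem18:
  shows "(\<forall>Q \<in> Obj (Quiv :: ('u::set_universe quiver, 'u quiver_hom) cat).
          \<forall>G \<in> Obj (IncHyp :: ('u ihyp, 'u ihyp_hom) cat).
            \<exists>\<Phi>. (\<forall>h. is_frobenius_morphism IncHyp Quiv Ups_dia Ups Ups_counit Q G
                       (hprod_cone (FO Ups Q) G) (qprod_cone Q (FO Ups_dia G)) h \<longleftrightarrow> h = \<Phi>)
              \<and> (\<forall>v \<in> Vert Q. \<forall>x \<in> HVert G. onV \<Phi> (pr tag1 (pr v x)) = pr v (pr tag1 x))
              \<and> (\<forall>v \<in> Vert Q. \<forall>x \<in> HEdge G. onV \<Phi> (pr tag2 (pr v x)) = pr v (pr tag2 x))
              \<and> onE \<Phi> = (\<lambda>i \<in> Edge Q \<otimes> Inc G. i))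
    \<and> geom_atomic (IncHyp :: ('u ihyp, 'u ihyp_hom) cat)
        (Quiv :: ('u quiver, 'u quiver_hom) cat) Ups_dia Ups Ups_star
    \<and> geom_surjection (IncHyp :: ('u ihyp, 'u ihyp_hom) cat)
        (Quiv :: ('u quiver, 'u quiver_hom) cat) Ups_dia Ups Ups_star
    \<and> \<not> geom_embedding (IncHyp :: ('u ihyp, 'u ihyp_hom) cat)
        (Quiv :: ('u quiver, 'u quiver_hom) cat) Ups_dia Ups Ups_star
    \<and> faithful_functor (IncHyp :: ('u ihyp, 'u ihyp_hom) cat)
        (Quiv :: ('u quiver, 'u quiver_hom) cat) Ups_dia
    \<and> equivalent_categories (IncHyp :: ('u ihyp, 'u ihyp_hom) cat)
        (slice (Quiv :: ('u quiver, 'u quiver_hom) cat) dipath1)"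
proof (intro conjI ballI)
  show "\<exists>\<Phi>. (\<forall>h. is_frobenius_morphism IncHyp Quiv Ups_dia Ups Ups_counit Q G
                  (hprod_cone (FO Ups Q) G) (qprod_cone Q (FO Ups_dia G)) h \<longleftrightarrow> h = \<Phi>)
      \<and> (\<forall>v \<in> Vert Q. \<forall>x \<in> HVert G. onV \<Phi> (pr tag1 (pr v x)) = pr v (pr tag1 x))
      \<and> (\<forall>v \<in> Vert Q. \<forall>x \<in> HEdge G. onV \<Phi> (pr tag2 (pr v x)) = pr v (pr tag2 x))
      \<and> onE \<Phi> = (\<lambda>i \<in> Edge Q \<otimes> Inc G. i)"
    if "Q \<in> Obj Quiv" "G \<in> Obj IncHyp" for Q :: "'u quiver" and G :: "'u ihyp"
    using that is_frobenius_morphism_iff[of Q G]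
    by (intro exI[of _ "Ups_frobenius Q G"]) (auto simp: Ups_frobenius_def hprod_def)
  have egm: "essential_geometric_morphism (IncHyp :: ('u ihyp, 'u ihyp_hom) cat) Quiv Ups_dia Ups Ups_star"
    unfolding essential_geometric_morphism_def left_adjoint_def
    using IncHyp.topos Quiv.topos Ups_dia_adjunction Ups_star_adjunction by blast
  then show "geom_atomic (IncHyp :: ('u ihyp, 'u ihyp_hom) cat) Quiv Ups_dia Ups Ups_star"
    "geom_surjection (IncHyp :: ('u ihyp, 'u ihyp_hom) cat) Quiv Ups_dia Ups Ups_star"
    by (simp_all add: geom_atomic_def geom_surjection_def Ups.logical Ups_faithful)
\<comment> \<open>An embedding would require \<open>Ups_star\<close> to be faithful, which already
  fails.\<close>
qed (simp_all add: geom_embedding_def Ups_star_not_faithful Ups_dia_faithful IncHyp_equivalent_slice)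

end
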